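(* Let $X$ be a set of taxa and let $\sigma^+=(\psi^+,\lambda^+)$ be a rooted binary metric species tree on $X$. If $|X|\ge 5$, then the distribution $\mathbb P_{\sigma^+}$ of unrooted topological gene trees under the multispecies coalescent model, with one lineage sampled per taxon, determines the rooted metric species tree $\sigma^+$: if $\sigma_1^+,\sigma_2^+$ are rooted binary metric species trees on $X$ with $\mathbb P_{\sigma_1^+}=\mathbb P_{\sigma_2^+}$, then $\sigma_1^+=\sigma_2^+$. This means equal rooted leaf-labeled topologies and equal lengths on all internal edges. If $|X|=4$, then $\mathbb P_{\sigma^+}$ determines the unrooted metric species tree $\sigma^-$, but does not determine $\sigma^+$: there exist rooted binary metric species trees $\sigma_1^+\neq\sigma_2^+$ on $X$ with $\mathbb P_{\sigma_1^+}=\mathbb P_{\sigma_2^+}$.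
   Context: Let $X$ be a finite set of $n$ taxa. A rooted binary metric species tree on $X$ is a pair $\sigma^+=(\psi^+,\lambda^+)$. Here $\psi^+$ is a rooted binary tree topology whose leaves are bijectively labeled by $X$, and $\lambda^+$ assigns a strictly positive length, in coalescent units, to each of its $n-2$ internal (non-pendant) edges. Pendant edge lengths are not specified. Multispecies coalescent model with one lineage per taxon. Each edge of the species tree is a population, and there is additionally a population above the root of infinite duration. One gene lineage starts at each leaf, and no coalescence occurs on pendant edges. Going backward in time, the lineages entering an internal edge are those exiting its child edges. Within that edge, during a time equal to its length, each pair of the lineages currently present coalesces at rate 1, so with $i$ lineages the total coalescence rate is $\binom{i}{2}$ and the merging pair is uniformly random. In the population above the root, lineages coalesce in the same way until one remains. This yields a random rooted binary gene tree whose leaves are labeled by the taxa (gene $A$ sampled from taxon $a$, etc.). Forgetting the root gives an unrooted binary leaf-labeled topological gene tree. $\mathbb P_{\sigma^+}$ denotes the resulting probability distribution on the set $\mathcal T_X$ of unrooted binary leaf-labeled tree topologies on $X$. The unrooted metric species tree $\sigma^-=(\psi^-,\lambda^-)$ is obtained from $\sigma^+$ by suppressing the root: - $\psi^-$ is the underlying unrooted leaf-labeled topology. - If the root is incident to two internal edges, these merge into one internal edge whose length is the sum of their lengths. - If the root is incident to a pendant edge, the merged edge is pendant and carries no length. - All other internal edges keep their lengths. *)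

theory Defs
  imports "HOL-Analysis.Analysis"
begin

text \<open>A rooted binary species tree with internal edge lengths. In SNode len l r,
  len is the length (coalescent units) of the edge ABOVE this node; the value
  stored at the root node is ignored (there is no edge above the root, only the
  infinite root population). Leaves carry no length (pendant edges unspecified).\<close>

datatype 'a stree = SLeaf 'a | SNode real "'a stree" "'a stree"

primrec sleaf_list :: "'a stree \<Rightarrow> 'a list" where
  "sleaf_list (SLeaf a) = [a]"
| "sleaf_list (SNode len l r) = sleaf_list l @ sleaf_list r"

definition sleaves :: "'a stree \<Rightarrow> 'a set" where
  "sleaves t = set (sleaf_list t)"

primrec pos_below :: "'a stree \<Rightarrow> bool" where
  "pos_below (SLeaf a) = True"
| "pos_below (SNode len l r) = (len > 0 \<and> pos_below l \<and> pos_below r)"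

primrec pos_internal :: "'a stree \<Rightarrow> bool" where
  "pos_internal (SLeaf a) = True"
| "pos_internal (SNode len l r) = (pos_below l \<and> pos_below r)"

definition rmst :: "'a set \<Rightarrow> 'a stree \<Rightarrow> bool" where
  "rmst X t \<longleftrightarrow> distinct (sleaf_list t) \<and> sleaves t = X \<and> pos_internal t"

text \<open>Clusters (leaf sets below nodes) = the rooted topology.\<close>
primrec clusters :: "'a stree \<Rightarrow> 'a set set" where
  "clusters (SLeaf a) = {{a}}"
| "clusters (SNode len l r) = insert (sleaves (SNode len l r)) (clusters l \<union> clusters r)"

primrec elen :: "'a stree \<Rightarrow> 'a set \<Rightarrow> real" where
  "elen (SLeaf a) C = 0"
| "elen (SNode len l r) C =
     (if C = sleaves (SNode len l r) then len
      else if C \<in> clusters l then elen l C else elen r C)"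

text \<open>Internal edges of the rooted tree = clusters of size at least 2 other than the root cluster.\<close>
definition internal_clusters :: "'a stree \<Rightarrow> 'a set set" where
  "internal_clusters t = {C \<in> clusters t. 2 \<le> card C \<and> C \<noteq> sleaves t}"

definition rooted_eq :: "'a stree \<Rightarrow> 'a stree \<Rightarrow> bool" where
  "rooted_eq t1 t2 \<longleftrightarrow> clusters t1 = clusters t2 \<and>
     (\<forall>C \<in> internal_clusters t1. elen t1 C = elen t2 C)"

definition usplits :: "'a stree \<Rightarrow> 'a set set set" where
  "usplits t = {{C, sleaves t - C} | C. C \<in> clusters t \<and> C \<noteq> sleaves t}"

definition internal_splits :: "'a stree \<Rightarrow> 'a set set set" where
  "internal_splits t = {s \<in> usplits t. \<forall>A \<in> s. 2 \<le> card A}"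

text \<open>Length of an internal edge of the unrooted tree: sum of the lengths of the
  rooted internal edges inducing that split (two of them exactly when the root was
  incident to two internal edges, which are merged).\<close>
definition ulen :: "'a stree \<Rightarrow> 'a set set \<Rightarrow> real" where
  "ulen t s = (\<Sum>C \<in> {C \<in> internal_clusters t. {C, sleaves t - C} = s}. elen t C)"

definition unrooted_eq :: "'a stree \<Rightarrow> 'a stree \<Rightarrow> bool" where
  "unrooted_eq t1 t2 \<longleftrightarrow> usplits t1 = usplits t2 \<and>
     (\<forall>s \<in> internal_splits t1. ulen t1 s = ulen t2 s)"

text \<open>A gene lineage is a rooted gene tree, represented by its set of clusters
  (the gene sampled from taxon a is identified with a; a single gene is {{a}}).
  A configuration is the set of lineages currently present.
  Merging the pair p = {H1, H2} of lineages produces H1 \<union> H2 \<union> {leaves(H1) \<union> leaves(H2)}.\<close>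

type_synonym 'a lineage = "'a set set"
type_synonym 'a config = "'a lineage set"

definition pairs :: "'a config \<Rightarrow> 'a config set" where
  "pairs S = {p. p \<subseteq> S \<and> card p = 2}"

definition merge_pair :: "'a config \<Rightarrow> 'a config \<Rightarrow> 'a config" where
  "merge_pair S p = (S - p) \<union> {insert (\<Union>(\<Union>p)) (\<Union>p)}"

definition crate :: "'a config \<Rightarrow> real" where
  "crate S = real (card S choose 2)"

text \<open>Coalescent within a population of duration t, with fuel k (at most k
  coalescences are tracked; used with k = number of lineages).
  edge_k k S t S' = probability that starting with lineage set S the lineage set at the
  end of the edge is S'.  First-step decomposition: the first coalescence happens at
  an exponential time of rate (|S| choose 2), and the merged pair is uniform.\<close>
primrec edge_k :: "nat \<Rightarrow> 'a config \<Rightarrow> real \<Rightarrow> 'a config \<Rightarrow> real" where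
  "edge_k 0 S t S' = (if S' = S then 1 else 0)"
| "edge_k (Suc k) S t S' =
     (if S' = S then exp (- crate S * t) else 0) +
     integral {0..t} (\<lambda>s. crate S * exp (- crate S * s) *
        (\<Sum>p \<in> pairs S. (1 / crate S) * edge_k k (merge_pair S p) (t - s) S'))"

definition edge_dist :: "'a config \<Rightarrow> real \<Rightarrow> 'a config \<Rightarrow> real" where
  "edge_dist S t S' = edge_k (card S) S t S'"

text \<open>Population above the root (infinite duration): uniform random merges until one lineage.\<close>
primrec root_k :: "nat \<Rightarrow> 'a config \<Rightarrow> 'a config \<Rightarrow> real" where
  "root_k 0 S S' = (if S' = S then 1 else 0)"
| "root_k (Suc k) S S' =
     (if card S \<le> 1 then (if S' = S then 1 else 0)
      else (\<Sum>p \<in> pairs S. (1 / crate S) * root_k k (merge_pair S p) S'))"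

definition root_dist :: "'a config \<Rightarrow> 'a config \<Rightarrow> real" where
  "root_dist S S' = root_k (card S) S S'"

text \<open>All candidate configurations with genes from A (a finite superset of the support).\<close>
definition cfgs :: "'a set \<Rightarrow> 'a config set" where
  "cfgs A = Pow (Pow (Pow A))"

text \<open>Distribution of the lineage set exiting (the top of the edge above) a non-root node.
  Pendant edges: no coalescence.\<close>
primrec out_dist :: "'a stree \<Rightarrow> 'a config \<Rightarrow> real" where
  "out_dist (SLeaf a) S' = (if S' = {{{a}}} then 1 else 0)"
| "out_dist (SNode len l r) S' =
     (\<Sum>S1 \<in> cfgs (sleaves l). \<Sum>S2 \<in> cfgs (sleaves r).
        out_dist l S1 * out_dist r S2 * edge_dist (S1 \<union> S2) len S')"

primrec rooted_gene_dist :: "'a stree \<Rightarrow> 'a config \<Rightarrow> real" where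
  "rooted_gene_dist (SLeaf a) G = (if G = {{{a}}} then 1 else 0)"
| "rooted_gene_dist (SNode len l r) G =
     (\<Sum>S1 \<in> cfgs (sleaves l). \<Sum>S2 \<in> cfgs (sleaves r).
        out_dist l S1 * out_dist r S2 * root_dist (S1 \<union> S2) G)"

definition unroot :: "'a set \<Rightarrow> 'a config \<Rightarrow> 'a set set set" where
  "unroot L G = {{C, L - C} | C. C \<in> \<Union>G \<and> C \<noteq> L}"

definition gene_tree_dist :: "'a stree \<Rightarrow> 'a set set set \<Rightarrow> real" where
  "gene_tree_dist t T =
     (\<Sum>G \<in> cfgs (sleaves t). rooted_gene_dist t G * (if unroot (sleaves t) G = T then 1 else 0))"

end

theory Submission
  imports Defs
begin

text \<open>
  If a function \<open>F\<close> of the set of lineages is an eigenfunction of the coalescent generator with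
  eigenvalue \<open>- \<lambda>\<close>, then its expectation decays by the factor \<open>exp (- \<lambda> t)\<close> along a population of
  duration \<open>t\<close>. Suitable eigenfunctions only look at four or five genes and split into products
  where two populations join, so the probabilities that the gene tree displays a given split of
  four or five taxa can be read off the species tree without discarding the other taxa.

  Let the depth of a pair of taxa be the distance from the root to their most recent common
  ancestor. The probability of a quartet split is \<open>1 - 2/3 exp (- x)\<close> or \<open>exp (- x) / 3\<close>, where \<open>x\<close>
  is the length of the internal path of the unrooted quartet; this gives all sums
  \<open>D a b + D c d - D a c - D b d\<close>, hence the unrooted metric tree. On five taxa with unrooted shape
  \<open>ab|c|de\<close>, the four probabilities that \<open>c\<close> forms a cherry with another taxon tell on which of the
  seven edges the root lies and determine the remaining length. Hence depths are determined up to an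
  additive constant on every five taxa, and therefore globally, and depths determine the rooted
  metric tree. For four taxa with two cherries, only the sum of the two internal lengths matters.
\<close>

subsection \<open>Expectations of eigenfunctions\<close>

definition eigenfunction :: "'a config set \<Rightarrow> real \<Rightarrow> ('a config \<Rightarrow> real) \<Rightarrow> bool" where
  "eigenfunction V lam F \<longleftrightarrow>
     (\<forall>S\<in>V. (\<Sum>p\<in>pairs S. F (merge_pair S p)) = (crate S - lam) * F S)"

definition out_expect :: "'a stree \<Rightarrow> ('a config \<Rightarrow> real) \<Rightarrow> real" where
  "out_expect t F = (\<Sum>S\<in>cfgs (sleaves t). out_dist t S * F S)"

definition root_expect :: "'a stree \<Rightarrow> ('a config \<Rightarrow> real) \<Rightarrow> real" where
  "root_expect t F = (\<Sum>G\<in>cfgs (sleaves t). rooted_gene_dist t G * F G)"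

definition join_expect ::
    "'a stree \<Rightarrow> 'a stree \<Rightarrow> ('a config \<Rightarrow> 'a config \<Rightarrow> real) \<Rightarrow> real" where
  "join_expect l r F =
     (\<Sum>S1\<in>cfgs (sleaves l). \<Sum>S2\<in>cfgs (sleaves r). out_dist l S1 * out_dist r S2 * F S1 S2)"

text \<open>The extra conditions say that every lineage contains its own leaf set as top cluster and
  that the leaf sets of the lineages partition \<open>A\<close>.\<close>

definition valid_configs :: "'a set \<Rightarrow> 'a config set" where
  "valid_configs A = {S \<in> cfgs A. (\<forall>H\<in>S. \<Union>H \<in> H \<and> \<Union>H \<noteq> {}) \<and>
     (\<forall>H\<in>S. \<forall>H'\<in>S. H \<noteq> H' \<longrightarrow> \<Union>H \<inter> \<Union>H' = {}) \<and> \<Union>(\<Union>S) = A}"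

lemma finite_cfgs: "finite A \<Longrightarrow> finite (cfgs A)"
  by (simp add: cfgs_def)

lemma finite_sleaves [simp]: "finite (sleaves t)"
  by (simp add: sleaves_def)

lemma sleaves_simps [simp]:
  "sleaves (SLeaf a) = {a}" "sleaves (SNode len l r) = sleaves l \<union> sleaves r"
  by (auto simp: sleaves_def)

lemma valid_configsD:
  assumes "S \<in> valid_configs A"
  shows "S \<in> cfgs A" "H \<in> S \<Longrightarrow> \<Union>H \<in> H" "H \<in> S \<Longrightarrow> \<Union>H \<noteq> {}" "H \<in> S \<Longrightarrow> \<Union>H \<subseteq> A"
    "H \<in> S \<Longrightarrow> H' \<in> S \<Longrightarrow> H \<noteq> H' \<Longrightarrow> \<Union>H \<inter> \<Union>H' = {}" "\<Union>(\<Union>S) = A"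
proof -
  show "\<Union>(\<Union>S) = A" using assms unfolding valid_configs_def by blast
  then show "H \<in> S \<Longrightarrow> \<Union>H \<subseteq> A" by blast
qed (use assms in \<open>simp_all add: valid_configs_def\<close>)

lemma valid_config_finite: "finite A \<Longrightarrow> S \<in> valid_configs A \<Longrightarrow> finite S"
  by (auto simp: valid_configs_def cfgs_def intro: finite_subset)

lemma pairs_E:
  assumes "p \<in> pairs S"
  obtains H1 H2 where "p = {H1, H2}" "H1 \<noteq> H2" "H1 \<in> S" "H2 \<in> S"
  using assms by (auto simp: pairs_def card_2_iff)

lemma finite_pairs: "finite S \<Longrightarrow> finite (pairs S)"
  by (simp add: pairs_def)

lemma pairs_empty: "finite S \<Longrightarrow> card S \<le> 1 \<Longrightarrow> pairs S = {}"
proof (rule equals0I)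
  fix p assume "finite S" "card S \<le> 1" "p \<in> pairs S"
  then show False using card_mono[of S p] by (simp add: pairs_def)
qed

lemma crate_eq_0_iff: "crate S = 0 \<longleftrightarrow> card S \<le> 1"
  by (auto simp: crate_def binomial_eq_0_iff)

lemma merge_pair_valid:
  assumes S: "S \<in> valid_configs A" and p: "p \<in> pairs S"
  shows "merge_pair S p \<in> valid_configs A"
proof -
  obtain H1 H2 where H: "p = {H1, H2}" "H1 \<noteq> H2" "H1 \<in> S" "H2 \<in> S"
    using p by (rule pairs_E)
  let ?N = "insert (\<Union>H1 \<union> \<Union>H2) (H1 \<union> H2)"
  have m: "merge_pair S p = insert ?N (S - {H1, H2})"
    by (simp add: merge_pair_def H)
  have N: "\<Union>?N = \<Union>H1 \<union> \<Union>H2" by auto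
  have 1: "merge_pair S p \<in> cfgs A"
    using S H unfolding m valid_configs_def cfgs_def by auto
  have 2: "\<forall>H\<in>merge_pair S p. \<Union>H \<in> H \<and> \<Union>H \<noteq> {}"
    using S H unfolding m valid_configs_def by (auto simp: N)
  have d: "\<And>H H'. H \<in> S \<Longrightarrow> H' \<in> S \<Longrightarrow> H \<noteq> H' \<Longrightarrow> \<Union>H \<inter> \<Union>H' = {}"
    using S unfolding valid_configs_def by simp
  have 3: "\<forall>H\<in>merge_pair S p. \<forall>H'\<in>merge_pair S p. H \<noteq> H' \<longrightarrow> \<Union>H \<inter> \<Union>H' = {}"
  proof (intro ballI impI)
    fix H H' assume a: "H \<in> merge_pair S p" "H' \<in> merge_pair S p" "H \<noteq> H'"
    have x: "\<Union>G \<inter> \<Union>?N = {}" if "G \<in> S - {H1, H2}" for G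
      unfolding N using d[of G H1] d[of G H2] H that by blast
    show "\<Union>H \<inter> \<Union>H' = {}"
    proof (cases "H = ?N")
      case True
      then have "H' \<in> S - {H1, H2}" using a m by (metis insertE)
      then show ?thesis using x[of H'] True by (simp only: Int_commute)
    next
      case False
      then have "H \<in> S - {H1, H2}" using a m by (metis insertE)
      then show ?thesis using x[of H] a m d by (metis DiffE insertE)
    qed
  qed
  have "\<Union>(\<Union>(merge_pair S p)) = \<Union>(\<Union>(S - {H1, H2})) \<union> \<Union>?N"
    unfolding m by (simp add: Un_commute)
  also have "\<dots> = \<Union>(\<Union>S)"
    unfolding N using H(3,4) by blast
  also have "\<dots> = A" using valid_configsD(6)[OF S] .
  finally show ?thesis using 1 2 3 by (simp add: valid_configs_def)
qed

lemma card_merge_pair: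
  assumes S: "S \<in> valid_configs A" and fin: "finite A" and p: "p \<in> pairs S"
  shows "Suc (card (merge_pair S p)) = card S"
proof -
  obtain H1 H2 where H: "p = {H1, H2}" "H1 \<noteq> H2" "H1 \<in> S" "H2 \<in> S"
    using p by (rule pairs_E)
  let ?N = "insert (\<Union>H1 \<union> \<Union>H2) (H1 \<union> H2)"
  have m: "merge_pair S p = insert ?N (S - {H1, H2})"
    by (simp add: merge_pair_def H)
  have f: "finite S" using valid_config_finite[OF fin S] .
  have "?N \<notin> S - {H1, H2}"
  proof
    assume "?N \<in> S - {H1, H2}"
    then have "\<Union>?N \<inter> \<Union>H1 = {}" using valid_configsD(5)[OF S _ H(3)] by (metis DiffD1 DiffD2 insertI1)
    moreover have "\<Union>?N \<inter> \<Union>H1 = \<Union>H1" by blast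
    ultimately show False using valid_configsD(3)[OF S H(3)] by simp
  qed
  then have "card (merge_pair S p) = Suc (card (S - {H1, H2}))"
    unfolding m using f by simp
  moreover have "card (S - {H1, H2}) = card S - 2"
    using H f by (subst card_Diff_subset) auto
  moreover have "card S \<ge> 2"
    using H f card_mono[of S "{H1,H2}"] by auto
  ultimately show ?thesis by simp
qed

lemma integral_reflect_interval:
  fixes f :: "real \<Rightarrow> real"
  shows "integral {0..t} (\<lambda>s. f (t - s)) = integral {0..t} f"
proof -
  have "integral {0..t} (\<lambda>s. f (t - s)) = integral {-t..-0} (\<lambda>s. f (t - (- s)))"
    using Henstock_Kurzweil_Integration.integral_reflect_real[of t 0 "\<lambda>s. f (t - s)"] by simp
  also have "\<dots> = integral {0-t..t-t} (\<lambda>s. f (s + t))"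
    by (simp add: add.commute)
  also have "\<dots> = integral {0..t} f"
    by (rule integral_shift_real_ivl)
  finally show ?thesis .
qed

lemma continuous_on_edge_k: "continuous_on {0..T} (\<lambda>t. edge_k k S t S')"
proof (induction k arbitrary: S T)
  case 0
  then show ?case by simp
next
  case (Suc k)
  let ?c = "crate S"
  define g where "g = (\<lambda>u. \<Sum>p\<in>pairs S. (1 / ?c) * edge_k k (merge_pair S p) u S')"
  have g: "continuous_on {0..T} g"
    unfolding g_def by (intro continuous_intros Suc)
  have eq: "integral {0..t} (\<lambda>s. ?c * exp (- ?c * s) * g (t - s))
      = exp (- ?c * t) * integral {0..t} (\<lambda>u. ?c * exp (?c * u) * g u)" for t
  proof -
    have "integral {0..t} (\<lambda>s. ?c * exp (- ?c * s) * g (t - s))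
        = integral {0..t} (\<lambda>s. (\<lambda>u. ?c * exp (- ?c * (t - u)) * g u) (t - s))"
      by (intro integral_cong) simp
    also have "\<dots> = integral {0..t} (\<lambda>u. ?c * exp (- ?c * (t - u)) * g u)"
      by (rule integral_reflect_interval)
    also have "\<dots> = integral {0..t} (\<lambda>u. exp (- ?c * t) * (?c * exp (?c * u) * g u))"
      by (intro integral_cong) (simp add: mult_exp_exp algebra_simps)
    finally show ?thesis by simp
  qed
  have "(\<lambda>u. ?c * exp (?c * u) * g u) integrable_on {0..T}"
    by (intro integrable_continuous_interval continuous_intros g)
  then have "continuous_on {0..T} (\<lambda>t. integral {0..t} (\<lambda>u. ?c * exp (?c * u) * g u))"
    by (rule indefinite_integral_continuous_1)
  then have "continuous_on {0..T} (\<lambda>t. (if S' = S then exp (- ?c * t) else 0)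
      + exp (- ?c * t) * integral {0..t} (\<lambda>u. ?c * exp (?c * u) * g u))"
    by (cases "S' = S") (auto intro!: continuous_intros)
  then show ?case
    unfolding edge_k.simps eq[symmetric] by (simp only: g_def)
qed

lemma integral_exp_scaled:
  fixes c t :: real
  assumes "0 \<le> t"
  shows "integral {0..t} (\<lambda>s. c * exp (- c * s)) = 1 - exp (- c * t)"
proof -
  have "((\<lambda>s. c * exp (- c * s)) has_integral (- exp (- c * t) - - exp (- c * 0))) {0..t}"
    by (rule fundamental_theorem_of_calculus[OF assms])
      (auto intro!: derivative_eq_intros simp flip: has_real_derivative_iff_has_vector_derivative)
  from integral_unique[OF this] show ?thesis by simp
qed

lemma edge_k_eigenfunction:
  assumes fin: "finite A" and F: "eigenfunction (valid_configs A) lam F"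
  shows "S \<in> valid_configs A \<Longrightarrow> card S \<le> k \<Longrightarrow> 0 \<le> t \<Longrightarrow>
    (\<Sum>S'\<in>cfgs A. edge_k k S t S' * F S') = exp (- lam * t) * F S"
proof (induction k arbitrary: S t)
  case 0
  then have "S = {}" using valid_config_finite[OF fin] by auto
  have "lam * F S = 0"
    using F 0 pairs_empty[of S] \<open>S = {}\<close>
    by (auto simp: eigenfunction_def crate_def dest!: bspec[of _ _ "{}"])
  then have "exp (- lam * t) * F S = F S" by auto
  moreover have "S \<in> cfgs A" using 0 by (simp add: valid_configs_def)
  moreover have "(\<Sum>S'\<in>cfgs A. edge_k 0 S t S' * F S') = (\<Sum>S'\<in>cfgs A. if S' = S then F S else 0)"
    by (intro sum.cong) auto
  ultimately show ?case using finite_cfgs[OF fin] by simp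
next
  case (Suc k)
  let ?c = "crate S"
  have finS: "finite S" and SA: "S \<in> cfgs A"
    using Suc.prems valid_config_finite[OF fin] by (auto simp: valid_configs_def)
  have FS: "(\<Sum>p\<in>pairs S. F (merge_pair S p)) = (?c - lam) * F S"
    using F Suc.prems by (simp add: eigenfunction_def)
  define G where "G = (\<lambda>S' s. ?c * exp (- ?c * s) *
        (\<Sum>p \<in> pairs S. (1 / ?c) * edge_k k (merge_pair S p) (t - s) S'))"
  have cont: "continuous_on {0..t} (\<lambda>s. edge_k k R (t - s) S')" for R S'
    by (rule continuous_on_compose2[OF continuous_on_edge_k[of t]]) (auto intro!: continuous_intros)
  have int: "(\<lambda>s. G S' s * F S') integrable_on {0..t}" for S'
    unfolding G_def by (intro integrable_continuous_interval continuous_intros cont)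
  have "(\<Sum>S'\<in>cfgs A. edge_k (Suc k) S t S' * F S')
      = (\<Sum>S'\<in>cfgs A. (if S' = S then exp (- ?c * t) * F S else 0) + integral {0..t} (\<lambda>s. G S' s * F S'))"
    by (intro sum.cong) (auto simp: G_def algebra_simps)
  also have "\<dots> = exp (- ?c * t) * F S + (\<Sum>S'\<in>cfgs A. integral {0..t} (\<lambda>s. G S' s * F S'))"
    using SA finite_cfgs[OF fin] by (simp add: sum.distrib)
  also have "(\<Sum>S'\<in>cfgs A. integral {0..t} (\<lambda>s. G S' s * F S'))
      = integral {0..t} (\<lambda>s. \<Sum>S'\<in>cfgs A. G S' s * F S')"
    using int finite_cfgs[OF fin] by (simp add: integral_sum)
  also have "\<dots> = integral {0..t} (\<lambda>s. exp (- lam * t) * F S * ((?c - lam) * exp (- (?c - lam) * s)))"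
  proof (intro integral_cong)
    fix s assume s: "s \<in> {0..t}"
    have "(\<Sum>S'\<in>cfgs A. G S' s * F S')
        = ?c * exp (- ?c * s) * (\<Sum>S'\<in>cfgs A. \<Sum>p \<in> pairs S. (1 / ?c) * (edge_k k (merge_pair S p) (t - s) S' * F S'))"
      unfolding G_def sum_distrib_left sum_distrib_right by (intro sum.cong refl) (simp only: mult.assoc)
    also have "(\<Sum>S'\<in>cfgs A. \<Sum>p \<in> pairs S. (1 / ?c) * (edge_k k (merge_pair S p) (t - s) S' * F S'))
        = (\<Sum>p \<in> pairs S. (1 / ?c) * (\<Sum>S'\<in>cfgs A. edge_k k (merge_pair S p) (t - s) S' * F S'))"
      by (subst sum.swap) (simp add: sum_distrib_left)
    also have "\<dots> = (\<Sum>p \<in> pairs S. (1 / ?c) * (exp (- lam * (t - s)) * F (merge_pair S p)))"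
    proof (intro sum.cong refl)
      fix p assume p: "p \<in> pairs S"
      have "card (merge_pair S p) \<le> k"
        using card_merge_pair[OF Suc.prems(1) fin p] Suc.prems(2) by simp
      then show "(1 / ?c) * (\<Sum>S'\<in>cfgs A. edge_k k (merge_pair S p) (t - s) S' * F S')
          = (1 / ?c) * (exp (- lam * (t - s)) * F (merge_pair S p))"
        using Suc.IH[of "merge_pair S p" "t - s"] merge_pair_valid[OF Suc.prems(1) p] s by simp
    qed
    also have "\<dots> = (1 / ?c) * exp (- lam * (t - s)) * (\<Sum>p \<in> pairs S. F (merge_pair S p))"
      by (simp add: sum_distrib_left mult.assoc)
    also have "?c * exp (- ?c * s) * \<dots> = exp (- ?c * s) * exp (- lam * (t - s)) * (\<Sum>p \<in> pairs S. F (merge_pair S p))"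
    proof (cases "?c = 0")
      case True
      then have "pairs S = {}" using pairs_empty[OF finS] crate_eq_0_iff[of S] by simp
      then show ?thesis by simp
    qed simp
    also have "\<dots> = exp (- ?c * s) * exp (- lam * (t - s)) * ((?c - lam) * F S)"
      unfolding FS ..
    also have "exp (- ?c * s) * exp (- lam * (t - s)) = exp (- lam * t) * exp (- (?c - lam) * s)"
      by (simp add: mult_exp_exp algebra_simps)
    finally show "(\<Sum>S'\<in>cfgs A. G S' s * F S')
        = exp (- lam * t) * F S * ((?c - lam) * exp (- (?c - lam) * s))"
      by (simp add: mult_ac)
  qed
  also have "\<dots> = exp (- lam * t) * F S * (1 - exp (- (?c - lam) * t))"
    using integral_exp_scaled[OF Suc.prems(3), of "?c - lam"] by (simp only: integral_mult_right)
  also have "exp (- ?c * t) * F S + \<dots> = exp (- lam * t) * F S"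
    by (simp add: algebra_simps mult_exp_exp flip: exp_add)
  finally show ?case .
qed

lemma root_k_harmonic:
  assumes fin: "finite A" and F: "eigenfunction (valid_configs A) 0 F"
  shows "S \<in> valid_configs A \<Longrightarrow> (\<Sum>S'\<in>cfgs A. root_k k S S' * F S') = F S"
proof (induction k arbitrary: S)
  case 0
  moreover have "S \<in> cfgs A" using 0 by (simp add: valid_configs_def)
  moreover have "(\<Sum>S'\<in>cfgs A. root_k 0 S S' * F S') = (\<Sum>S'\<in>cfgs A. if S' = S then F S else 0)"
    by (intro sum.cong) auto
  ultimately show ?case using finite_cfgs[OF fin] by simp
next
  case (Suc k)
  have SA: "S \<in> cfgs A" using Suc.prems by (simp add: valid_configs_def)
  show ?case
  proof (cases "card S \<le> 1")
    case True
    have "(\<Sum>S'\<in>cfgs A. root_k (Suc k) S S' * F S') = (\<Sum>S'\<in>cfgs A. if S' = S then F S else 0)"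
      using True by (intro sum.cong) auto
    then show ?thesis using SA finite_cfgs[OF fin] by simp
  next
    case False
    have "(\<Sum>S'\<in>cfgs A. root_k (Suc k) S S' * F S')
        = (\<Sum>S'\<in>cfgs A. \<Sum>p\<in>pairs S. (1 / crate S) * (root_k k (merge_pair S p) S' * F S'))"
      using False by (simp add: sum_distrib_left sum_distrib_right mult.assoc)
    also have "\<dots> = (\<Sum>p\<in>pairs S. (1 / crate S) * (\<Sum>S'\<in>cfgs A. root_k k (merge_pair S p) S' * F S'))"
      by (subst sum.swap) (simp add: sum_distrib_left)
    also have "\<dots> = (\<Sum>p\<in>pairs S. (1 / crate S) * F (merge_pair S p))"
      using Suc.IH merge_pair_valid[OF Suc.prems] by (intro sum.cong) auto
    also have "\<dots> = (1 / crate S) * (crate S * F S)"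
      using F Suc.prems by (simp add: eigenfunction_def flip: sum_distrib_left sum_divide_distrib)
    finally show ?thesis using False crate_eq_0_iff[of S] by simp
  qed
qed

lemma edge_k_outside:
  assumes "\<And>S p. S \<in> V \<Longrightarrow> p \<in> pairs S \<Longrightarrow> merge_pair S p \<in> V" and "S' \<notin> V"
  shows "S \<in> V \<Longrightarrow> edge_k k S t S' = 0"
proof (induction k arbitrary: S t)
  case 0
  then show ?case using assms by auto
next
  case (Suc k)
  have "(\<Sum>p \<in> pairs S. (1 / crate S) * edge_k k (merge_pair S p) u S') = 0" for u
    using Suc.IH assms(1)[OF Suc.prems] by (intro sum.neutral) simp
  moreover have "S' \<noteq> S" using assms Suc.prems by blast
  ultimately show ?case by (simp del: times_divide_eq_left)
qed

lemma root_k_outside: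
  assumes "\<And>S p. S \<in> V \<Longrightarrow> p \<in> pairs S \<Longrightarrow> merge_pair S p \<in> V" and "S' \<notin> V"
  shows "S \<in> V \<Longrightarrow> root_k k S S' = 0"
proof (induction k arbitrary: S)
  case 0
  then show ?case using assms by auto
next
  case (Suc k)
  have "(\<Sum>p \<in> pairs S. (1 / crate S) * root_k k (merge_pair S p) S') = 0"
    using Suc.IH assms(1)[OF Suc.prems] by (intro sum.neutral) simp
  moreover have "S' \<noteq> S" using assms Suc.prems by blast
  ultimately show ?case by simp
qed

lemma valid_configs_Un:
  assumes "S1 \<in> valid_configs A" "S2 \<in> valid_configs B" "A \<inter> B = {}"
  shows "S1 \<union> S2 \<in> valid_configs (A \<union> B)"
proof -
  have sub: "\<And>H. H \<in> S1 \<Longrightarrow> \<Union>H \<subseteq> A" "\<And>H. H \<in> S2 \<Longrightarrow> \<Union>H \<subseteq> B"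
    using valid_configsD(4) assms by blast+
  have "S1 \<in> cfgs A" "S2 \<in> cfgs B" using valid_configsD(1) assms by blast+
  then have "S1 \<union> S2 \<in> cfgs (A \<union> B)"
    unfolding cfgs_def by (metis Pow_mono Pow_iff Un_least Un_upper1 Un_upper2 subset_trans)
  moreover have "\<forall>H\<in>S1 \<union> S2. \<Union>H \<in> H \<and> \<Union>H \<noteq> {}"
    using valid_configsD(2,3) assms(1,2) by (metis Un_iff)
  moreover have "\<forall>H\<in>S1 \<union> S2. \<forall>H'\<in>S1 \<union> S2. H \<noteq> H' \<longrightarrow> \<Union>H \<inter> \<Union>H' = {}"
  proof (intro ballI impI)
    fix H H' assume a: "H \<in> S1 \<union> S2" "H' \<in> S1 \<union> S2" "H \<noteq> H'"
    consider "H \<in> S1" "H' \<in> S1" | "H \<in> S2" "H' \<in> S2" | "\<Union>H \<subseteq> A" "\<Union>H' \<subseteq> B" | "\<Union>H \<subseteq> B" "\<Union>H' \<subseteq> A"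
      using a sub by (metis UnE)
    then show "\<Union>H \<inter> \<Union>H' = {}"
    proof cases
      case 1 then show ?thesis using valid_configsD(5)[OF assms(1)] a(3) by simp
    next
      case 2 then show ?thesis using valid_configsD(5)[OF assms(2)] a(3) by simp
    next
      case 3 then show ?thesis using assms(3) by blast
    next
      case 4 then show ?thesis using assms(3) by blast
    qed
  qed
  moreover have "\<Union>(\<Union>(S1 \<union> S2)) = A \<union> B"
    using valid_configsD(6)[OF assms(1)] valid_configsD(6)[OF assms(2)] by (simp only: Union_Un_distrib)
  ultimately show ?thesis unfolding valid_configs_def by simp
qed

lemma out_dist_invalid:
  "distinct (sleaf_list t) \<Longrightarrow> S \<notin> valid_configs (sleaves t) \<Longrightarrow> out_dist t S = 0"
proof (induction t arbitrary: S)
  case (SLeaf a)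
  have "{{{a}}} \<in> valid_configs {a}" by (auto simp: valid_configs_def cfgs_def)
  then show ?case using SLeaf by auto
next
  case (SNode len l r)
  have d: "sleaves l \<inter> sleaves r = {}" using SNode.prems by (simp add: sleaves_def)
  have "out_dist l S1 * out_dist r S2 * edge_dist (S1 \<union> S2) len S = 0" for S1 S2
  proof (cases "S1 \<in> valid_configs (sleaves l) \<and> S2 \<in> valid_configs (sleaves r)")
    case True
    then have "S1 \<union> S2 \<in> valid_configs (sleaves (SNode len l r))"
      using valid_configs_Un[OF _ _ d] by simp
    then show ?thesis using edge_k_outside[of "valid_configs (sleaves (SNode len l r))", OF merge_pair_valid SNode.prems(2)]
      by (simp add: edge_dist_def)
  next
    case False
    then show ?thesis using SNode by auto
  qed
  then show ?case by (simp only: out_dist.simps sum.neutral_const)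
qed

lemma join_expect_cong_support:
  assumes "\<And>S1 S2. out_dist l S1 \<noteq> 0 \<Longrightarrow> out_dist r S2 \<noteq> 0 \<Longrightarrow> F S1 S2 = G S1 S2"
  shows "join_expect l r F = join_expect l r G"
  unfolding join_expect_def
proof (intro sum.cong refl)
  fix S1 S2
  show "out_dist l S1 * out_dist r S2 * F S1 S2 = out_dist l S1 * out_dist r S2 * G S1 S2"
    using assms[of S1 S2] by (cases "out_dist l S1 = 0"; cases "out_dist r S2 = 0") auto
qed

lemma join_expect_cong:
  assumes "distinct (sleaf_list l)" "distinct (sleaf_list r)"
    and "\<And>S1 S2. S1 \<in> valid_configs (sleaves l) \<Longrightarrow> S2 \<in> valid_configs (sleaves r) \<Longrightarrow> F S1 S2 = G S1 S2"
  shows "join_expect l r F = join_expect l r G"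
  using assms(3) out_dist_invalid[OF assms(1)] out_dist_invalid[OF assms(2)]
  by (intro join_expect_cong_support) metis

lemma out_expect_cong:
  assumes "distinct (sleaf_list t)"
    and "\<And>S. S \<in> valid_configs (sleaves t) \<Longrightarrow> F S = G S"
  shows "out_expect t F = out_expect t G"
  unfolding out_expect_def
proof (intro sum.cong refl)
  fix S
  show "out_dist t S * F S = out_dist t S * G S"
    using assms out_dist_invalid[of t S] by (cases "S \<in> valid_configs (sleaves t)") auto
qed

lemma join_expect_mult:
  "join_expect l r (\<lambda>S1 S2. F S1 * G S2) = out_expect l F * out_expect r G"
  unfolding join_expect_def out_expect_def sum_product by (intro sum.cong refl) (simp only: mult_ac)

lemma join_expect_add:
  "join_expect l r (\<lambda>S1 S2. F S1 S2 + G S1 S2) = join_expect l r F + join_expect l r G"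
  unfolding join_expect_def by (simp add: sum.distrib algebra_simps)

lemma join_expect_cmult:
  "join_expect l r (\<lambda>S1 S2. c * F S1 S2) = c * join_expect l r F"
  unfolding join_expect_def by (simp add: sum_distrib_left mult_ac)

lemma out_expect_add:
  "out_expect t (\<lambda>S. F S + G S) = out_expect t F + out_expect t G"
  unfolding out_expect_def by (simp add: sum.distrib algebra_simps)

lemma out_expect_cmult:
  "out_expect t (\<lambda>S. c * F S) = c * out_expect t F"
  unfolding out_expect_def by (simp add: sum_distrib_left mult_ac)

lemma join_expect_commute:
  "join_expect l r (\<lambda>S1 S2. F (S1 \<union> S2)) = join_expect r l (\<lambda>S1 S2. F (S1 \<union> S2))"
  unfolding join_expect_def by (subst sum.swap) (simp add: mult_ac Un_commute)

lemma sum_join_expect_swap: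
  "(\<Sum>S'\<in>B. (\<Sum>S1\<in>cfgs (sleaves l). \<Sum>S2\<in>cfgs (sleaves r).
      out_dist l S1 * out_dist r S2 * K (S1 \<union> S2) S') * F S')
    = join_expect l r (\<lambda>S1 S2. \<Sum>S'\<in>B. K (S1 \<union> S2) S' * F S')"
proof -
  have "(\<Sum>S'\<in>B. (\<Sum>S1\<in>cfgs (sleaves l). \<Sum>S2\<in>cfgs (sleaves r).
      out_dist l S1 * out_dist r S2 * K (S1 \<union> S2) S') * F S')
    = (\<Sum>S'\<in>B. \<Sum>S1\<in>cfgs (sleaves l). \<Sum>S2\<in>cfgs (sleaves r).
        out_dist l S1 * out_dist r S2 * (K (S1 \<union> S2) S' * F S'))"
    by (simp add: sum_distrib_right mult.assoc)
  also have "\<dots> = (\<Sum>S1\<in>cfgs (sleaves l). \<Sum>S'\<in>B. \<Sum>S2\<in>cfgs (sleaves r).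
        out_dist l S1 * out_dist r S2 * (K (S1 \<union> S2) S' * F S'))"
    by (rule sum.swap)
  also have "\<dots> = (\<Sum>S1\<in>cfgs (sleaves l). \<Sum>S2\<in>cfgs (sleaves r). \<Sum>S'\<in>B.
        out_dist l S1 * out_dist r S2 * (K (S1 \<union> S2) S' * F S'))"
    by (intro sum.cong refl sum.swap)
  finally show ?thesis by (simp add: join_expect_def sum_distrib_left)
qed

lemma out_expect_SNode:
  assumes dist: "distinct (sleaf_list (SNode len l r))" and len: "0 \<le> len"
    and F: "eigenfunction (valid_configs (sleaves (SNode len l r))) lam F"
  shows "out_expect (SNode len l r) F = exp (- lam * len) * join_expect l r (\<lambda>S1 S2. F (S1 \<union> S2))"
proof -
  let ?A = "sleaves (SNode len l r)"
  have d: "sleaves l \<inter> sleaves r = {}" using dist by (simp add: sleaves_def)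
  have "out_expect (SNode len l r) F
      = join_expect l r (\<lambda>S1 S2. \<Sum>S'\<in>cfgs ?A. edge_dist (S1 \<union> S2) len S' * F S')"
    unfolding out_expect_def out_dist.simps by (rule sum_join_expect_swap)
  also have "\<dots> = join_expect l r (\<lambda>S1 S2. exp (- lam * len) * F (S1 \<union> S2))"
  proof (rule join_expect_cong)
    fix S1 S2 assume "S1 \<in> valid_configs (sleaves l)" "S2 \<in> valid_configs (sleaves r)"
    then have "S1 \<union> S2 \<in> valid_configs ?A" using valid_configs_Un[OF _ _ d] by simp
    then show "(\<Sum>S'\<in>cfgs ?A. edge_dist (S1 \<union> S2) len S' * F S') = exp (- lam * len) * F (S1 \<union> S2)"
      unfolding edge_dist_def using edge_k_eigenfunction[OF finite_sleaves F _ _ len] by blast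
  qed (use dist in auto)
  finally show ?thesis by (simp add: join_expect_cmult)
qed

lemma root_expect_SNode:
  "root_expect (SNode len l r) F =
    join_expect l r (\<lambda>S1 S2. \<Sum>G\<in>cfgs (sleaves (SNode len l r)). root_dist (S1 \<union> S2) G * F G)"
  unfolding root_expect_def rooted_gene_dist.simps by (rule sum_join_expect_swap)

lemma root_expect_SNode_harmonic:
  assumes dist: "distinct (sleaf_list (SNode len l r))"
    and F: "eigenfunction (valid_configs (sleaves (SNode len l r))) 0 F"
  shows "root_expect (SNode len l r) F = join_expect l r (\<lambda>S1 S2. F (S1 \<union> S2))"
  unfolding root_expect_SNode
proof (rule join_expect_cong)
  let ?A = "sleaves (SNode len l r)"
  have d: "sleaves l \<inter> sleaves r = {}" using dist by (simp add: sleaves_def)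
  fix S1 S2 assume "S1 \<in> valid_configs (sleaves l)" "S2 \<in> valid_configs (sleaves r)"
  then have "S1 \<union> S2 \<in> valid_configs ?A" using valid_configs_Un[OF _ _ d] by simp
  then show "(\<Sum>S'\<in>cfgs ?A. root_dist (S1 \<union> S2) S' * F S') = F (S1 \<union> S2)"
    unfolding root_dist_def using root_k_harmonic[OF finite_sleaves F] by blast
qed (use dist in auto)

lemma constant_harmonic: "finite L \<Longrightarrow> eigenfunction (valid_configs L) 0 (\<lambda>_. c)"
  unfolding eigenfunction_def
proof
  fix S assume "finite L" "S \<in> valid_configs L"
  then have "finite S" using valid_config_finite by blast
  then show "(\<Sum>p\<in>pairs S. c) = (crate S - 0) * c"
    using n_subsets[of S 2] by (simp add: crate_def pairs_def)
qed

lemma out_expect_const: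
  assumes "distinct (sleaf_list t)" "pos_below t"
  shows "out_expect t (\<lambda>_. c) = c"
proof -
  have "out_expect t (\<lambda>_. 1) = 1" using assms
  proof (induction t)
    case (SLeaf a)
    then show ?case by (simp add: out_expect_def cfgs_def finite_cfgs)
  next
    case (SNode len l r)
    from out_expect_SNode[OF SNode.prems(1) _ constant_harmonic[OF finite_sleaves]]
    show ?case using SNode join_expect_mult[of l r "\<lambda>_. 1" "\<lambda>_. 1"] by simp
  qed
  then show ?thesis using out_expect_cmult[of t c "\<lambda>_. 1"] by simp
qed

subsection \<open>A family of eigenfunctions\<close>

definition lineages_meeting :: "'a set \<Rightarrow> 'a config \<Rightarrow> 'a config" where
  "lineages_meeting A S = {H \<in> S. \<Union>H \<inter> A \<noteq> {}}"

abbreviation nlin :: "'a set \<Rightarrow> 'a config \<Rightarrow> nat" where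
  "nlin A S \<equiv> card (lineages_meeting A S)"

definition separates :: "'a set \<Rightarrow> 'a set \<Rightarrow> 'a config \<Rightarrow> bool" where
  "separates A W S \<longleftrightarrow> (\<exists>C\<in>\<Union>S. C \<inter> (A \<union> W) = A)"

definition mixed :: "'a set \<Rightarrow> 'a set \<Rightarrow> 'a config \<Rightarrow> bool" where
  "mixed A W S \<longleftrightarrow> (\<exists>C\<in>\<Union>S. C \<inter> A \<noteq> {} \<and> C \<inter> W \<noteq> {})"

text \<open>Follow the lineages of the genes in \<open>A\<close> and in \<open>W\<close> until one of the first kind
  coalesces with one of the second kind. The value becomes 1 if before that time all of \<open>A\<close>
  (when \<open>sA\<close> is set) or all of \<open>W\<close> (when \<open>sW\<close> is set) has coalesced, and 0 otherwise.\<close>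

definition two_type :: "bool \<Rightarrow> bool \<Rightarrow> (nat \<Rightarrow> nat \<Rightarrow> real) \<Rightarrow> 'a set \<Rightarrow> 'a set \<Rightarrow> 'a config \<Rightarrow> real"
  where "two_type sA sW v A W S =
     (if sA \<and> separates A W S \<or> sW \<and> separates W A S then 1
      else if mixed A W S then 0 else v (nlin A S) (nlin W S))"

lemma lineages_meeting_subset: "lineages_meeting A S \<subseteq> S"
  by (auto simp: lineages_meeting_def)

lemma lineages_meeting_insert:
  "lineages_meeting A (insert N R) =
    (if \<Union>N \<inter> A \<noteq> {} then insert N (lineages_meeting A R) else lineages_meeting A R)"
  by (auto simp: lineages_meeting_def simp del: Union_iff)

lemma lineages_meeting_Diff: "lineages_meeting A (S - R) = lineages_meeting A S - R"
  by (auto simp: lineages_meeting_def simp del: Union_iff)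

lemma in_lineages_meeting: "H \<in> lineages_meeting A S \<longleftrightarrow> H \<in> S \<and> \<Union>H \<inter> A \<noteq> {}"
  by (simp add: lineages_meeting_def)

lemma Union_merge_pair:
  assumes "H1 \<in> S" "H2 \<in> S"
  shows "\<Union>(merge_pair S {H1, H2}) = insert (\<Union>H1 \<union> \<Union>H2) (\<Union>S)"
  using assms by (auto simp: merge_pair_def)

lemma separates_merge_pair:
  assumes "H1 \<in> S" "H2 \<in> S"
  shows "separates A W (merge_pair S {H1, H2}) \<longleftrightarrow>
    separates A W S \<or> (\<Union>H1 \<union> \<Union>H2) \<inter> (A \<union> W) = A"
  unfolding separates_def Union_merge_pair[OF assms] by (simp only: bex_simps(5) disj_commute)

lemma mixed_merge_pair:
  assumes "H1 \<in> S" "H2 \<in> S"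
  shows "mixed A W (merge_pair S {H1, H2}) \<longleftrightarrow>
    mixed A W S \<or> (\<Union>H1 \<union> \<Union>H2) \<inter> A \<noteq> {} \<and> (\<Union>H1 \<union> \<Union>H2) \<inter> W \<noteq> {}"
  unfolding mixed_def Union_merge_pair[OF assms] by (simp only: bex_simps(5) disj_commute)

lemma mixed_commute: "mixed A W S = mixed W A S"
  unfolding mixed_def by blast

lemma two_type_commute: "two_type sA sW v A W S = two_type sW sA (\<lambda>i j. v j i) W A S"
  unfolding two_type_def by (auto simp: mixed_commute)

lemma not_mixed_top:
  assumes "S \<in> valid_configs L" "\<not> mixed A W S" "H \<in> S"
  shows "\<Union>H \<inter> A = {} \<or> \<Union>H \<inter> W = {}"
proof -
  have "\<Union>H \<in> \<Union>S" using valid_configsD(2)[OF assms(1,3)] assms(3) by (rule UnionI[rotated])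
  then show ?thesis using assms(2) unfolding mixed_def by (simp only: bex_simps) (metis)
qed

lemma nlin_merge_pair:
  assumes S: "S \<in> valid_configs L" and fin: "finite L"
    and H: "H1 \<in> S" "H2 \<in> S" "H1 \<noteq> H2"
  shows "nlin A (merge_pair S {H1, H2}) =
    (if {H1, H2} \<subseteq> lineages_meeting A S then nlin A S - 1 else nlin A S)"
proof -
  let ?N = "insert (\<Union>H1 \<union> \<Union>H2) (H1 \<union> H2)" and ?M = "lineages_meeting A S"
  have UN: "\<Union>?N = \<Union>H1 \<union> \<Union>H2" by blast
  have m: "merge_pair S {H1, H2} = insert ?N (S - {H1, H2})"
    by (simp add: merge_pair_def)
  have N: "?N \<notin> S - {H1, H2}"
  proof
    assume "?N \<in> S - {H1, H2}"
    then have "\<Union>?N \<inter> \<Union>H1 = {}" using valid_configsD(5)[OF S _ H(1)] by (metis DiffD1 DiffD2 insertI1)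
    moreover have "\<Union>?N \<inter> \<Union>H1 = \<Union>H1" by blast
    ultimately show False using valid_configsD(3)[OF S H(1)] by simp
  qed
  have f: "finite ?M"
    using valid_config_finite[OF fin S] by (rule finite_subset[OF lineages_meeting_subset])
  have M: "lineages_meeting A (merge_pair S {H1, H2}) =
      (if H1 \<in> ?M \<or> H2 \<in> ?M then insert ?N (?M - {H1, H2}) else ?M - {H1, H2})"
  proof -
    have "\<Union>?N \<inter> A \<noteq> {} \<longleftrightarrow> H1 \<in> ?M \<or> H2 \<in> ?M"
      unfolding UN in_lineages_meeting using H by (simp add: Int_Un_distrib2)
    then show ?thesis
      unfolding m lineages_meeting_insert lineages_meeting_Diff by simp
  qed
  have N': "?N \<notin> ?M - {H1, H2}" using N lineages_meeting_subset by blast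
  consider "H1 \<in> ?M" "H2 \<in> ?M" | "H1 \<in> ?M" "H2 \<notin> ?M" | "H1 \<notin> ?M" "H2 \<in> ?M" | "H1 \<notin> ?M" "H2 \<notin> ?M"
    by blast
  then show ?thesis
  proof cases
    case 1
    have "card (?M - {H1, H2}) = nlin A S - 2" using 1 H f by (subst card_Diff_subset) auto
    moreover have "nlin A S \<ge> 2" using 1 H f card_mono[of ?M "{H1,H2}"] by auto
    ultimately show ?thesis using 1 N' f by (simp add: M card_insert_disjoint del: Diff_iff)
  next
    case 2
    have "?M - {H1, H2} = ?M - {H1}" using 2 by blast
    moreover have "nlin A S \<ge> 1" using 2 f by (metis One_nat_def Suc_leI card_gt_0_iff empty_iff)
    ultimately show ?thesis using 2 N' f by (simp add: M card_insert_disjoint del: Diff_iff)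
  next
    case 3
    have "?M - {H1, H2} = ?M - {H2}" using 3 by blast
    moreover have "nlin A S \<ge> 1" using 3 f by (metis One_nat_def Suc_leI card_gt_0_iff empty_iff)
    ultimately show ?thesis using 3 N' f by (simp add: M card_insert_disjoint del: Diff_iff)
  next
    case 4
    have "?M - {H1, H2} = ?M" using 4 by blast
    then show ?thesis using 4 by (simp add: M)
  qed
qed

lemma separates_nlin:
  assumes S: "S \<in> valid_configs L" and A: "A \<noteq> {}" and sep: "separates A W S"
  shows "nlin A S = 1"
proof -
  obtain C H where C: "C \<in> H" "H \<in> S" "C \<inter> (A \<union> W) = A"
    using sep unfolding separates_def by blast
  have "A \<subseteq> \<Union>H" using C by blast
  then have "H' \<in> lineages_meeting A S \<longleftrightarrow> H' = H" for H'
    using A C(2) valid_configsD(5)[OF S _ C(2), of H'] unfolding in_lineages_meeting by blast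
  then have "lineages_meeting A S = {H}" by blast
  then show ?thesis by simp
qed

lemma two_type_not_mixed:
  assumes "S \<in> valid_configs L" "\<not> mixed A W S"
    and "sA \<Longrightarrow> A \<noteq> {} \<and> (\<forall>j. v 1 j = 1)" "sW \<Longrightarrow> W \<noteq> {} \<and> (\<forall>i. v i 1 = 1)"
  shows "two_type sA sW v A W S = v (nlin A S) (nlin W S)"
  using assms separates_nlin[of S L A W] separates_nlin[of S L W A]
  unfolding two_type_def by auto

lemma nlin_le_card:
  assumes "S \<in> valid_configs L" "finite A"
  shows "nlin A S \<le> card A"
proof -
  let ?M = "lineages_meeting A S"
  define g where "g = (\<lambda>H. SOME x. x \<in> \<Union>H \<inter> A)"
  have g: "g H \<in> \<Union>H \<inter> A" if "H \<in> ?M" for H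
  proof -
    have "\<exists>x. x \<in> \<Union>H \<inter> A" using that unfolding in_lineages_meeting by blast
    then show ?thesis unfolding g_def by (rule someI_ex)
  qed
  have "inj_on g ?M"
  proof (rule inj_onI)
    fix H H' assume h: "H \<in> ?M" "H' \<in> ?M" "g H = g H'"
    then have "\<Union>H \<inter> \<Union>H' \<noteq> {}" using g[OF h(1)] g[OF h(2)] by (metis IntE IntI empty_iff)
    then show "H = H'" using valid_configsD(5)[OF assms(1)] h by (metis in_lineages_meeting)
  qed
  moreover have "g ` ?M \<subseteq> A" using g by blast
  ultimately show ?thesis by (metis card_inj_on_le assms(2))
qed

lemma nlin_eq_0_iff:
  assumes "S \<in> valid_configs L" "finite L" "A \<subseteq> L"
  shows "nlin A S = 0 \<longleftrightarrow> A = {}"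
proof -
  have "finite (lineages_meeting A S)"
    using valid_config_finite[OF assms(2,1)] by (rule finite_subset[OF lineages_meeting_subset])
  moreover have "lineages_meeting A S = {} \<longleftrightarrow> A = {}"
    using assms(3) valid_configsD(6)[OF assms(1)] unfolding lineages_meeting_def by blast
  ultimately show ?thesis by simp
qed

lemma sum_pairs_indicator:
  assumes "finite S" "M \<subseteq> S"
  shows "(\<Sum>p\<in>pairs S. if p \<subseteq> M then (c::real) else 0) = real (card M choose 2) * c"
proof -
  have "(\<Sum>p\<in>pairs S. if p \<subseteq> M then c else 0) = (\<Sum>p\<in>{p \<in> pairs S. p \<subseteq> M}. c)"
    using finite_pairs[OF assms(1)] by (subst sum.inter_filter) auto
  also have "{p \<in> pairs S. p \<subseteq> M} = {p. p \<subseteq> M \<and> card p = 2}"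
    using assms(2) by (auto simp: pairs_def)
  finally show ?thesis using n_subsets[of M 2] assms finite_subset by force
qed

lemma two_type_eigenfunction:
  assumes fin: "finite L" and AW: "A \<union> W \<subseteq> L" "A \<inter> W = {}"
    and sA: "sA \<Longrightarrow> A \<noteq> {} \<and> (\<forall>j. v 1 j = 1) \<and> lam = 0"
    and sW: "sW \<Longrightarrow> W \<noteq> {} \<and> (\<forall>i. v i 1 = 1) \<and> lam = 0"
    and v: "\<And>i j. i \<le> card A \<Longrightarrow> j \<le> card W \<Longrightarrow> i = 0 \<longleftrightarrow> A = {} \<Longrightarrow> j = 0 \<longleftrightarrow> W = {} \<Longrightarrow>
        \<not> (sA \<and> i = 1) \<Longrightarrow> \<not> (sW \<and> j = 1) \<Longrightarrow>
        real (i choose 2) * v (i - 1) j + real (j choose 2) * v i (j - 1)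
          = (real ((i + j) choose 2) - lam) * v i j"
  shows "eigenfunction (valid_configs L) lam (two_type sA sW v A W)"
  unfolding eigenfunction_def
proof
  let ?F = "two_type sA sW v A W"
  fix S assume S: "S \<in> valid_configs L"
  have finS: "finite S" using valid_config_finite[OF fin S] .
  let ?s = "\<lambda>S. sA \<and> separates A W S \<or> sW \<and> separates W A S"
  have sum1: "(\<Sum>p\<in>pairs S. (c::real)) = crate S * c" for c
    using sum_pairs_indicator[OF finS order_refl, of c]
    by (simp add: crate_def pairs_def)
  consider "?s S" | "\<not> ?s S" "mixed A W S" | "\<not> ?s S" "\<not> mixed A W S" by blast
  then show "(\<Sum>p\<in>pairs S. ?F (merge_pair S p)) = (crate S - lam) * ?F S"
  proof cases
    case 1
    have "?F (merge_pair S p) = 1" if p: "p \<in> pairs S" for p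
    proof -
      obtain H1 H2 where H: "p = {H1, H2}" "H1 \<noteq> H2" "H1 \<in> S" "H2 \<in> S"
        using p by (rule pairs_E)
      have "?s (merge_pair S p)"
        unfolding H(1) separates_merge_pair[OF H(3,4)] using 1 by blast
      then show ?thesis by (simp only: two_type_def if_True)
    qed
    then have "(\<Sum>p\<in>pairs S. ?F (merge_pair S p)) = (\<Sum>p\<in>pairs S. 1)" by (intro sum.cong refl)
    moreover have "?F S = 1" using 1 by (simp only: two_type_def if_True)
    moreover have "lam = 0" using 1 sA sW by blast
    ultimately show ?thesis unfolding sum1 by simp
  next
    case 2
    obtain C H where C: "C \<in> H" "H \<in> S" "C \<inter> A \<noteq> {}" "C \<inter> W \<noteq> {}"
      using 2(2) unfolding mixed_def by blast
    have CH: "C \<subseteq> \<Union>H" using C by blast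
    have "?F (merge_pair S p) = 0" if p: "p \<in> pairs S" for p
    proof -
      obtain H1 H2 where H: "p = {H1, H2}" "H1 \<noteq> H2" "H1 \<in> S" "H2 \<in> S"
        using p by (rule pairs_E)
      have no: "(\<Union>H1 \<union> \<Union>H2) \<inter> (B \<union> V) \<noteq> B" if B: "C \<inter> B \<noteq> {}" "C \<inter> V \<noteq> {}" "B \<inter> V = {}" for B V
      proof
        assume eq: "(\<Union>H1 \<union> \<Union>H2) \<inter> (B \<union> V) = B"
        then have "\<Union>H \<inter> (\<Union>H1 \<union> \<Union>H2) \<noteq> {}" using B(1) CH by blast
        then have "\<Union>H \<inter> \<Union>H1 \<noteq> {} \<or> \<Union>H \<inter> \<Union>H2 \<noteq> {}" by blast
        then have "H = H1 \<or> H = H2"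
          using valid_configsD(5)[OF S C(2) H(3)] valid_configsD(5)[OF S C(2) H(4)] by blast
        then have "C \<subseteq> \<Union>H1 \<union> \<Union>H2" using CH by blast
        then show False using eq B(2,3) by blast
      qed
      have "\<not> ?s (merge_pair S p)"
        unfolding H(1) using 2(1) no[OF C(3,4) AW(2)] no[OF C(4,3)] AW(2)
        by (simp add: separates_merge_pair[OF H(3,4)] Int_commute)
      moreover have "mixed A W (merge_pair S p)"
        unfolding H(1) using 2(2) by (simp add: mixed_merge_pair[OF H(3,4)])
      ultimately show ?thesis by (simp add: two_type_def)
    qed
    moreover have "?F S = 0" using 2 by (simp add: two_type_def)
    ultimately show ?thesis by simp
  next
    case 3
    let ?MA = "lineages_meeting A S" and ?MW = "lineages_meeting W S"
    let ?i = "nlin A S" and ?j = "nlin W S"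
    have FS: "?F S = v ?i ?j" using 3 by (auto simp: two_type_def)
    have disj: "?MA \<inter> ?MW = {}"
      using not_mixed_top[OF S 3(2)] unfolding lineages_meeting_def by blast
    have f: "finite ?MA" "finite ?MW"
      using finS lineages_meeting_subset finite_subset by metis+
    have cardU: "card (?MA \<union> ?MW) = ?i + ?j" using disj f by (simp add: card_Un_disjoint)
    have step: "?F (merge_pair S p) = v ?i ?j + (if p \<subseteq> ?MA then v (?i - 1) ?j else 0)
        + (if p \<subseteq> ?MW then v ?i (?j - 1) else 0) - (if p \<subseteq> ?MA \<union> ?MW then v ?i ?j else 0)"
      if p: "p \<in> pairs S" for p
    proof -
      obtain H1 H2 where H: "p = {H1, H2}" "H1 \<noteq> H2" "H1 \<in> S" "H2 \<in> S"
        using p by (rule pairs_E)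
      have V: "merge_pair S p \<in> valid_configs L" using merge_pair_valid[OF S p] .
      have mA: "\<Union>H1 \<inter> A \<noteq> {} \<longleftrightarrow> H1 \<in> ?MA" "\<Union>H2 \<inter> A \<noteq> {} \<longleftrightarrow> H2 \<in> ?MA"
        "\<Union>H1 \<inter> W \<noteq> {} \<longleftrightarrow> H1 \<in> ?MW" "\<Union>H2 \<inter> W \<noteq> {} \<longleftrightarrow> H2 \<in> ?MW"
        using H by (simp_all add: lineages_meeting_def)
      have mm: "mixed A W (merge_pair S p) \<longleftrightarrow> (H1 \<in> ?MA \<or> H2 \<in> ?MA) \<and> (H1 \<in> ?MW \<or> H2 \<in> ?MW)"
        unfolding H(1) mixed_merge_pair[OF H(3,4)] using 3(2) mA by blast
      have n: "nlin A (merge_pair S p) = (if p \<subseteq> ?MA then ?i - 1 else ?i)"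
          "nlin W (merge_pair S p) = (if p \<subseteq> ?MW then ?j - 1 else ?j)"
        unfolding H(1) by (rule nlin_merge_pair[OF S fin H(3,4,2)])+
      show ?thesis
      proof (cases "mixed A W (merge_pair S p)")
        case True
        then have "(\<Union>H1 \<union> \<Union>H2) \<inter> A \<noteq> {}" "(\<Union>H1 \<union> \<Union>H2) \<inter> W \<noteq> {}"
          using mm mA by blast+
        then have "\<not> ?s (merge_pair S p)"
          unfolding H(1) separates_merge_pair[OF H(3,4)] using 3(1) AW(2) by blast
        then have "?F (merge_pair S p) = 0" using True by (simp add: two_type_def)
        moreover have "p \<subseteq> ?MA \<union> ?MW" "\<not> p \<subseteq> ?MA" "\<not> p \<subseteq> ?MW"
          using True mm disj unfolding H(1) by auto
        ultimately show ?thesis by simp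
      next
        case False
        have "?F (merge_pair S p) = v (nlin A (merge_pair S p)) (nlin W (merge_pair S p))"
          using sA sW by (intro two_type_not_mixed[OF V False]) auto
        moreover have "p \<subseteq> ?MA \<Longrightarrow> \<not> p \<subseteq> ?MW" using disj unfolding H(1) by blast
        moreover have "p \<subseteq> ?MA \<union> ?MW \<Longrightarrow> p \<subseteq> ?MA \<or> p \<subseteq> ?MW"
          using False mm unfolding H(1) by auto
        ultimately show ?thesis unfolding n by (auto simp: le_supI1 le_supI2)
      qed
    qed
    have "(\<Sum>p\<in>pairs S. ?F (merge_pair S p))
        = crate S * v ?i ?j + real (?i choose 2) * v (?i - 1) ?j + real (?j choose 2) * v ?i (?j - 1)
          - real ((?i + ?j) choose 2) * v ?i ?j"
      by (subst sum.cong[OF refl step])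
        (simp_all only: sum.distrib sum_subtractf sum1 cardU sum_pairs_indicator[OF finS]
          lineages_meeting_subset Un_subset_iff simp_thms)
    also have "\<dots> = (crate S - lam) * v ?i ?j"
    proof (cases "sA \<and> ?i = 1 \<or> sW \<and> ?j = 1")
      case False
      have "finite A" "finite W" using AW fin finite_subset by auto
      then have "?i \<le> card A" "?j \<le> card W" using nlin_le_card[OF S] by blast+
      moreover have "?i = 0 \<longleftrightarrow> A = {}" "?j = 0 \<longleftrightarrow> W = {}"
        using nlin_eq_0_iff[OF S fin] AW(1) by simp_all
      ultimately have "real (?i choose 2) * v (?i - 1) ?j + real (?j choose 2) * v ?i (?j - 1)
          = (real ((?i + ?j) choose 2) - lam) * v ?i ?j"
        using False by (intro v) auto
      then show ?thesis by (simp add: algebra_simps)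
    next
      case True
      have "separates B V S" if B: "card (lineages_meeting B S) = 1" "\<not> mixed B V S" "B \<union> V \<subseteq> L" for B V
      proof -
        obtain H where H: "lineages_meeting B S = {H}" using B(1) by (auto simp: card_1_singleton_iff)
        then have HS: "H \<in> S" "\<Union>H \<inter> B \<noteq> {}" by (auto simp: lineages_meeting_def)
        have "B \<subseteq> \<Union>H"
        proof
          fix x assume x: "x \<in> B"
          then obtain H' where "H' \<in> S" "x \<in> \<Union>H'" using valid_configsD(6)[OF S] B(3) by blast
          then show "x \<in> \<Union>H" using H x unfolding lineages_meeting_def by blast
        qed
        moreover have "\<Union>H \<inter> V = {}" using not_mixed_top[OF S B(2) HS(1)] HS(2) by blast
        ultimately show ?thesis
          unfolding separates_def using valid_configsD(2)[OF S HS(1)] HS(1) by blast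
      qed
      then have "?s S" using True 3(2) mixed_commute[of W A S] AW(1) by (metis Un_commute)
      then show ?thesis using 3(1) by simp
    qed
    finally show ?thesis by (simp add: FS)
  qed
qed

definition unmerged :: "'a set \<Rightarrow> 'a config \<Rightarrow> real" where
  "unmerged Z S = (if nlin Z S = card Z then 1 else 0)"

lemma unmerged_eq_two_type:
  "unmerged Z S = two_type False False (\<lambda>i j. if i = card Z then 1 else 0) Z {} S"
  by (simp add: two_type_def mixed_def unmerged_def)

lemma separates_Un: "separates A W (S1 \<union> S2) \<longleftrightarrow> separates A W S1 \<or> separates A W S2"
  by (simp add: separates_def bex_Un)

lemma mixed_Un: "mixed A W (S1 \<union> S2) \<longleftrightarrow> mixed A W S1 \<or> mixed A W S2"
  by (simp add: mixed_def bex_Un)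

lemma nlin_Un:
  assumes "S1 \<in> valid_configs L1" "S2 \<in> valid_configs L2" "L1 \<inter> L2 = {}" "finite L1" "finite L2"
  shows "nlin A (S1 \<union> S2) = nlin A S1 + nlin A S2"
proof -
  have "finite S1" "finite S2" using assms valid_config_finite by blast+
  moreover have "S1 \<inter> S2 = {}"
  proof (rule ccontr)
    assume "S1 \<inter> S2 \<noteq> {}"
    then obtain H where "H \<in> S1" "H \<in> S2" by blast
    then have "\<Union>H \<subseteq> L1" "\<Union>H \<subseteq> L2" "\<Union>H \<noteq> {}"
      using assms valid_configsD(3,4) by blast+
    then show False using assms(3) by blast
  qed
  moreover have "lineages_meeting A (S1 \<union> S2) = lineages_meeting A S1 \<union> lineages_meeting A S2"
    by (auto simp: lineages_meeting_def)
  ultimately show ?thesis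
    by (simp add: card_Un_disjoint finite_subset[OF lineages_meeting_subset]
        disjoint_iff lineages_meeting_def)
qed

lemma cluster_subset: "S \<in> valid_configs L \<Longrightarrow> C \<in> \<Union>S \<Longrightarrow> C \<subseteq> L"
  using valid_configsD(6) by blast

lemma nlin_restrict:
  assumes "S \<in> valid_configs L" "A \<inter> L = B"
  shows "nlin A S = nlin B S"
proof -
  have "\<Union>H \<inter> A = \<Union>H \<inter> B" if "H \<in> S" for H
    using valid_configsD(4)[OF assms(1) that] assms(2) by blast
  then have "lineages_meeting A S = lineages_meeting B S"
    unfolding lineages_meeting_def by (intro Collect_cong) (metis)
  then show ?thesis by simp
qed

lemma mixed_restrict:
  assumes "S \<in> valid_configs L" "A \<inter> L = B" "W \<inter> L = V"
  shows "mixed A W S = mixed B V S"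
  unfolding mixed_def
proof (intro bex_cong refl)
  fix C assume "C \<in> \<Union>S"
  then have "C \<subseteq> L" by (rule cluster_subset[OF assms(1)])
  then have "C \<inter> A = C \<inter> B" "C \<inter> W = C \<inter> V" using assms(2,3) by blast+
  then show "(C \<inter> A \<noteq> {} \<and> C \<inter> W \<noteq> {}) = (C \<inter> B \<noteq> {} \<and> C \<inter> V \<noteq> {})" by simp
qed

lemma separates_restrict:
  assumes "S \<in> valid_configs L" "A \<subseteq> L" "W \<inter> L = V"
  shows "separates A W S = separates A V S"
  unfolding separates_def
proof (intro bex_cong refl)
  fix C assume "C \<in> \<Union>S"
  then have "C \<subseteq> L" by (rule cluster_subset[OF assms(1)])
  then show "C \<inter> (A \<union> W) = A \<longleftrightarrow> C \<inter> (A \<union> V) = A" using assms by blast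
qed

lemma not_separates: "S \<in> valid_configs L \<Longrightarrow> \<not> A \<subseteq> L \<Longrightarrow> \<not> separates A W S"
  unfolding separates_def using cluster_subset[of S L] by (metis Int_lower1 subset_trans)

lemma nlin_empty [simp]: "nlin {} S = 0"
  by (simp add: lineages_meeting_def)

lemma not_mixed_empty [simp]: "\<not> mixed {} W S" "\<not> mixed A {} S"
  by (simp_all add: mixed_def)

lemma nlin_singleton:
  assumes "S \<in> valid_configs L" "finite L" "a \<in> L"
  shows "nlin {a} S = 1"
  using nlin_le_card[OF assms(1), of "{a}"] nlin_eq_0_iff[OF assms(1,2), of "{a}"] assms(3)
  by simp

lemma unmerged_Un:
  assumes S: "S1 \<in> valid_configs L1" "S2 \<in> valid_configs L2" and L: "L1 \<inter> L2 = {}" "finite L1" "finite L2"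
    and Z: "Z1 \<subseteq> L1" "Z2 \<subseteq> L2"
  shows "unmerged (Z1 \<union> Z2) (S1 \<union> S2) = unmerged Z1 S1 * unmerged Z2 S2"
proof -
  have f: "finite Z1" "finite Z2" using Z L finite_subset by blast+
  have "nlin (Z1 \<union> Z2) (S1 \<union> S2) = nlin Z1 S1 + nlin Z2 S2"
    unfolding nlin_Un[OF S L]
    using nlin_restrict[OF S(1), of "Z1 \<union> Z2" Z1] nlin_restrict[OF S(2), of "Z1 \<union> Z2" Z2] Z L(1) by fastforce
  moreover have "card (Z1 \<union> Z2) = card Z1 + card Z2"
    using f Z L(1) by (intro card_Un_disjoint) auto
  moreover have "nlin Z1 S1 \<le> card Z1" "nlin Z2 S2 \<le> card Z2"
    using nlin_le_card S f by blast+
  ultimately show ?thesis by (auto simp: unmerged_def)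
qed

lemma nlin_doubleton:
  assumes S: "S \<in> valid_configs L" and L: "finite L" "a \<in> L" "b \<in> L" "a \<noteq> b"
  shows "nlin {a, b} S = (if unmerged {a, b} S = 1 then 2 else 1)"
    and "unmerged {a, b} S = (if mixed {a} {b} S then 0 else 1)"
    and "unmerged {a, b} S \<in> {0, 1}"
proof -
  have le: "nlin {a, b} S \<le> 2" "nlin {a, b} S \<noteq> 0"
    using nlin_le_card[OF S, of "{a,b}"] nlin_eq_0_iff[OF S L(1), of "{a,b}"] L by auto
  then show "nlin {a, b} S = (if unmerged {a, b} S = 1 then 2 else 1)"
    using L(4) by (auto simp: unmerged_def)
  show "unmerged {a, b} S \<in> {0, 1}" by (simp add: unmerged_def)
  obtain Ha Hb where H: "Ha \<in> S" "a \<in> \<Union>Ha" "Hb \<in> S" "b \<in> \<Union>Hb"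
    using L valid_configsD(6)[OF S] by blast
  have "H' \<in> lineages_meeting {a, b} S \<longleftrightarrow> H' = Ha \<or> H' = Hb" for H'
    using H valid_configsD(5)[OF S H(1), of H'] valid_configsD(5)[OF S H(3), of H']
    unfolding in_lineages_meeting by blast
  then have lm: "lineages_meeting {a, b} S = {Ha, Hb}" by blast
  have "mixed {a} {b} S \<longleftrightarrow> Ha = Hb"
  proof
    assume "mixed {a} {b} S"
    then obtain C H' where "C \<in> H'" "H' \<in> S" "a \<in> C" "b \<in> C" unfolding mixed_def by blast
    then have H': "H' \<in> S" "a \<in> \<Union>H'" "b \<in> \<Union>H'" by blast+
    have "H' = Ha" using valid_configsD(5)[OF S H'(1) H(1)] H'(2) H(2) by blast
    moreover have "H' = Hb" using valid_configsD(5)[OF S H'(1) H(3)] H'(3) H(4) by blast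
    ultimately show "Ha = Hb" by simp
  next
    assume "Ha = Hb"
    moreover have "\<Union>Ha \<in> \<Union>S" using valid_configsD(2)[OF S H(1)] H(1) by blast
    ultimately show "mixed {a} {b} S" using H unfolding mixed_def by (intro bexI[of _ "\<Union>Ha"]) auto
  qed
  then show "unmerged {a, b} S = (if mixed {a} {b} S then 0 else 1)"
    using L(4) by (simp add: unmerged_def lm card_insert_if)
qed

subsection \<open>Restricting to few taxa\<close>

primrec depth :: "'a stree \<Rightarrow> 'a \<Rightarrow> 'a \<Rightarrow> real" where
  "depth (SLeaf x) a b = 0"
| "depth (SNode len l r) a b = len +
     (if a \<in> sleaves l \<and> b \<in> sleaves l then depth l a b
      else if a \<in> sleaves r \<and> b \<in> sleaves r then depth r a b else 0)"

text \<open>Functions that only see the genes in \<open>Z\<close>; irrelevant taxa may then be pruned.\<close>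

definition local_eigenfunction :: "'a set \<Rightarrow> real \<Rightarrow> ('a config \<Rightarrow> real) \<Rightarrow> bool" where
  "local_eigenfunction Z lam F \<longleftrightarrow>
     (\<forall>L. finite L \<and> Z \<subseteq> L \<longrightarrow> eigenfunction (valid_configs L) lam F) \<and>
     (\<forall>L1 L2 S1 S2. S1 \<in> valid_configs L1 \<and> S2 \<in> valid_configs L2 \<and> L1 \<inter> L2 = {} \<and>
        finite L1 \<and> finite L2 \<and> Z \<subseteq> L1 \<longrightarrow> F (S1 \<union> S2) = F S1)"

definition splits_at :: "'a stree \<Rightarrow> 'a set \<Rightarrow> 'a stree \<Rightarrow> 'a stree \<Rightarrow> real \<Rightarrow> bool" where
  "splits_at t Z l r s \<longleftrightarrow>
     distinct (sleaf_list l) \<and> distinct (sleaf_list r) \<and> sleaves l \<inter> sleaves r = {} \<and>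
     pos_below l \<and> pos_below r \<and> Z \<subseteq> sleaves l \<union> sleaves r \<and>
     Z \<inter> sleaves l \<noteq> {} \<and> Z \<inter> sleaves r \<noteq> {} \<and>
     (\<forall>a\<in>Z. \<forall>b\<in>Z. depth t a b =
        (if a \<in> sleaves l \<and> b \<in> sleaves l then s + depth l a b
         else if a \<in> sleaves r \<and> b \<in> sleaves r then s + depth r a b else s))"

lemma depth_commute: "depth t a b = depth t b a"
  by (induction t) auto

lemma depth_pos:
  assumes "pos_below t" "a \<in> sleaves t" "b \<in> sleaves t" "a \<noteq> b"
  shows "0 < depth t a b"
proof -
  have nn: "0 \<le> depth t a b" if "pos_below t" for t :: "'a stree"
    using that by (induction t) auto
  show ?thesis using assms nn by (cases t) (auto intro: add_pos_nonneg)
qed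

lemma splits_at_commute:
  assumes "splits_at t Z l r s"
  shows "splits_at t Z r l s"
proof -
  have d: "sleaves l \<inter> sleaves r = {}" using assms unfolding splits_at_def by simp
  show ?thesis using assms d unfolding splits_at_def by (auto simp: Un_commute Int_commute)
qed

lemma join_expect_left:
  assumes "distinct (sleaf_list r)" "pos_below r"
  shows "join_expect l r (\<lambda>S1 S2. F S1) = out_expect l F"
  using join_expect_mult[of l r F "\<lambda>_. 1"] out_expect_const[OF assms, of 1] by simp

lemma join_expect_local:
  assumes F: "local_eigenfunction Z lam F" and d: "distinct (sleaf_list l)" "distinct (sleaf_list r)"
    "sleaves l \<inter> sleaves r = {}" and r: "pos_below r" and Z: "Z \<subseteq> sleaves l"
  shows "join_expect l r (\<lambda>S1 S2. F (S1 \<union> S2)) = out_expect l F"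
proof -
  have "join_expect l r (\<lambda>S1 S2. F (S1 \<union> S2)) = join_expect l r (\<lambda>S1 S2. F S1)"
  proof (rule join_expect_cong[OF d(1,2)])
    fix S1 S2 assume "S1 \<in> valid_configs (sleaves l)" "S2 \<in> valid_configs (sleaves r)"
    then show "F (S1 \<union> S2) = F S1"
      using F[unfolded local_eigenfunction_def, THEN conjunct2, rule_format] d(3) Z finite_sleaves
      by (metis (no_types))
  qed
  then show ?thesis using join_expect_left[OF d(2) r] by simp
qed

lemma out_expect_split:
  assumes "distinct (sleaf_list t)" "pos_below t" "Z \<subseteq> sleaves t" "2 \<le> card Z"
  shows "\<exists>l r s. splits_at t Z l r s \<and> (\<forall>lam F. local_eigenfunction Z lam F \<longrightarrow>
    out_expect t F = exp (- lam * s) * join_expect l r (\<lambda>S1 S2. F (S1 \<union> S2)))"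
  using assms
proof (induction t)
  case (SLeaf a)
  then show ?case using card_mono[of "{a}" Z] by simp
next
  case (SNode len l r)
  let ?t = "SNode len l r"
  have d: "distinct (sleaf_list l)" "distinct (sleaf_list r)" "sleaves l \<inter> sleaves r = {}"
    using SNode.prems(1) by (auto simp: sleaves_def)
  have pos: "0 < len" "pos_below l" "pos_below r" using SNode.prems by auto
  have out: "out_expect ?t F = exp (- lam * len) * join_expect l r (\<lambda>S1 S2. F (S1 \<union> S2))"
    if "local_eigenfunction Z lam F" for lam F
    using that SNode.prems(3) pos(1) finite_sleaves[of ?t] unfolding local_eigenfunction_def
    by (intro out_expect_SNode[OF SNode.prems(1)]) (simp_all del: sleaves_simps)
  consider "Z \<subseteq> sleaves l" | "Z \<subseteq> sleaves r" | "Z \<inter> sleaves l \<noteq> {}" "Z \<inter> sleaves r \<noteq> {}"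
    using SNode.prems(3) by fastforce
  then show ?case
  proof cases
    case 1
    obtain l' r' s where IH: "splits_at l Z l' r' s" "\<And>lam F. local_eigenfunction Z lam F \<Longrightarrow>
        out_expect l F = exp (- lam * s) * join_expect l' r' (\<lambda>S1 S2. F (S1 \<union> S2))"
      using SNode.IH(1)[OF d(1) pos(2) 1 SNode.prems(4)] by blast
    have dep: "depth ?t a b = len + depth l a b" if "a \<in> Z" "b \<in> Z" for a b
      using that 1 by auto
    have "splits_at ?t Z l' r' (len + s)"
      using IH(1) dep unfolding splits_at_def by (simp add: add.assoc)
    moreover have "out_expect ?t F = exp (- lam * (len + s)) * join_expect l' r' (\<lambda>S1 S2. F (S1 \<union> S2))"
      if F: "local_eigenfunction Z lam F" for lam F
      using out[OF F] IH(2)[OF F] join_expect_local[OF F d pos(3) 1]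
      by (simp add: algebra_simps exp_add exp_diff exp_minus field_simps)
    ultimately show ?thesis by blast
  next
    case 2
    obtain l' r' s where IH: "splits_at r Z l' r' s" "\<And>lam F. local_eigenfunction Z lam F \<Longrightarrow>
        out_expect r F = exp (- lam * s) * join_expect l' r' (\<lambda>S1 S2. F (S1 \<union> S2))"
      using SNode.IH(2)[OF d(2) pos(3) 2 SNode.prems(4)] by blast
    have dep: "depth ?t a b = len + depth r a b" if "a \<in> Z" "b \<in> Z" for a b
      using that 2 d(3) by auto
    have "splits_at ?t Z l' r' (len + s)"
      using IH(1) dep unfolding splits_at_def by (simp add: add.assoc)
    moreover have "out_expect ?t F = exp (- lam * (len + s)) * join_expect l' r' (\<lambda>S1 S2. F (S1 \<union> S2))"
      if F: "local_eigenfunction Z lam F" for lam F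
      using out[OF F] IH(2)[OF F] join_expect_local[OF F d(2,1) _ pos(2) 2] d(3) join_expect_commute[of l r F]
      by (simp add: Int_commute algebra_simps exp_add exp_diff exp_minus field_simps)
    ultimately show ?thesis by blast
  next
    case 3
    have "splits_at ?t Z l r len"
      unfolding splits_at_def using d pos 3 SNode.prems(3) by auto
    then show ?thesis using out by blast
  qed
qed

lemma root_expect_split:
  assumes t: "distinct (sleaf_list t)" "pos_internal t" "Z \<subseteq> sleaves t" "2 \<le> card Z"
  shows "\<exists>l r s. splits_at t Z l r s \<and> (\<forall>F. local_eigenfunction Z 0 F \<longrightarrow>
    root_expect t F = join_expect l r (\<lambda>S1 S2. F (S1 \<union> S2)))"
proof (cases t)
  case (SLeaf a)
  then show ?thesis using t card_mono[of "{a}" Z] by simp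
next
  case (SNode len l r)
  \<comment> \<open>A harmonic function does not notice if the root population has finite duration.\<close>
  let ?t = "SNode 1 l r"
  have t': "distinct (sleaf_list ?t)" "pos_below ?t" "Z \<subseteq> sleaves ?t" using t SNode by simp_all
  obtain l' r' s where sp: "splits_at ?t Z l' r' s" and E: "\<And>lam F. local_eigenfunction Z lam F \<Longrightarrow>
      out_expect ?t F = exp (- lam * s) * join_expect l' r' (\<lambda>S1 S2. F (S1 \<union> S2))"
    using out_expect_split[OF t' t(4)] by blast
  have dep: "depth t a b = depth ?t a b + (len - 1)" for a b using SNode by simp
  have "splits_at t Z l' r' (s + (len - 1))"
    using sp unfolding splits_at_def dep by (simp del: depth.simps)
  moreover have "root_expect t F = join_expect l' r' (\<lambda>S1 S2. F (S1 \<union> S2))"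
    if F: "local_eigenfunction Z 0 F" for F
  proof -
    have "eigenfunction (valid_configs (sleaves (SNode k l r))) 0 F" for k
      using F t'(3) finite_sleaves[of ?t] unfolding local_eigenfunction_def by simp
    then have "root_expect t F = out_expect ?t F"
      using root_expect_SNode_harmonic[of len l r F] out_expect_SNode[of 1 l r 0 F] t'(1) SNode by simp
    then show ?thesis using E[OF F] by simp
  qed
  ultimately show ?thesis by blast
qed

lemma out_expect_splitE:
  assumes "distinct (sleaf_list t)" "pos_below t" "Z \<subseteq> sleaves t" "2 \<le> card Z" "a \<in> Z"
  obtains l r s where "splits_at t Z l r s" "a \<in> sleaves l"
    "\<And>lam F. local_eigenfunction Z lam F \<Longrightarrow>
      out_expect t F = exp (- lam * s) * join_expect l r (\<lambda>S1 S2. F (S1 \<union> S2))"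
proof -
  obtain l r s where *: "splits_at t Z l r s" "\<And>lam F. local_eigenfunction Z lam F \<Longrightarrow>
      out_expect t F = exp (- lam * s) * join_expect l r (\<lambda>S1 S2. F (S1 \<union> S2))"
    using out_expect_split[OF assms(1-4)] by blast
  have "a \<in> sleaves l \<or> a \<in> sleaves r" using *(1) assms(5) unfolding splits_at_def by blast
  then show ?thesis using that[OF *(1) _ *(2)] that[OF splits_at_commute[OF *(1)]] *(2)
      join_expect_commute[of l r] by metis
qed

lemma root_expect_splitE:
  assumes "distinct (sleaf_list t)" "pos_internal t" "Z \<subseteq> sleaves t" "2 \<le> card Z" "a \<in> Z"
  obtains l r s where "splits_at t Z l r s" "a \<in> sleaves l"
    "\<And>F. local_eigenfunction Z 0 F \<Longrightarrow> root_expect t F = join_expect l r (\<lambda>S1 S2. F (S1 \<union> S2))"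
proof -
  obtain l r s where *: "splits_at t Z l r s" "\<And>F. local_eigenfunction Z 0 F \<Longrightarrow>
      root_expect t F = join_expect l r (\<lambda>S1 S2. F (S1 \<union> S2))"
    using root_expect_split[OF assms(1-4)] by blast
  have "a \<in> sleaves l \<or> a \<in> sleaves r" using *(1) assms(5) unfolding splits_at_def by blast
  then show ?thesis using that[OF *(1) _ *(2)] that[OF splits_at_commute[OF *(1)]] *(2)
      join_expect_commute[of l r] by metis
qed

lemma splits_at_side:
  assumes "splits_at t Z l r s" "a \<in> Z" "b \<in> Z" "a \<noteq> b" "a \<in> sleaves l"
  shows "b \<in> sleaves l \<Longrightarrow> s < depth t a b \<and> depth l a b = depth t a b - s"
    and "b \<notin> sleaves l \<Longrightarrow> b \<in> sleaves r \<and> depth t a b = s"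
proof -
  have "a \<notin> sleaves r" using assms unfolding splits_at_def by blast
  moreover have "pos_below l" "Z \<subseteq> sleaves l \<union> sleaves r" using assms unfolding splits_at_def by simp_all
  moreover have "depth t a b =
        (if a \<in> sleaves l \<and> b \<in> sleaves l then s + depth l a b
         else if a \<in> sleaves r \<and> b \<in> sleaves r then s + depth r a b else s)"
    using assms unfolding splits_at_def by blast
  ultimately show "b \<in> sleaves l \<Longrightarrow> s < depth t a b \<and> depth l a b = depth t a b - s"
    and "b \<notin> sleaves l \<Longrightarrow> b \<in> sleaves r \<and> depth t a b = s"
    using assms depth_pos[of l a b] by auto
qed

lemma splits_at_depth:
  assumes sp: "splits_at t Z l r s" and a: "a \<in> Z" "a \<in> sleaves l"
    and m: "\<forall>y\<in>Z - {a}. m \<le> depth t a y" "\<exists>y\<in>Z - {a}. depth t a y = m"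
  shows "s = m" and "y \<in> Z \<Longrightarrow> y \<noteq> a \<Longrightarrow> depth t a y = m \<Longrightarrow> y \<in> sleaves r"
    and "y \<in> Z \<Longrightarrow> y \<noteq> a \<Longrightarrow> m < depth t a y \<Longrightarrow> y \<in> sleaves l \<and> depth l a y = depth t a y - m"
proof -
  have side: "y \<in> sleaves l \<and> s < depth t a y \<and> depth l a y = depth t a y - s \<or>
      y \<in> sleaves r \<and> depth t a y = s" if "y \<in> Z" "y \<noteq> a" for y
    using splits_at_side[OF sp a(1) that(1) _ a(2)] that(2) by blast
  obtain w where w: "w \<in> Z" "w \<in> sleaves r" "w \<notin> sleaves l" using sp unfolding splits_at_def by blast
  obtain z where z: "z \<in> Z - {a}" "depth t a z = m" using m(2) by blast
  have "w \<noteq> a" using w(3) a(2) by blast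
  then have "depth t a w = s" "m \<le> depth t a w" using side[of w] m(1) w by blast+
  then show s: "s = m" using side[of z] z by auto
  show "y \<in> Z \<Longrightarrow> y \<noteq> a \<Longrightarrow> depth t a y = m \<Longrightarrow> y \<in> sleaves r"
    "y \<in> Z \<Longrightarrow> y \<noteq> a \<Longrightarrow> m < depth t a y \<Longrightarrow> y \<in> sleaves l \<and> depth l a y = depth t a y - m"
    using side[of y] s by auto
qed

lemma splits_at_right:
  assumes "splits_at t Z l r s" "a \<in> Z" "b \<in> Z" "a \<noteq> b" "a \<in> sleaves r" "b \<in> sleaves r"
  shows "s < depth t a b" "depth r a b = depth t a b - s"
  using splits_at_side(1)[OF splits_at_commute[OF assms(1)] assms(2-6)] by auto

lemma splits_at_nonempty: "splits_at t Z l r s \<Longrightarrow> \<exists>b\<in>Z. b \<in> sleaves r \<and> b \<notin> sleaves l"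
  unfolding splits_at_def by blast

lemma two_type_Un:
  assumes S: "S1 \<in> valid_configs L1" "S2 \<in> valid_configs L2"
    and L: "L1 \<inter> L2 = {}" "finite L1" "finite L2"
    and AW: "A1 \<union> W1 \<subseteq> L1" "A2 \<union> W2 \<subseteq> L2" "A1 \<union> A2 = A" "W1 \<union> W2 = W"
    and ne: "sA \<Longrightarrow> A \<noteq> {}" "sW \<Longrightarrow> W \<noteq> {}"
  shows "two_type sA sW v A W (S1 \<union> S2) =
    (if sA \<and> (A2 = {} \<and> separates A1 W1 S1 \<or> A1 = {} \<and> separates A2 W2 S2) \<or>
        sW \<and> (W2 = {} \<and> separates W1 A1 S1 \<or> W1 = {} \<and> separates W2 A2 S2) then 1
     else if mixed A1 W1 S1 \<or> mixed A2 W2 S2 then 0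
     else v (nlin A1 S1 + nlin A2 S2) (nlin W1 S1 + nlin W2 S2))"
proof -
  have i: "A \<inter> L1 = A1" "A \<inter> L2 = A2" "W \<inter> L1 = W1" "W \<inter> L2 = W2"
    using AW L(1) by blast+
  have sep: "separates B V (S1 \<union> S2) \<longleftrightarrow>
      (B2 = {} \<and> separates B1 V1 S1 \<or> B1 = {} \<and> separates B2 V2 S2)"
    if "B \<inter> L1 = B1" "B \<inter> L2 = B2" "V \<inter> L1 = V1" "V \<inter> L2 = V2" "B \<noteq> {}" "B1 \<union> B2 = B" for B V B1 B2 V1 V2
  proof -
    have "separates B V S1 \<longleftrightarrow> B2 = {} \<and> separates B1 V1 S1"
    proof (cases "B \<subseteq> L1")
      case True
      then have "B2 = {}" "B = B1" using that L(1) by blast+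
      then show ?thesis using separates_restrict[OF S(1) True that(3)] by simp
    next
      case False
      then have "B2 \<noteq> {}" using that by blast
      then show ?thesis using not_separates[OF S(1) False] by simp
    qed
    moreover have "separates B V S2 \<longleftrightarrow> B1 = {} \<and> separates B2 V2 S2"
    proof (cases "B \<subseteq> L2")
      case True
      then have "B1 = {}" "B = B2" using that L(1) by blast+
      then show ?thesis using separates_restrict[OF S(2) True that(4)] by simp
    next
      case False
      then have "B1 \<noteq> {}" using that by blast
      then show ?thesis using not_separates[OF S(2) False] by simp
    qed
    ultimately show ?thesis by (simp add: separates_Un)
  qed
  have m: "mixed A W (S1 \<union> S2) \<longleftrightarrow> mixed A1 W1 S1 \<or> mixed A2 W2 S2"
    unfolding mixed_Un using mixed_restrict[OF S(1) i(1,3)] mixed_restrict[OF S(2) i(2,4)] by simp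
  have n: "nlin A (S1 \<union> S2) = nlin A1 S1 + nlin A2 S2" "nlin W (S1 \<union> S2) = nlin W1 S1 + nlin W2 S2"
    unfolding nlin_Un[OF S L] nlin_restrict[OF S(1) i(1)] nlin_restrict[OF S(2) i(2)]
      nlin_restrict[OF S(1) i(3)] nlin_restrict[OF S(2) i(4)] by simp_all
  show ?thesis
    unfolding two_type_def m n using sep[OF i ] sep[OF i(3,4,1,2)] ne AW(3,4)
    by (cases sA; cases sW) simp_all
qed

lemma two_type_local:
  assumes AW: "finite A" "finite W" "A \<inter> W = {}"
    and sA: "sA \<Longrightarrow> A \<noteq> {} \<and> (\<forall>j. v 1 j = 1) \<and> lam = 0"
    and sW: "sW \<Longrightarrow> W \<noteq> {} \<and> (\<forall>i. v i 1 = 1) \<and> lam = 0"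
    and v: "\<And>i j. i \<le> card A \<Longrightarrow> j \<le> card W \<Longrightarrow> i = 0 \<longleftrightarrow> A = {} \<Longrightarrow> j = 0 \<longleftrightarrow> W = {} \<Longrightarrow>
        \<not> (sA \<and> i = 1) \<Longrightarrow> \<not> (sW \<and> j = 1) \<Longrightarrow>
        real (i choose 2) * v (i - 1) j + real (j choose 2) * v i (j - 1)
          = (real ((i + j) choose 2) - lam) * v i j"
  shows "local_eigenfunction (A \<union> W) lam (two_type sA sW v A W)"
  unfolding local_eigenfunction_def
proof (intro conjI allI impI)
  fix L assume "finite L \<and> A \<union> W \<subseteq> L"
  then show "eigenfunction (valid_configs L) lam (two_type sA sW v A W)"
    using two_type_eigenfunction[of L A W sA v lam sW] AW(3) sA sW v by blast
next
  fix L1 L2 S1 S2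
  assume a: "S1 \<in> valid_configs L1 \<and> S2 \<in> valid_configs L2 \<and> L1 \<inter> L2 = {} \<and>
        finite L1 \<and> finite L2 \<and> A \<union> W \<subseteq> L1"
  then have "two_type sA sW v A W (S1 \<union> S2) =
    (if sA \<and> (separates A W S1 \<or> A = {} \<and> separates {} {} S2) \<or>
        sW \<and> (separates W A S1 \<or> W = {} \<and> separates {} {} S2) then 1
     else if mixed A W S1 \<or> mixed {} {} S2 then 0
     else v (nlin A S1 + nlin {} S2) (nlin W S1 + nlin {} S2))"
    using two_type_Un[of S1 L1 S2 L2 A W "{}" "{}" A W sA sW v] sA sW by simp
  then show "two_type sA sW v A W (S1 \<union> S2) = two_type sA sW v A W S1"
    unfolding two_type_def using sA sW by auto
qed

lemma unmerged_local: "finite Z \<Longrightarrow> local_eigenfunction Z (real (card Z choose 2)) (unmerged Z)"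
proof -
  assume f: "finite Z"
  have "local_eigenfunction (Z \<union> {}) (real (card Z choose 2))
      (two_type False False (\<lambda>i j. if i = card Z then 1 else 0) Z {})"
    using f by (intro two_type_local) (auto simp: le_Suc_eq)
  then show ?thesis by (simp add: unmerged_eq_two_type[abs_def])
qed

lemma unmerged_Un_same:
  assumes S: "S \<in> valid_configs L" and fin: "finite L" and AW: "A \<union> W \<subseteq> L" "A \<inter> W = {}"
  shows "unmerged (A \<union> W) S =
    (if \<not> mixed A W S \<and> nlin A S = card A \<and> nlin W S = card W then 1 else 0)"
proof -
  let ?MA = "lineages_meeting A S" and ?MW = "lineages_meeting W S"
  have f: "finite ?MA" "finite ?MW" "finite A" "finite W"
    using valid_config_finite[OF fin S] lineages_meeting_subset finite_subset AW fin by (metis, metis, blast, blast)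
  have U: "lineages_meeting (A \<union> W) S = ?MA \<union> ?MW"
    by (auto simp: in_lineages_meeting Int_Un_distrib simp del: Union_iff)
  have c: "card (A \<union> W) = card A + card W" using f AW by (simp add: card_Un_disjoint)
  have le: "nlin A S \<le> card A" "nlin W S \<le> card W" using nlin_le_card[OF S] f by blast+
  have mix: "mixed A W S \<longleftrightarrow> ?MA \<inter> ?MW \<noteq> {}"
  proof
    assume "mixed A W S"
    then obtain C H where "C \<in> H" "H \<in> S" "C \<inter> A \<noteq> {}" "C \<inter> W \<noteq> {}"
      unfolding mixed_def by blast
    then have "H \<in> ?MA \<inter> ?MW" unfolding Int_iff in_lineages_meeting by blast
    then show "?MA \<inter> ?MW \<noteq> {}" by blast
  next
    assume "?MA \<inter> ?MW \<noteq> {}"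
    then obtain H where H: "H \<in> S" "\<Union>H \<inter> A \<noteq> {}" "\<Union>H \<inter> W \<noteq> {}"
      unfolding lineages_meeting_def by blast
    then show "mixed A W S" using not_mixed_top[OF S _ H(1)] by blast
  qed
  have cU: "card (?MA \<union> ?MW) + card (?MA \<inter> ?MW) = nlin A S + nlin W S"
    using card_Un_Int[OF f(1,2)] by simp
  show ?thesis
  proof (cases "mixed A W S")
    case True
    then have "0 < card (?MA \<inter> ?MW)" using mix f by (simp add: card_gt_0_iff)
    then show ?thesis using True cU le by (simp add: unmerged_def U c)
  next
    case False
    then have "card (?MA \<inter> ?MW) = 0" using mix by simp
    then show ?thesis using False cU le by (auto simp: unmerged_def U c)
  qed
qed

lemma out_expect_unmerged_split:
  assumes sp: "splits_at t Z l r s" and Z: "Z = Z1 \<union> Z2" "Z1 \<subseteq> sleaves l" "Z2 \<subseteq> sleaves r"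
    and E: "\<And>lam F. local_eigenfunction Z lam F \<Longrightarrow>
      out_expect t F = exp (- lam * s) * join_expect l r (\<lambda>S1 S2. F (S1 \<union> S2))"
  shows "out_expect t (unmerged Z) =
    exp (- s) ^ (card Z choose 2) * out_expect l (unmerged Z1) * out_expect r (unmerged Z2)"
proof -
  have d: "distinct (sleaf_list l)" "distinct (sleaf_list r)" "sleaves l \<inter> sleaves r = {}"
    using sp unfolding splits_at_def by simp_all
  have "finite Z" using Z finite_sleaves finite_subset by (metis finite_Un)
  then have "out_expect t (unmerged Z)
      = exp (- real (card Z choose 2) * s) * join_expect l r (\<lambda>S1 S2. unmerged Z (S1 \<union> S2))"
    using E unmerged_local by blast
  also have "join_expect l r (\<lambda>S1 S2. unmerged Z (S1 \<union> S2))
      = join_expect l r (\<lambda>S1 S2. unmerged Z1 S1 * unmerged Z2 S2)"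
    unfolding Z(1) by (intro join_expect_cong d(1,2) unmerged_Un[OF _ _ d(3) _ _ Z(2,3)]) auto
  finally show ?thesis
    by (simp add: join_expect_mult exp_of_nat_mult[symmetric] mult.assoc)
qed

lemma out_expect_unmerged_singleton:
  assumes "distinct (sleaf_list t)" "pos_below t" "a \<in> sleaves t"
  shows "out_expect t (unmerged {a}) = 1"
proof -
  have "out_expect t (unmerged {a}) = out_expect t (\<lambda>_. 1)"
    using nlin_singleton[OF _ finite_sleaves assms(3)]
    by (intro out_expect_cong assms(1)) (simp add: unmerged_def)
  then show ?thesis using out_expect_const[OF assms(1,2)] by simp
qed

lemma out_expect_unmerged_doubleton:
  assumes "distinct (sleaf_list t)" "pos_below t" "a \<in> sleaves t" "b \<in> sleaves t" "a \<noteq> b"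
  shows "out_expect t (unmerged {a, b}) = exp (- depth t a b)"
proof -
  obtain l r s where sp: "splits_at t {a, b} l r s" "a \<in> sleaves l"
    and E: "\<And>lam F. local_eigenfunction {a, b} lam F \<Longrightarrow>
      out_expect t F = exp (- lam * s) * join_expect l r (\<lambda>S1 S2. F (S1 \<union> S2))"
    using assms by (elim out_expect_splitE[of t "{a,b}" a]) auto
  have b: "b \<in> sleaves r" "b \<notin> sleaves l" using splits_at_nonempty[OF sp(1)] sp(2) by auto
  have "out_expect t (unmerged {a, b}) = exp (- s) ^ (card {a,b} choose 2) * out_expect l (unmerged {a}) * out_expect r (unmerged {b})"
    using sp b by (intro out_expect_unmerged_split[OF sp(1) _ _ _ E]) auto
  moreover have "depth t a b = s" using splits_at_side(2)[OF sp(1) _ _ assms(5) sp(2) b(2)] by simp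
  moreover have "out_expect l (unmerged {a}) = 1" "out_expect r (unmerged {b}) = 1"
    using sp b unfolding splits_at_def by (auto intro: out_expect_unmerged_singleton)
  ultimately show ?thesis using assms(5) by (simp add: numeral_2_eq_2)
qed

subsection \<open>Probabilities of splits of quartets and quintets\<close>

text \<open>The four weights below are the solutions of the recurrence in
  \<open>two_type_eigenfunction\<close> for the numbers of genes that occur.\<close>

definition w_both :: "nat \<Rightarrow> nat \<Rightarrow> real" where
  "w_both i j = (if i = 1 \<or> j = 1 then 1 else if i = 2 \<and> j = 2 then 1/3 else 1/5)"

definition w_first :: "nat \<Rightarrow> nat \<Rightarrow> real" where
  "w_first i j = (if i = 1 then 1 else if j = 1 then 1/3 else 2/9)"

definition w_second :: "nat \<Rightarrow> nat \<Rightarrow> real" where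
  "w_second i j = (if j = 1 then 1 else if j = 2 then 1/3 else 1/6)"

definition w_open :: "nat \<Rightarrow> nat \<Rightarrow> real" where
  "w_open i j = (if i = 1 then 1 else 1/2)"

abbreviation "tt_both \<equiv> two_type True True w_both"
abbreviation "tt_first \<equiv> two_type True False w_first"
abbreviation "tt_second \<equiv> two_type False True w_second"
abbreviation "tt_open \<equiv> two_type False False w_open"

lemma le_3_cases: "(n::nat) \<le> 3 \<Longrightarrow> n = 0 \<or> n = 1 \<or> n = 2 \<or> n = 3"
  by auto

lemma choose_2_values: "(0::nat) choose 2 = 0" "(1::nat) choose 2 = 0" "(2::nat) choose 2 = 1"
    "(3::nat) choose 2 = 3" "(4::nat) choose 2 = 6" "(5::nat) choose 2 = 10"
    "Suc 0 choose 2 = 0" "Suc (Suc 0) choose 2 = 1" "Suc (Suc (Suc 0)) choose 2 = 3"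
  by (simp_all add: choose_two)

lemma tt_both_local:
  assumes "card A = 2" "card W = 2 \<or> card W = 3" "A \<inter> W = {}"
  shows "local_eigenfunction (A \<union> W) 0 (tt_both A W)"
proof (rule two_type_local)
  show "finite A" "finite W" using assms by (auto intro: card_ge_0_finite)
  fix i j assume a: "i \<le> card A" "j \<le> card W" "i = 0 \<longleftrightarrow> A = {}" "j = 0 \<longleftrightarrow> W = {}"
    "\<not> (True \<and> i = 1)" "\<not> (True \<and> j = 1)"
  have "A \<noteq> {}" "W \<noteq> {}" using assms by auto
  then have "i = 2" "j = 2 \<or> j = 3" using assms a le_3_cases[of i] le_3_cases[of j] by auto
  then show "real (i choose 2) * w_both (i - 1) j + real (j choose 2) * w_both i (j - 1)
          = (real ((i + j) choose 2) - 0) * w_both i j"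
    by (auto simp: w_both_def choose_2_values)
qed (use assms in \<open>auto simp: w_both_def\<close>)

lemma tt_first_local:
  assumes "card A = 2" "card W = 1 \<or> card W = 2" "A \<inter> W = {}"
  shows "local_eigenfunction (A \<union> W) 0 (tt_first A W)"
proof (rule two_type_local)
  show "finite A" "finite W" using assms by (auto intro: card_ge_0_finite)
  fix i j assume a: "i \<le> card A" "j \<le> card W" "i = 0 \<longleftrightarrow> A = {}" "j = 0 \<longleftrightarrow> W = {}"
    "\<not> (True \<and> i = 1)" "\<not> (False \<and> j = 1)"
  have "A \<noteq> {}" "W \<noteq> {}" using assms by auto
  then have "i = 2" "j = 1 \<or> j = 2" using assms a le_3_cases[of i] le_3_cases[of j] by auto
  then show "real (i choose 2) * w_first (i - 1) j + real (j choose 2) * w_first i (j - 1)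
          = (real ((i + j) choose 2) - 0) * w_first i j"
    by (auto simp: w_first_def choose_2_values)
qed (use assms in \<open>auto simp: w_first_def\<close>)

lemma tt_second_local:
  assumes "card A = 1" "card W = 3" "A \<inter> W = {}"
  shows "local_eigenfunction (A \<union> W) 0 (tt_second A W)"
proof (rule two_type_local)
  show "finite A" "finite W" using assms by (auto intro: card_ge_0_finite)
  fix i j assume a: "i \<le> card A" "j \<le> card W" "i = 0 \<longleftrightarrow> A = {}" "j = 0 \<longleftrightarrow> W = {}"
    "\<not> (False \<and> i = 1)" "\<not> (True \<and> j = 1)"
  have "A \<noteq> {}" "W \<noteq> {}" using assms by auto
  then have "i = 1" "j = 2 \<or> j = 3" using assms a le_3_cases[of i] le_3_cases[of j] by auto
  then show "real (i choose 2) * w_second (i - 1) j + real (j choose 2) * w_second i (j - 1)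
          = (real ((i + j) choose 2) - 0) * w_second i j"
    by (auto simp: w_second_def choose_2_values)
qed (use assms in \<open>auto simp: w_second_def\<close>)

lemma tt_open_local:
  assumes "card A = 2" "card W = 1" "A \<inter> W = {}"
  shows "local_eigenfunction (A \<union> W) 1 (tt_open A W)"
proof (rule two_type_local)
  show "finite A" "finite W" using assms by (auto intro: card_ge_0_finite)
  fix i j assume a: "i \<le> card A" "j \<le> card W" "i = 0 \<longleftrightarrow> A = {}" "j = 0 \<longleftrightarrow> W = {}"
    "\<not> (False \<and> i = 1)" "\<not> (False \<and> j = 1)"
  have "A \<noteq> {}" "W \<noteq> {}" using assms by auto
  then have "j = 1" "i = 1 \<or> i = 2" using assms a le_3_cases[of i] le_3_cases[of j] by auto
  then show "real (i choose 2) * w_open (i - 1) j + real (j choose 2) * w_open i (j - 1)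
          = (real ((i + j) choose 2) - 1) * w_open i j"
    by (auto simp: w_open_def choose_2_values)
qed (use assms in auto)

locale joined =
  fixes L1 L2 :: "'a set" and S1 S2 :: "'a config"
  assumes S: "S1 \<in> valid_configs L1" "S2 \<in> valid_configs L2"
    and L: "L1 \<inter> L2 = {}" "finite L1" "finite L2"
begin

lemma nlin_one: "a \<in> L1 \<Longrightarrow> nlin {a} S1 = 1" "a \<in> L2 \<Longrightarrow> nlin {a} S2 = 1"
  using nlin_singleton S L by metis+

lemma nlin_cases:
  assumes "card A = 2" "A \<subseteq> L1"
  shows "nlin A S1 = 1 \<or> nlin A S1 = 2"
proof -
  have "A \<noteq> {}" "finite A" using assms by (auto intro: card_ge_0_finite)
  then have "nlin A S1 \<noteq> 0" "nlin A S1 \<le> 2"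
    using nlin_eq_0_iff[OF S(1) L(2) assms(2)] nlin_le_card[OF S(1), of A] assms(1) by auto
  then show ?thesis by linarith
qed

lemma nlin_cases3:
  assumes "card A = 3" "A \<subseteq> L1"
  shows "nlin A S1 = 1 \<or> nlin A S1 = 2 \<or> nlin A S1 = 3"
proof -
  have "A \<noteq> {}" "finite A" using assms by (auto intro: card_ge_0_finite)
  then have "nlin A S1 \<noteq> 0" "nlin A S1 \<le> 3"
    using nlin_eq_0_iff[OF S(1) L(2) assms(2)] nlin_le_card[OF S(1), of A] assms(1) by auto
  then show ?thesis by linarith
qed

lemma tt_both_peel_second:
  assumes "A \<subseteq> L1" "W \<subseteq> L1" "x \<in> L2" "A \<inter> W = {}" "card A = 2" "W \<noteq> {}"
  shows "tt_both A (insert x W) (S1 \<union> S2) =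
    (if separates A W S1 then 1 else if mixed A W S1 then 0 else w_both (nlin A S1) (nlin W S1 + 1))"
proof -
  have "A \<noteq> {}" using assms by auto
  then show ?thesis
    using two_type_Un[OF S L, of A W "{}" "{x}" A "insert x W" True True w_both] assms nlin_one(2)[of x]
    by simp
qed

lemma tt_both_peel_second1:
  assumes "a \<in> L1" "b \<in> L1" "c \<in> L1" "x \<in> L2" "a \<noteq> b" "a \<noteq> c" "b \<noteq> c"
  shows "tt_both {a, b} {c, x} (S1 \<union> S2) = tt_first {a, b} {c} S1"
  unfolding insert_commute[of c x] using tt_both_peel_second[of "{a, b}" "{c}" x] assms nlin_one(1)[of c] nlin_cases[of "{a,b}"]
  by (auto simp: two_type_def w_both_def w_first_def)

lemma tt_both_peel_second2:
  assumes "A \<subseteq> L1" "W \<subseteq> L1" "x \<in> L2" "A \<inter> W = {}" "card A = 2" "card W = 2"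
  shows "tt_both A (insert x W) (S1 \<union> S2) = tt_first A W S1 - 1/45 * unmerged (A \<union> W) S1"
proof -
  have W: "W \<noteq> {}" "A \<noteq> {}" using assms by auto
  show ?thesis
    unfolding tt_both_peel_second[OF assms(1-5) W(1)] unmerged_Un_same[OF S(1) L(2) Un_least[OF assms(1,2)] assms(4)]
    using nlin_cases[OF assms(5,1)] nlin_cases[OF assms(6,2)] assms(5,6) separates_nlin[OF S(1) W(2), of W]
    by (auto simp: two_type_def w_both_def w_first_def)
qed

lemma tt_both_peel_first:
  assumes "a \<in> L1" "W \<subseteq> L1" "x \<in> L2" "a \<notin> W" "card W = 3"
  shows "tt_both {a, x} W (S1 \<union> S2) = tt_second {a} W S1 + 1/30 * unmerged (insert a W) S1"
proof -
  have W: "W \<noteq> {}" using assms by auto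
  have "a \<noteq> x" using assms L by auto
  then have *: "tt_both {a, x} W (S1 \<union> S2) =
    (if separates W {a} S1 then 1 else if mixed {a} W S1 then 0 else w_both 2 (nlin W S1))"
    using two_type_Un[OF S L, of "{a}" W "{x}" "{}" "{a,x}" W True True w_both] assms W
      nlin_one(2)[of x] nlin_one(1)[of a] by (simp add: insert_commute numeral_2_eq_2)
  show ?thesis
    unfolding * using unmerged_Un_same[OF S(1) L(2), of "{a}" W] assms
      nlin_cases3[OF assms(5,2)] separates_nlin[OF S(1) W, of "{a}"] nlin_one(1)[of a]
    by (auto simp: two_type_def w_both_def w_second_def)
qed

lemma unmerged_triple:
  assumes "a \<in> L1" "b \<in> L1" "c \<in> L1" "a \<noteq> b" "a \<noteq> c" "b \<noteq> c"
  shows "unmerged {a, b, c} S1 = (if \<not> mixed {a, b} {c} S1 \<and> nlin {a, b} S1 = 2 then 1 else 0)"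
proof -
  have "{a, b} \<union> {c} = {a, b, c}" by auto
  then show ?thesis
    using unmerged_Un_same[OF S(1) L(2), of "{a,b}" "{c}"] assms nlin_one(1)[of c] by simp
qed

lemma tt_first_peel_second:
  assumes "a \<in> L1" "b \<in> L1" "c \<in> L1" "x \<in> L2" "a \<noteq> b" "a \<noteq> c" "b \<noteq> c"
  shows "tt_first {a, b} {c, x} (S1 \<union> S2) = tt_first {a, b} {c} S1 - 1/9 * unmerged {a, b, c} S1"
proof -
  have "c \<noteq> x" using assms L by auto
  have *: "tt_first {a, b} {c, x} (S1 \<union> S2) =
    (if separates {a, b} {c} S1 then 1 else if mixed {a, b} {c} S1 then 0 else w_first (nlin {a, b} S1) 2)"
    using two_type_Un[OF S L, of "{a,b}" "{c}" "{}" "{x}" "{a,b}" "{c,x}" True False w_first] assms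
      nlin_one(2)[of x] nlin_one(1)[of c] by (simp add: insert_commute numeral_2_eq_2)
  show ?thesis
    unfolding * using unmerged_triple[of a b c] assms
      nlin_cases[of "{a,b}"] separates_nlin[OF S(1), of "{a,b}" "{c}"] nlin_one(1)[of c]
    by (auto simp: two_type_def w_first_def)
qed

lemma tt_first_peel_first:
  assumes "a \<in> L1" "b \<in> L1" "c \<in> L1" "x \<in> L2" "a \<noteq> b" "a \<noteq> c" "b \<noteq> c"
  shows "tt_first {c, x} {a, b} (S1 \<union> S2) = 1/3 * tt_open {a, b} {c} S1 + 1/18 * unmerged {a, b, c} S1"
proof -
  have "c \<noteq> x" using assms L by auto
  have *: "tt_first {c, x} {a, b} (S1 \<union> S2) =
    (if mixed {c} {a, b} S1 then 0 else w_first 2 (nlin {a, b} S1))"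
    using two_type_Un[OF S L, of "{c}" "{a,b}" "{x}" "{}" "{c,x}" "{a,b}" True False w_first] assms
      nlin_one(2)[of x] nlin_one(1)[of c] by (simp add: insert_commute numeral_2_eq_2)
  show ?thesis
    unfolding * using unmerged_triple[of a b c] assms
      nlin_cases[of "{a,b}"] nlin_one(1)[of c] mixed_commute[of "{c}" "{a,b}" S1]
    by (auto simp: two_type_def w_first_def w_open_def)
qed

lemma tt_second_peel_second:
  assumes "a \<in> L1" "b \<in> L1" "c \<in> L1" "x \<in> L2" "a \<noteq> b" "a \<noteq> c" "b \<noteq> c"
  shows "tt_second {c} {a, b, x} (S1 \<union> S2) = 1/3 * tt_open {a, b} {c} S1"
proof -
  have "c \<noteq> x" using assms L by auto
  have *: "tt_second {c} {a, b, x} (S1 \<union> S2) =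
    (if mixed {c} {a, b} S1 then 0 else w_second 1 (nlin {a, b} S1 + 1))"
    using two_type_Un[OF S L, of "{c}" "{a,b}" "{}" "{x}" "{c}" "{a,b,x}" False True w_second] assms
      nlin_one(2)[of x] nlin_one(1)[of c] by (simp add: insert_commute numeral_2_eq_2)
  show ?thesis
    unfolding * using assms
      nlin_cases[of "{a,b}"] nlin_one(1)[of c] mixed_commute[of "{c}" "{a,b}" S1]
    by (auto simp: two_type_def w_second_def w_open_def)
qed

lemma unmerged_cases:
  "a \<in> L1 \<Longrightarrow> b \<in> L1 \<Longrightarrow> a \<noteq> b \<Longrightarrow>
    unmerged {a, b} S1 = 1 \<and> nlin {a, b} S1 = 2 \<and> \<not> mixed {a} {b} S1 \<or>
    unmerged {a, b} S1 = 0 \<and> nlin {a, b} S1 = 1 \<and> mixed {a} {b} S1"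
  "a \<in> L2 \<Longrightarrow> b \<in> L2 \<Longrightarrow> a \<noteq> b \<Longrightarrow>
    unmerged {a, b} S2 = 1 \<and> nlin {a, b} S2 = 2 \<and> \<not> mixed {a} {b} S2 \<or>
    unmerged {a, b} S2 = 0 \<and> nlin {a, b} S2 = 1 \<and> mixed {a} {b} S2"
  using nlin_doubleton[OF S(1) L(2), of a b] nlin_doubleton[OF S(2) L(3), of a b] by (auto split: if_splits)

lemma tt_first_cherry:
  assumes "a \<in> L1" "b \<in> L1" "c \<in> L2" "a \<noteq> b"
  shows "tt_first {a, b} {c} (S1 \<union> S2) = 1 + - (2/3) * unmerged {a, b} S1"
proof -
  have *: "tt_first {a, b} {c} (S1 \<union> S2) =
    (if separates {a, b} {} S1 then 1 else w_first (nlin {a, b} S1) 1)"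
    using two_type_Un[OF S L, of "{a,b}" "{}" "{}" "{c}" "{a,b}" "{c}" True False w_first] assms
      nlin_one(2)[of c] by simp
  show ?thesis
    unfolding * using unmerged_cases(1)[OF assms(1,2,4)] separates_nlin[OF S(1), of "{a,b}" "{}"]
    by (auto simp: w_first_def)
qed

lemma tt_first_cross:
  assumes "a \<in> L1" "b \<in> L1" "c \<in> L2" "a \<noteq> b"
  shows "tt_first {a, c} {b} (S1 \<union> S2) = 1/3 * unmerged {a, b} S1"
proof -
  have *: "tt_first {a, c} {b} (S1 \<union> S2) =
    (if mixed {a} {b} S1 then 0 else w_first 2 1)"
    using two_type_Un[OF S L, of "{a}" "{b}" "{c}" "{}" "{a,c}" "{b}" True False w_first] assms
      nlin_one(2)[of c] nlin_one(1)[of a] nlin_one(1)[of b] by (simp add: insert_commute numeral_2_eq_2)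
  show ?thesis
    unfolding * using unmerged_cases(1)[OF assms(1,2,4)] by (auto simp: w_first_def)
qed

lemma tt_open_cherry:
  assumes "a \<in> L1" "b \<in> L1" "c \<in> L2" "a \<noteq> b"
  shows "tt_open {a, b} {c} (S1 \<union> S2) = 1 + - (1/2) * unmerged {a, b} S1"
proof -
  have *: "tt_open {a, b} {c} (S1 \<union> S2) = w_open (nlin {a, b} S1) 1"
    using two_type_Un[OF S L, of "{a,b}" "{}" "{}" "{c}" "{a,b}" "{c}" False False w_open] assms
      nlin_one(2)[of c] by simp
  show ?thesis
    unfolding * using unmerged_cases(1)[OF assms(1,2,4)] by (auto simp: w_open_def)
qed

lemma tt_second_cherries:
  assumes "a \<in> L1" "b \<in> L1" "d \<in> L2" "e \<in> L2" "a \<noteq> b" "d \<noteq> e"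
  shows "tt_second {a} {b, d, e} (S1 \<union> S2)
    = 1/3 * unmerged {a, b} S1 + - (1/6) * (unmerged {a, b} S1 * unmerged {d, e} S2)"
proof -
  have *: "tt_second {a} {b, d, e} (S1 \<union> S2) =
    (if mixed {a} {b} S1 then 0 else w_second 1 (1 + nlin {d, e} S2))"
    using two_type_Un[OF S L, of "{a}" "{b}" "{}" "{d,e}" "{a}" "{b,d,e}" False True w_second] assms
      nlin_one(1)[of a] nlin_one(1)[of b] by (simp add: insert_commute)
  show ?thesis
    unfolding * using unmerged_cases(1)[OF assms(1,2,5)] unmerged_cases(2)[OF assms(3,4,6)]
    by (auto simp: w_second_def)
qed

lemma tt_both_balanced_first:
  assumes "a \<in> L1" "b \<in> L1" "c \<in> L1" "d \<in> L2" "e \<in> L2" "a \<noteq> b" "a \<noteq> c" "b \<noteq> c" "d \<noteq> e"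
  shows "tt_both {a, c} {b, d, e} (S1 \<union> S2) =
    tt_first {a, c} {b} S1 + - (2/15) * (unmerged {a, b, c} S1 * unmerged {d, e} S2)"
proof -
  have *: "tt_both {a, c} {b, d, e} (S1 \<union> S2) =
    (if separates {a, c} {b} S1 then 1 else if mixed {a, c} {b} S1 then 0
     else w_both (nlin {a, c} S1) (1 + nlin {d, e} S2))"
    using two_type_Un[OF S L, of "{a,c}" "{b}" "{}" "{d,e}" "{a,c}" "{b,d,e}" True True w_both] assms
      nlin_one(1)[of b] by (simp add: insert_commute)
  have "unmerged {a, b, c} S1 =
      (if \<not> mixed {a, c} {b} S1 \<and> nlin {a, c} S1 = 2 then 1 else 0)"
    using unmerged_triple[of a c b] assms by (simp add: insert_commute)
  then show ?thesis
    unfolding * using assms nlin_cases[of "{a,c}"] nlin_one(1)[of b] unmerged_cases(2)[of d e]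
      separates_nlin[OF S(1), of "{a,c}" "{b}"]
    by (auto simp: two_type_def w_both_def w_first_def)
qed

lemma tt_both_balanced_second:
  assumes "a \<in> L1" "b \<in> L1" "c \<in> L1" "d \<in> L2" "e \<in> L2" "a \<noteq> b" "a \<noteq> c" "b \<noteq> c" "d \<noteq> e"
  shows "tt_both {c, d} {a, b, e} (S1 \<union> S2) =
    1/3 * (tt_open {a, b} {c} S1 * unmerged {d, e} S2) + 1/30 * (unmerged {a, b, c} S1 * unmerged {d, e} S2)"
proof -
  have *: "tt_both {c, d} {a, b, e} (S1 \<union> S2) =
    (if mixed {c} {a, b} S1 \<or> mixed {d} {e} S2 then 0 else w_both 2 (nlin {a, b} S1 + 1))"
    using two_type_Un[OF S L, of "{c}" "{a,b}" "{d}" "{e}" "{c,d}" "{a,b,e}" True True w_both] assms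
      nlin_one(1)[of c] nlin_one(2)[of d] nlin_one(2)[of e] by (simp add: insert_commute numeral_2_eq_2)
  show ?thesis
    unfolding * using unmerged_triple[of a b c] assms
      nlin_cases[of "{a,b}"] nlin_one(1)[of c] unmerged_cases(2)[of d e] mixed_commute[of "{c}" "{a,b}" S1]
    by (auto simp: two_type_def w_both_def w_open_def)
qed

lemma tt_both_cherries:
  assumes "a \<in> L1" "b \<in> L1" "c \<in> L2" "d \<in> L2" "a \<noteq> b" "c \<noteq> d"
  shows "tt_both {a, b} {c, d} (S1 \<union> S2) = 1 + - (2/3) * (unmerged {a, b} S1 * unmerged {c, d} S2)"
    and "tt_both {a, c} {b, d} (S1 \<union> S2) = 1/3 * (unmerged {a, b} S1 * unmerged {c, d} S2)"
proof -
  have *: "tt_both {a, b} {c, d} (S1 \<union> S2) =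
    (if separates {a, b} {} S1 \<or> separates {c, d} {} S2 then 1 else w_both (nlin {a, b} S1) (nlin {c, d} S2))"
    using two_type_Un[OF S L, of "{a,b}" "{}" "{}" "{c,d}" "{a,b}" "{c,d}" True True w_both] assms by simp
  show "tt_both {a, b} {c, d} (S1 \<union> S2) = 1 + - (2/3) * (unmerged {a, b} S1 * unmerged {c, d} S2)"
    unfolding * using unmerged_cases(1)[OF assms(1,2,5)] unmerged_cases(2)[OF assms(3,4,6)]
      separates_nlin[OF S(1), of "{a,b}" "{}"] separates_nlin[OF S(2), of "{c,d}" "{}"]
    by (auto simp: w_both_def)
  have **: "tt_both {a, c} {b, d} (S1 \<union> S2) =
    (if mixed {a} {b} S1 \<or> mixed {c} {d} S2 then 0 else w_both 2 2)"
    using two_type_Un[OF S L, of "{a}" "{b}" "{c}" "{d}" "{a,c}" "{b,d}" True True w_both] assms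
      nlin_one(1)[of a] nlin_one(1)[of b] nlin_one(2)[of c] nlin_one(2)[of d]
    by (simp add: insert_commute numeral_2_eq_2)
  show "tt_both {a, c} {b, d} (S1 \<union> S2) = 1/3 * (unmerged {a, b} S1 * unmerged {c, d} S2)"
    unfolding ** using unmerged_cases(1)[OF assms(1,2,5)] unmerged_cases(2)[OF assms(3,4,6)]
    by (auto simp: w_both_def)
qed

end

abbreviation display_prob :: "'a stree \<Rightarrow> 'a set \<Rightarrow> 'a set \<Rightarrow> real" where
  "display_prob t A W \<equiv> root_expect t (tt_both A W)"

lemma join_eval:
  assumes "splits_at t Z l r s"
    and "\<And>S1 S2. joined (sleaves l) (sleaves r) S1 S2 \<Longrightarrow> F (S1 \<union> S2) = G S1 S2"
  shows "join_expect l r (\<lambda>S1 S2. F (S1 \<union> S2)) = join_expect l r G"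
proof (rule join_expect_cong)
  fix S1 S2 assume "S1 \<in> valid_configs (sleaves l)" "S2 \<in> valid_configs (sleaves r)"
  then have "joined (sleaves l) (sleaves r) S1 S2"
    using assms(1) by unfold_locales (auto simp: splits_at_def)
  then show "F (S1 \<union> S2) = G S1 S2" by (rule assms(2))
qed (use assms(1) in \<open>auto simp: splits_at_def\<close>)

lemma splits_at_props:
  assumes "splits_at t Z l r s"
  shows "distinct (sleaf_list l)" "pos_below l" "distinct (sleaf_list r)" "pos_below r"
  using assms unfolding splits_at_def by auto

lemma out_triple:
  assumes t: "distinct (sleaf_list t)" "pos_below t"
    and abc: "a \<in> sleaves t" "b \<in> sleaves t" "c \<in> sleaves t" "a \<noteq> b" "a \<noteq> c" "b \<noteq> c"
    and D: "depth t a c < depth t a b"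
    and X: "X = exp (- (depth t a b - depth t a c))" and Y: "Y = exp (- depth t a c)"
  shows "out_expect t (unmerged {a, b, c}) = X * Y ^ 3"
    and "out_expect t (tt_first {a, b} {c}) = 1 - 2/3 * X"
    and "out_expect t (tt_first {a, c} {b}) = X / 3"
    and "out_expect t (tt_open {a, b} {c}) = Y * (1 - X / 2)"
proof -
  let ?Z = "{a, b, c}"
  obtain l r s where sp: "splits_at t ?Z l r s" and a: "a \<in> sleaves l"
    and E: "\<And>lam F. local_eigenfunction ?Z lam F \<Longrightarrow>
      out_expect t F = exp (- lam * s) * join_expect l r (\<lambda>S1 S2. F (S1 \<union> S2))"
    using t abc by (elim out_expect_splitE[of t ?Z a]) auto
  have m: "\<forall>y\<in>?Z - {a}. depth t a c \<le> depth t a y" "\<exists>y\<in>?Z - {a}. depth t a y = depth t a c"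
    using D abc by auto
  note sd = splits_at_depth[OF sp _ a m]
  have s: "s = depth t a c" and b: "b \<in> sleaves l" and c: "c \<in> sleaves r"
    using sd(1) sd(3)[of b] sd(2)[of c] D abc by auto
  have dl: "depth l a b = depth t a b - s" using sd(3)[of b] D abc s by auto
  note lr = splits_at_props[OF sp]
  have Eab: "out_expect l (unmerged {a, b}) = X"
    using out_expect_unmerged_doubleton[OF lr(1,2) a b abc(4)] dl s X by simp
  have c3: "card ?Z = 3" using abc by simp
  have "out_expect t (unmerged ?Z) =
      exp (- s) ^ (card ?Z choose 2) * out_expect l (unmerged {a, b}) * out_expect r (unmerged {c})"
    using a b c by (intro out_expect_unmerged_split[OF sp _ _ _ E]) auto
  then show "out_expect t (unmerged ?Z) = X * Y ^ 3"
    using out_expect_unmerged_singleton[OF lr(3,4) c] Eab s Y c3 by (simp add: choose_2_values)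
  have Z: "{a, b} \<union> {c} = ?Z" "{a, c} \<union> {b} = ?Z" by auto
  have "local_eigenfunction ?Z 0 (tt_first {a, b} {c})"
    using tt_first_local[of "{a,b}" "{c}"] abc unfolding Z by simp
  from E[OF this] have "out_expect t (tt_first {a, b} {c})
      = join_expect l r (\<lambda>S1 S2. tt_first {a, b} {c} (S1 \<union> S2))" by simp
  also have "\<dots> = join_expect l r (\<lambda>S1 S2. 1 + - (2/3) * unmerged {a, b} S1)"
    using a b c abc by (intro join_eval[OF sp]) (rule joined.tt_first_cherry)
  also have "\<dots> = 1 + - (2/3) * X"
    unfolding join_expect_left[OF lr(3,4)] out_expect_add out_expect_cmult out_expect_const[OF lr(1,2)] Eab ..
  finally show "out_expect t (tt_first {a, b} {c}) = 1 - 2/3 * X" by simp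
  have "local_eigenfunction ?Z 0 (tt_first {a, c} {b})"
    using tt_first_local[of "{a,c}" "{b}"] abc unfolding Z by simp
  from E[OF this] have "out_expect t (tt_first {a, c} {b})
      = join_expect l r (\<lambda>S1 S2. tt_first {a, c} {b} (S1 \<union> S2))" by simp
  also have "\<dots> = join_expect l r (\<lambda>S1 S2. 1/3 * unmerged {a, b} S1)"
    using a b c abc by (intro join_eval[OF sp]) (rule joined.tt_first_cross)
  also have "\<dots> = 1/3 * X"
    unfolding join_expect_left[OF lr(3,4)] out_expect_cmult Eab ..
  finally show "out_expect t (tt_first {a, c} {b}) = X / 3" by simp
  have "local_eigenfunction ?Z 1 (tt_open {a, b} {c})"
    using tt_open_local[of "{a,b}" "{c}"] abc unfolding Z by simp
  from E[OF this] have "out_expect t (tt_open {a, b} {c})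
      = Y * join_expect l r (\<lambda>S1 S2. tt_open {a, b} {c} (S1 \<union> S2))" using s Y by simp
  also have "join_expect l r (\<lambda>S1 S2. tt_open {a, b} {c} (S1 \<union> S2))
      = join_expect l r (\<lambda>S1 S2. 1 + - (1/2) * unmerged {a, b} S1)"
    using a b c abc by (intro join_eval[OF sp]) (rule joined.tt_open_cherry)
  also have "\<dots> = 1 + - (1/2) * X"
    unfolding join_expect_left[OF lr(3,4)] out_expect_add out_expect_cmult out_expect_const[OF lr(1,2)] Eab ..
  finally show "out_expect t (tt_open {a, b} {c}) = Y * (1 - X / 2)" by simp
qed

lemma out_balanced4:
  assumes t: "distinct (sleaf_list t)" "pos_below t"
    and mem: "a \<in> sleaves t" "b \<in> sleaves t" "d \<in> sleaves t" "e \<in> sleaves t"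
    and ne: "distinct [a, b, d, e]"
    and D: "depth t a d = m" "depth t a e = m" "m < depth t a b"
    and X: "X = exp (- (depth t a b - m))" and U: "U = exp (- (depth t d e - m))"
    and Z: "Z = exp (- m)"
  shows "out_expect t (unmerged {a, b, d, e}) = X * U * Z ^ 6"
    and "out_expect t (tt_second {a} {b, d, e}) = X * (1/3 - U / 6)"
proof -
  let ?Z = "{a, b, d, e}"
  obtain l r s where sp: "splits_at t ?Z l r s" and a: "a \<in> sleaves l"
    and E: "\<And>lam F. local_eigenfunction ?Z lam F \<Longrightarrow>
      out_expect t F = exp (- lam * s) * join_expect l r (\<lambda>S1 S2. F (S1 \<union> S2))"
    using t mem ne by (elim out_expect_splitE[of t ?Z a]) auto
  have m: "\<forall>y\<in>?Z - {a}. m \<le> depth t a y" "\<exists>y\<in>?Z - {a}. depth t a y = m"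
    using D ne by auto
  note sd = splits_at_depth[OF sp _ a m]
  have s: "s = m" and b: "b \<in> sleaves l" and d: "d \<in> sleaves r" and e: "e \<in> sleaves r"
    using sd(1) sd(3)[of b] sd(2)[of d] sd(2)[of e] D ne by auto
  have dl: "depth l a b = depth t a b - m" "depth r d e = depth t d e - m"
    using sd(3)[of b] splits_at_right[OF sp, of d e] s d e D ne by auto
  note lr = splits_at_props[OF sp]
  have Eab: "out_expect l (unmerged {a, b}) = X"
    using out_expect_unmerged_doubleton[OF lr(1,2) a b] dl X ne by simp
  have Ede: "out_expect r (unmerged {d, e}) = U"
    using out_expect_unmerged_doubleton[OF lr(3,4) d e] dl U ne by simp
  have c4: "card ?Z = 4" using ne by simp
  have "out_expect t (unmerged ?Z) =
      exp (- s) ^ (card ?Z choose 2) * out_expect l (unmerged {a, b}) * out_expect r (unmerged {d, e})"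
    using a b d e by (intro out_expect_unmerged_split[OF sp _ _ _ E]) auto
  then show "out_expect t (unmerged ?Z) = X * U * Z ^ 6"
    using Eab Ede s Z c4 by (simp add: choose_2_values)
  have Zs: "{a} \<union> {b, d, e} = ?Z" by auto
  have "local_eigenfunction ?Z 0 (tt_second {a} {b, d, e})"
    using tt_second_local[of "{a}" "{b, d, e}"] ne unfolding Zs by auto
  from E[OF this] have "out_expect t (tt_second {a} {b, d, e})
      = join_expect l r (\<lambda>S1 S2. tt_second {a} {b, d, e} (S1 \<union> S2))" by simp
  also have "\<dots> = join_expect l r (\<lambda>S1 S2. 1/3 * unmerged {a, b} S1
      + - (1/6) * (unmerged {a, b} S1 * unmerged {d, e} S2))"
    using a b d e ne by (intro join_eval[OF sp]) (rule joined.tt_second_cherries, auto)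
  also have "\<dots> = 1/3 * X + - (1/6) * (X * U)"
    unfolding join_expect_add join_expect_cmult join_expect_left[OF lr(3,4)] join_expect_mult Eab Ede ..
  finally show "out_expect t (tt_second {a} {b, d, e}) = X * (1/3 - U / 6)" by (simp add: algebra_simps)
qed

lemma out_caterpillar4:
  assumes t: "distinct (sleaf_list t)" "pos_below t"
    and mem: "a \<in> sleaves t" "b \<in> sleaves t" "c \<in> sleaves t" "d \<in> sleaves t"
    and ne: "distinct [a, b, c, d]"
    and D: "depth t a d < depth t a c" "depth t a c < depth t a b"
    and X: "X = exp (- (depth t a b - depth t a c))" and Y: "Y = exp (- (depth t a c - depth t a d))"
    and Z: "Z = exp (- depth t a d)"
  shows "out_expect t (unmerged {a, b, c, d}) = X * Y ^ 3 * Z ^ 6"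
    and "out_expect t (tt_first {a, c} {b, d}) = X / 3 - X * Y ^ 3 / 9"
    and "out_expect t (tt_first {c, d} {a, b}) = Y * (1 - X / 2) / 3 + X * Y ^ 3 / 18"
    and "out_expect t (tt_second {c} {a, b, d}) = Y * (1 - X / 2) / 3"
proof -
  let ?Z = "{a, b, c, d}"
  obtain l r s where sp: "splits_at t ?Z l r s" and a: "a \<in> sleaves l"
    and E: "\<And>lam F. local_eigenfunction ?Z lam F \<Longrightarrow>
      out_expect t F = exp (- lam * s) * join_expect l r (\<lambda>S1 S2. F (S1 \<union> S2))"
    using t mem ne by (elim out_expect_splitE[of t ?Z a]) auto
  have m: "\<forall>y\<in>?Z - {a}. depth t a d \<le> depth t a y" "\<exists>y\<in>?Z - {a}. depth t a y = depth t a d"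
    using D ne by auto
  note sd = splits_at_depth[OF sp _ a m]
  have s: "s = depth t a d" and b: "b \<in> sleaves l" and c: "c \<in> sleaves l" and d: "d \<in> sleaves r"
    using sd(1) sd(3)[of b] sd(3)[of c] sd(2)[of d] D ne by auto
  have dl: "depth l a b = depth t a b - depth t a d" "depth l a c = depth t a c - depth t a d"
    using sd(3)[of b] sd(3)[of c] D ne by auto
  note lr = splits_at_props[OF sp]
  have T: "depth l a c < depth l a b" "X = exp (- (depth l a b - depth l a c))" "Y = exp (- depth l a c)"
    using D X Y dl by auto
  have ne': "a \<noteq> b" "a \<noteq> c" "b \<noteq> c" using ne by auto
  note E3 = out_triple[OF lr(1,2) a b c ne' T]
  have c4: "card ?Z = 4" using ne by simp
  have "out_expect t (unmerged ?Z) =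
      exp (- s) ^ (card ?Z choose 2) * out_expect l (unmerged {a, b, c}) * out_expect r (unmerged {d})"
    using a b c d by (intro out_expect_unmerged_split[OF sp _ _ _ E]) auto
  then show "out_expect t (unmerged ?Z) = X * Y ^ 3 * Z ^ 6"
    using E3(1) out_expect_unmerged_singleton[OF lr(3,4) d] s Z c4 by (simp add: choose_2_values)
  have Zs: "{a, c} \<union> {b, d} = ?Z" "{c, d} \<union> {a, b} = ?Z" "{c} \<union> {a, b, d} = ?Z" by auto
  have "local_eigenfunction ?Z 0 (tt_first {a, c} {b, d})"
    using tt_first_local[of "{a,c}" "{b,d}"] ne unfolding Zs by auto
  from E[OF this] have "out_expect t (tt_first {a, c} {b, d})
      = join_expect l r (\<lambda>S1 S2. tt_first {a, c} {b, d} (S1 \<union> S2))" by simp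
  also have "\<dots> = join_expect l r (\<lambda>S1 S2. tt_first {a, c} {b} S1 + - (1/9) * unmerged {a, b, c} S1)"
  proof (rule join_eval[OF sp])
    fix S1 S2 assume J: "joined (sleaves l) (sleaves r) S1 S2"
    show "tt_first {a, c} {b, d} (S1 \<union> S2) = tt_first {a, c} {b} S1 + - (1/9) * unmerged {a, b, c} S1"
      using joined.tt_first_peel_second[OF J a c b d] ne by (auto simp: insert_commute)
  qed
  also have "\<dots> = X / 3 + - (1/9) * (X * Y ^ 3)"
    unfolding join_expect_left[OF lr(3,4)] out_expect_add out_expect_cmult E3 ..
  finally show "out_expect t (tt_first {a, c} {b, d}) = X / 3 - X * Y ^ 3 / 9" by simp
  have "local_eigenfunction ?Z 0 (tt_first {c, d} {a, b})"
    using tt_first_local[of "{c,d}" "{a,b}"] ne unfolding Zs by auto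
  from E[OF this] have "out_expect t (tt_first {c, d} {a, b})
      = join_expect l r (\<lambda>S1 S2. tt_first {c, d} {a, b} (S1 \<union> S2))" by simp
  also have "\<dots> = join_expect l r (\<lambda>S1 S2. 1/3 * tt_open {a, b} {c} S1 + 1/18 * unmerged {a, b, c} S1)"
    using a b c d ne' by (intro join_eval[OF sp]) (rule joined.tt_first_peel_first)
  also have "\<dots> = 1/3 * (Y * (1 - X / 2)) + 1/18 * (X * Y ^ 3)"
    unfolding join_expect_left[OF lr(3,4)] out_expect_add out_expect_cmult E3 ..
  finally show "out_expect t (tt_first {c, d} {a, b}) = Y * (1 - X / 2) / 3 + X * Y ^ 3 / 18" by simp
  have "local_eigenfunction ?Z 0 (tt_second {c} {a, b, d})"
    using tt_second_local[of "{c}" "{a,b,d}"] ne unfolding Zs by auto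
  from E[OF this] have "out_expect t (tt_second {c} {a, b, d})
      = join_expect l r (\<lambda>S1 S2. tt_second {c} {a, b, d} (S1 \<union> S2))" by simp
  also have "\<dots> = join_expect l r (\<lambda>S1 S2. 1/3 * tt_open {a, b} {c} S1)"
    using a b c d ne' by (intro join_eval[OF sp]) (rule joined.tt_second_peel_second)
  also have "\<dots> = 1/3 * (Y * (1 - X / 2))"
    unfolding join_expect_left[OF lr(3,4)] out_expect_add out_expect_cmult E3 ..
  finally show "out_expect t (tt_second {c} {a, b, d}) = Y * (1 - X / 2) / 3" by simp
qed

locale rooted_tree =
  fixes t :: "'a stree"
  assumes t: "distinct (sleaf_list t)" "pos_internal t"
begin

abbreviation "D \<equiv> depth t"

lemma quartet_caterpillar:
  assumes mem: "{a, b, c, d} \<subseteq> sleaves t" and ne: "distinct [a, b, c, d]"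
    and D: "D a d < D a c" "D a c < D a b"
    and X: "X = exp (- (D a b - D a c))"
  shows "display_prob t {a, b} {c, d} = 1 - 2/3 * X"
    and "display_prob t {a, c} {b, d} = X / 3"
proof -
  let ?Z = "{a, b, c, d}"
  obtain l r s where sp: "splits_at t ?Z l r s" and a: "a \<in> sleaves l"
    and E: "\<And>F. local_eigenfunction ?Z 0 F \<Longrightarrow>
      root_expect t F = join_expect l r (\<lambda>S1 S2. F (S1 \<union> S2))"
    using t mem ne by (elim root_expect_splitE[of t ?Z a]) auto
  have m: "\<forall>y\<in>?Z - {a}. D a d \<le> D a y" "\<exists>y\<in>?Z - {a}. D a y = D a d"
    using D ne by auto
  note sd = splits_at_depth[OF sp _ a m]
  have s: "s = D a d" and b: "b \<in> sleaves l" and c: "c \<in> sleaves l" and d: "d \<in> sleaves r"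
    using sd(1) sd(3)[of b] sd(3)[of c] sd(2)[of d] D ne by auto
  have dl: "depth l a b = D a b - D a d" "depth l a c = D a c - D a d"
    using sd(3)[of b] sd(3)[of c] D ne by auto
  note lr = splits_at_props[OF sp]
  have T: "depth l a c < depth l a b" "X = exp (- (depth l a b - depth l a c))"
    using D X dl by auto
  have ne': "a \<noteq> b" "a \<noteq> c" "b \<noteq> c" using ne by auto
  note E3 = out_triple[OF lr(1,2) a b c ne' T refl]
  have Zs: "{a, b} \<union> {c, d} = ?Z" "{a, c} \<union> {b, d} = ?Z" by auto
  have "local_eigenfunction ?Z 0 (tt_both {a, b} {c, d})" "local_eigenfunction ?Z 0 (tt_both {a, c} {b, d})"
    using tt_both_local[of "{a,b}" "{c,d}"] tt_both_local[of "{a,c}" "{b,d}"] ne unfolding Zs by auto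
  note E' = this[THEN E]
  have "join_expect l r (\<lambda>S1 S2. tt_both {a, b} {c, d} (S1 \<union> S2)) = join_expect l r (\<lambda>S1 S2. tt_first {a, b} {c} S1)"
    using a b c d ne' by (intro join_eval[OF sp]) (rule joined.tt_both_peel_second1)
  then show "display_prob t {a, b} {c, d} = 1 - 2/3 * X"
    unfolding E' join_expect_left[OF lr(3,4)] E3 .
  have "join_expect l r (\<lambda>S1 S2. tt_both {a, c} {b, d} (S1 \<union> S2)) = join_expect l r (\<lambda>S1 S2. tt_first {a, c} {b} S1)"
    using a b c d ne' by (intro join_eval[OF sp]) (rule joined.tt_both_peel_second1, auto)
  then show "display_prob t {a, c} {b, d} = X / 3"
    unfolding E' join_expect_left[OF lr(3,4)] E3 .
qed

lemma quartet_balanced: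
  assumes mem: "{a, b, c, d} \<subseteq> sleaves t" and ne: "distinct [a, b, c, d]"
    and D: "D a c = m" "D a d = m" "m < D a b"
    and X: "X = exp (- (D a b + D c d - 2 * m))"
  shows "display_prob t {a, b} {c, d} = 1 - 2/3 * X"
    and "display_prob t {a, c} {b, d} = X / 3"
proof -
  let ?Z = "{a, b, c, d}"
  obtain l r s where sp: "splits_at t ?Z l r s" and a: "a \<in> sleaves l"
    and E: "\<And>F. local_eigenfunction ?Z 0 F \<Longrightarrow>
      root_expect t F = join_expect l r (\<lambda>S1 S2. F (S1 \<union> S2))"
    using t mem ne by (elim root_expect_splitE[of t ?Z a]) auto
  have m: "\<forall>y\<in>?Z - {a}. m \<le> D a y" "\<exists>y\<in>?Z - {a}. D a y = m"
    using D ne by auto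
  note sd = splits_at_depth[OF sp _ a m]
  have s: "s = m" and b: "b \<in> sleaves l" and c: "c \<in> sleaves r" and d: "d \<in> sleaves r"
    using sd(1) sd(3)[of b] sd(2)[of c] sd(2)[of d] D ne by auto
  have dl: "depth l a b = D a b - m" "depth r c d = D c d - m"
    using sd(3)[of b] splits_at_right[OF sp, of c d] s c d D ne by auto
  note lr = splits_at_props[OF sp]
  have EX: "out_expect l (unmerged {a, b}) * out_expect r (unmerged {c, d}) = X"
    using out_expect_unmerged_doubleton[OF lr(1,2) a b] out_expect_unmerged_doubleton[OF lr(3,4) c d] dl X ne
    by (simp add: mult_exp_exp)
  have ne': "a \<noteq> b" "c \<noteq> d" using ne by auto
  have Zs: "{a, b} \<union> {c, d} = ?Z" "{a, c} \<union> {b, d} = ?Z" by auto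
  have "local_eigenfunction ?Z 0 (tt_both {a, b} {c, d})" "local_eigenfunction ?Z 0 (tt_both {a, c} {b, d})"
    using tt_both_local[of "{a,b}" "{c,d}"] tt_both_local[of "{a,c}" "{b,d}"] ne unfolding Zs by auto
  note E' = this[THEN E]
  have one: "join_expect l r (\<lambda>S1 S2. 1) = 1"
    using join_expect_left[OF lr(3,4), of l "\<lambda>_. 1"] out_expect_const[OF lr(1,2), of 1] by simp
  have "join_expect l r (\<lambda>S1 S2. tt_both {a, b} {c, d} (S1 \<union> S2))
      = join_expect l r (\<lambda>S1 S2. 1 + - (2/3) * (unmerged {a, b} S1 * unmerged {c, d} S2))"
    using a b c d ne' by (intro join_eval[OF sp]) (rule joined.tt_both_cherries)
  then have "display_prob t {a, b} {c, d} = 1 + - (2/3) * X"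
    unfolding E' join_expect_add join_expect_cmult join_expect_mult EX one .
  then show "display_prob t {a, b} {c, d} = 1 - 2/3 * X" by simp
  have "join_expect l r (\<lambda>S1 S2. tt_both {a, c} {b, d} (S1 \<union> S2))
      = join_expect l r (\<lambda>S1 S2. 1/3 * (unmerged {a, b} S1 * unmerged {c, d} S2))"
    using a b c d ne' by (intro join_eval[OF sp]) (rule joined.tt_both_cherries)
  then have "display_prob t {a, c} {b, d} = 1/3 * X"
    unfolding E' join_expect_add join_expect_cmult join_expect_mult EX one .
  then show "display_prob t {a, c} {b, d} = X / 3" by simp
qed

lemma quintet_pseudocaterpillar:
  assumes mem: "{a, b, c, d, e} \<subseteq> sleaves t" and ne: "distinct [a, b, c, d, e]"
    and D: "D a c = s0" "D a d = s0 + z" "D a e = s0 + z" "D a b = s0 + z + x" "D d e = s0 + z + u" "0 < x" "0 < z"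
    and X: "X = exp (- x)" "U = exp (- u)" "Z = exp (- z)"
  shows "display_prob t {a, c} {b, d, e} = X * (1/3 - U / 6) + X * U * Z ^ 6 / 30"
proof -
  let ?Z = "{a, b, c, d, e}"
  obtain l r s where sp: "splits_at t ?Z l r s" and a: "a \<in> sleaves l"
    and E: "\<And>F. local_eigenfunction ?Z 0 F \<Longrightarrow>
      root_expect t F = join_expect l r (\<lambda>S1 S2. F (S1 \<union> S2))"
    using t mem ne by (elim root_expect_splitE[of t ?Z a]) auto
  have m: "\<forall>y\<in>?Z - {a}. s0 \<le> D a y" "\<exists>y\<in>?Z - {a}. D a y = s0"
    using D ne by auto
  note sd = splits_at_depth[OF sp _ a m]
  have s: "s = s0" and b: "b \<in> sleaves l" and d: "d \<in> sleaves l" and e: "e \<in> sleaves l" and c: "c \<in> sleaves r"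
    using sd(1) sd(3)[of b] sd(3)[of d] sd(3)[of e] sd(2)[of c] D ne by auto
  have dl: "depth l a b = z + x" "depth l a d = z" "depth l a e = z" "depth l d e = z + u"
    using sd(3)[of b] sd(3)[of d] sd(3)[of e] splits_at_side(1)[OF sp, of d e] D s d e ne by auto
  note lr = splits_at_props[OF sp]
  have ne': "distinct [a, b, d, e]" using ne by auto
  have T: "z < depth l a b" "X = exp (- (depth l a b - z))" "U = exp (- (depth l d e - z))"
    using D X dl by auto
  note E4 = out_balanced4[OF lr(1,2) a b d e ne' dl(2,3) T X(3)]
  have Zs: "{a, c} \<union> {b, d, e} = ?Z" by auto
  have "local_eigenfunction ?Z 0 (tt_both {a, c} {b, d, e})"
    using tt_both_local[of "{a,c}" "{b,d,e}"] ne unfolding Zs by auto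
  note E' = this[THEN E]
  have "join_expect l r (\<lambda>S1 S2. tt_both {a, c} {b, d, e} (S1 \<union> S2))
      = join_expect l r (\<lambda>S1 S2. tt_second {a} {b, d, e} S1 + 1/30 * unmerged {a, b, d, e} S1)"
    using a b c d e ne by (intro join_eval[OF sp]) (rule joined.tt_both_peel_first, auto)
  then have "display_prob t {a, c} {b, d, e} = X * (1/3 - U / 6) + 1/30 * (X * U * Z ^ 6)"
    unfolding E' join_expect_left[OF lr(3,4)] out_expect_add out_expect_cmult E4 .
  then show ?thesis by simp
qed

lemma quintet_balanced:
  assumes mem: "{a, b, c, d, e} \<subseteq> sleaves t" and ne: "distinct [a, b, c, d, e]"
    and D: "D a d = s0" "D a e = s0" "D a c = s0 + y" "D a b = s0 + y + x" "D d e = s0 + w" "0 < x" "0 < y"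
    and X: "X = exp (- x)" "Y = exp (- y)" "V = exp (- w)"
  shows "display_prob t {a, c} {b, d, e} = X / 3 - 2/15 * X * Y ^ 3 * V"
    and "display_prob t {c, d} {a, b, e} = V * (Y * (1 - X / 2) / 3 + X * Y ^ 3 / 30)"
proof -
  let ?Z = "{a, b, c, d, e}"
  obtain l r s where sp: "splits_at t ?Z l r s" and a: "a \<in> sleaves l"
    and E: "\<And>F. local_eigenfunction ?Z 0 F \<Longrightarrow>
      root_expect t F = join_expect l r (\<lambda>S1 S2. F (S1 \<union> S2))"
    using t mem ne by (elim root_expect_splitE[of t ?Z a]) auto
  have m: "\<forall>y\<in>?Z - {a}. s0 \<le> D a y" "\<exists>y\<in>?Z - {a}. D a y = s0"
    using D ne by auto
  note sd = splits_at_depth[OF sp _ a m]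
  have s: "s = s0" and b: "b \<in> sleaves l" and c: "c \<in> sleaves l" and d: "d \<in> sleaves r" and e: "e \<in> sleaves r"
    using sd(1) sd(3)[of b] sd(3)[of c] sd(2)[of d] sd(2)[of e] D ne by auto
  have dl: "depth l a b = y + x" "depth l a c = y" "depth r d e = w"
    using sd(3)[of b] sd(3)[of c] splits_at_right[OF sp, of d e] D s d e ne by auto
  note lr = splits_at_props[OF sp]
  have ne': "a \<noteq> b" "a \<noteq> c" "b \<noteq> c" "d \<noteq> e" using ne by auto
  have T: "depth l a c < depth l a b" "X = exp (- (depth l a b - depth l a c))" "Y = exp (- depth l a c)"
    using D X dl by auto
  note E3 = out_triple[OF lr(1,2) a b c ne'(1-3) T]
  have Ede: "out_expect r (unmerged {d, e}) = V"
    using out_expect_unmerged_doubleton[OF lr(3,4) d e ne'(4)] dl X by simp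
  have Zs: "{a, c} \<union> {b, d, e} = ?Z" "{c, d} \<union> {a, b, e} = ?Z" by auto
  have "local_eigenfunction ?Z 0 (tt_both {a, c} {b, d, e})" "local_eigenfunction ?Z 0 (tt_both {c, d} {a, b, e})"
    using tt_both_local[of "{a,c}" "{b,d,e}"] tt_both_local[of "{c,d}" "{a,b,e}"] ne unfolding Zs by auto
  note E' = this[THEN E]
  have "join_expect l r (\<lambda>S1 S2. tt_both {a, c} {b, d, e} (S1 \<union> S2))
      = join_expect l r (\<lambda>S1 S2. tt_first {a, c} {b} S1 + - (2/15) * (unmerged {a, b, c} S1 * unmerged {d, e} S2))"
    using a b c d e ne' by (intro join_eval[OF sp]) (rule joined.tt_both_balanced_first)
  then have "display_prob t {a, c} {b, d, e} = X / 3 + - (2/15) * (X * Y ^ 3 * V)"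
    unfolding E' join_expect_add join_expect_cmult join_expect_mult join_expect_left[OF lr(3,4)] Ede E3 .
  then show "display_prob t {a, c} {b, d, e} = X / 3 - 2/15 * X * Y ^ 3 * V" by simp
  have "join_expect l r (\<lambda>S1 S2. tt_both {c, d} {a, b, e} (S1 \<union> S2))
      = join_expect l r (\<lambda>S1 S2. 1/3 * (tt_open {a, b} {c} S1 * unmerged {d, e} S2)
          + 1/30 * (unmerged {a, b, c} S1 * unmerged {d, e} S2))"
    using a b c d e ne' by (intro join_eval[OF sp]) (rule joined.tt_both_balanced_second)
  then have "display_prob t {c, d} {a, b, e} = 1/3 * (Y * (1 - X / 2) * V) + 1/30 * (X * Y ^ 3 * V)"
    unfolding E' join_expect_add join_expect_cmult join_expect_mult Ede E3 .
  then show "display_prob t {c, d} {a, b, e} = V * (Y * (1 - X / 2) / 3 + X * Y ^ 3 / 30)"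
    by (simp add: field_simps)
qed

lemma quintet_caterpillar:
  assumes mem: "{a, b, c, d, e} \<subseteq> sleaves t" and ne: "distinct [a, b, c, d, e]"
    and D: "D a e = s0" "D a d = s0 + z" "D a c = s0 + z + y" "D a b = s0 + z + y + x" "0 < x" "0 < y" "0 < z"
    and X: "X = exp (- x)" "Y = exp (- y)" "Z = exp (- z)"
  shows "display_prob t {a, c} {b, d, e} = X / 3 - X * Y ^ 3 / 9 - X * Y ^ 3 * Z ^ 6 / 45"
    and "display_prob t {c, d} {a, b, e} = Y * (1 - X / 2) / 3 + X * Y ^ 3 / 18 - X * Y ^ 3 * Z ^ 6 / 45"
    and "display_prob t {c, e} {a, b, d} = Y * (1 - X / 2) / 3 + X * Y ^ 3 * Z ^ 6 / 30"
proof -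
  let ?Z = "{a, b, c, d, e}"
  obtain l r s where sp: "splits_at t ?Z l r s" and a: "a \<in> sleaves l"
    and E: "\<And>F. local_eigenfunction ?Z 0 F \<Longrightarrow>
      root_expect t F = join_expect l r (\<lambda>S1 S2. F (S1 \<union> S2))"
    using t mem ne by (elim root_expect_splitE[of t ?Z a]) auto
  have m: "\<forall>y\<in>?Z - {a}. s0 \<le> D a y" "\<exists>y\<in>?Z - {a}. D a y = s0"
    using D ne by auto
  note sd = splits_at_depth[OF sp _ a m]
  have s: "s = s0" and b: "b \<in> sleaves l" and c: "c \<in> sleaves l" and d: "d \<in> sleaves l" and e: "e \<in> sleaves r"
    using sd(1) sd(3)[of b] sd(3)[of c] sd(3)[of d] sd(2)[of e] D ne by auto
  have dl: "depth l a b = z + y + x" "depth l a c = z + y" "depth l a d = z"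
    using sd(3)[of b] sd(3)[of c] sd(3)[of d] D ne by auto
  note lr = splits_at_props[OF sp]
  have ne': "distinct [a, b, c, d]" using ne by auto
  have T: "depth l a d < depth l a c" "depth l a c < depth l a b" "X = exp (- (depth l a b - depth l a c))"
      "Y = exp (- (depth l a c - depth l a d))" "Z = exp (- depth l a d)"
    using D X dl by auto
  note E4 = out_caterpillar4[OF lr(1,2) a b c d ne' T]
  have Zs: "{a, c} \<union> {b, d, e} = ?Z" "{c, d} \<union> {a, b, e} = ?Z" "{c, e} \<union> {a, b, d} = ?Z" by auto
  have "local_eigenfunction ?Z 0 (tt_both {a, c} {b, d, e})" "local_eigenfunction ?Z 0 (tt_both {c, d} {a, b, e})"
    "local_eigenfunction ?Z 0 (tt_both {c, e} {a, b, d})"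
    using tt_both_local[of "{a,c}" "{b,d,e}"] tt_both_local[of "{c,d}" "{a,b,e}"]
      tt_both_local[of "{c,e}" "{a,b,d}"] ne unfolding Zs by auto
  note E' = this[THEN E]
  have "join_expect l r (\<lambda>S1 S2. tt_both {a, c} {b, d, e} (S1 \<union> S2))
      = join_expect l r (\<lambda>S1 S2. tt_first {a, c} {b, d} S1 + - (1/45) * unmerged {a, b, c, d} S1)"
  proof (rule join_eval[OF sp])
    fix S1 S2 assume J: "joined (sleaves l) (sleaves r) S1 S2"
    show "tt_both {a, c} {b, d, e} (S1 \<union> S2) = tt_first {a, c} {b, d} S1 + - (1/45) * unmerged {a, b, c, d} S1"
      using joined.tt_both_peel_second2[OF J, of "{a,c}" "{b,d}" e] a b c d e ne by (auto simp: insert_commute)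
  qed
  then have "display_prob t {a, c} {b, d, e} = (X / 3 - X * Y ^ 3 / 9) + - (1/45) * (X * Y ^ 3 * Z ^ 6)"
    unfolding E' join_expect_left[OF lr(3,4)] out_expect_add out_expect_cmult E4 .
  then show "display_prob t {a, c} {b, d, e} = X / 3 - X * Y ^ 3 / 9 - X * Y ^ 3 * Z ^ 6 / 45" by simp
  have "join_expect l r (\<lambda>S1 S2. tt_both {c, d} {a, b, e} (S1 \<union> S2))
      = join_expect l r (\<lambda>S1 S2. tt_first {c, d} {a, b} S1 + - (1/45) * unmerged {a, b, c, d} S1)"
  proof (rule join_eval[OF sp])
    fix S1 S2 assume J: "joined (sleaves l) (sleaves r) S1 S2"
    show "tt_both {c, d} {a, b, e} (S1 \<union> S2) = tt_first {c, d} {a, b} S1 + - (1/45) * unmerged {a, b, c, d} S1"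
      using joined.tt_both_peel_second2[OF J, of "{c,d}" "{a,b}" e] a b c d e ne by (auto simp: insert_commute)
  qed
  then have "display_prob t {c, d} {a, b, e} = (Y * (1 - X / 2) / 3 + X * Y ^ 3 / 18) + - (1/45) * (X * Y ^ 3 * Z ^ 6)"
    unfolding E' join_expect_left[OF lr(3,4)] out_expect_add out_expect_cmult E4 .
  then show "display_prob t {c, d} {a, b, e} = Y * (1 - X / 2) / 3 + X * Y ^ 3 / 18 - X * Y ^ 3 * Z ^ 6 / 45" by simp
  have "join_expect l r (\<lambda>S1 S2. tt_both {c, e} {a, b, d} (S1 \<union> S2))
      = join_expect l r (\<lambda>S1 S2. tt_second {c} {a, b, d} S1 + 1/30 * unmerged {a, b, c, d} S1)"
  proof (rule join_eval[OF sp])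
    fix S1 S2 assume J: "joined (sleaves l) (sleaves r) S1 S2"
    show "tt_both {c, e} {a, b, d} (S1 \<union> S2) = tt_second {c} {a, b, d} S1 + 1/30 * unmerged {a, b, c, d} S1"
      using joined.tt_both_peel_first[OF J, of c "{a,b,d}" e] a b c d e ne by (auto simp: insert_commute)
  qed
  then have "display_prob t {c, e} {a, b, d} = Y * (1 - X / 2) / 3 + 1/30 * (X * Y ^ 3 * Z ^ 6)"
    unfolding E' join_expect_left[OF lr(3,4)] out_expect_add out_expect_cmult E4 .
  then show "display_prob t {c, e} {a, b, d} = Y * (1 - X / 2) / 3 + X * Y ^ 3 * Z ^ 6 / 30" by simp
qed

end

definition displays :: "'a set \<Rightarrow> 'a set \<Rightarrow> 'a set set set \<Rightarrow> bool" where
  "displays A W T \<longleftrightarrow> (\<exists>P Q. {P, Q} \<in> T \<and> A \<subseteq> P \<and> W \<subseteq> Q \<and> P \<inter> Q = {})"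

lemma root_k_card:
  assumes fin: "finite A"
  shows "S \<in> valid_configs A \<Longrightarrow> card S \<le> Suc k \<Longrightarrow> root_k k S S' \<noteq> 0 \<Longrightarrow> card S' \<le> 1"
proof (induction k arbitrary: S)
  case 0
  then show ?case by (auto split: if_splits)
next
  case (Suc k)
  show ?case
  proof (cases "card S \<le> 1")
    case True
    then show ?thesis using Suc.prems by (auto split: if_splits)
  next
    case False
    then have "(\<Sum>p \<in> pairs S. (1 / crate S) * root_k k (merge_pair S p) S') \<noteq> 0"
      using Suc.prems by simp
    then obtain p where p: "p \<in> pairs S" "(1 / crate S) * root_k k (merge_pair S p) S' \<noteq> 0"
      by (meson sum.not_neutral_contains_not_neutral)
    then have "root_k k (merge_pair S p) S' \<noteq> 0" by auto
    then show ?thesis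
      using Suc.IH merge_pair_valid[OF Suc.prems(1) p(1)] card_merge_pair[OF Suc.prems(1) fin p(1)] Suc.prems(2)
      by simp
  qed
qed

lemma rooted_gene_dist_support:
  assumes "distinct (sleaf_list t)" "rooted_gene_dist t G \<noteq> 0"
  shows "G \<in> valid_configs (sleaves t) \<and> card G \<le> 1"
proof (cases t)
  case (SLeaf a)
  then have "G = {{{a}}}" using assms by (auto split: if_splits)
  then show ?thesis using SLeaf by (auto simp: valid_configs_def cfgs_def)
next
  case (SNode len l r)
  have d: "distinct (sleaf_list l)" "distinct (sleaf_list r)" "sleaves l \<inter> sleaves r = {}"
    using assms(1) SNode by (auto simp: sleaves_def)
  obtain S1 S2 where "out_dist l S1 * out_dist r S2 * root_dist (S1 \<union> S2) G \<noteq> 0"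
    using assms(2) SNode by (metis (no_types, lifting) rooted_gene_dist.simps(2) sum.not_neutral_contains_not_neutral)
  then have *: "out_dist l S1 \<noteq> 0" "out_dist r S2 \<noteq> 0" "root_k (card (S1 \<union> S2)) (S1 \<union> S2) G \<noteq> 0"
    by (auto simp: root_dist_def)
  then have "S1 \<in> valid_configs (sleaves l)" "S2 \<in> valid_configs (sleaves r)"
    using d out_dist_invalid by metis+
  then have "S1 \<union> S2 \<in> valid_configs (sleaves t)"
    using valid_configs_Un[OF _ _ d(3)] SNode by simp
  then show ?thesis
    using root_k_outside[of "valid_configs (sleaves t)", OF merge_pair_valid, of G "S1 \<union> S2"] *(3)
      root_k_card[OF finite_sleaves, of "S1 \<union> S2" t "card (S1 \<union> S2)" G] by auto
qed

lemma tt_both_final: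
  assumes G: "G \<in> valid_configs L" "card G \<le> 1" and fin: "finite L"
    and AW: "A \<subseteq> L" "W \<subseteq> L" "A \<inter> W = {}" "A \<noteq> {}" "W \<noteq> {}"
  shows "tt_both A W G = (if displays A W (unroot L G) then 1 else 0)"
proof -
  have "finite G" using valid_config_finite[OF fin G(1)] .
  moreover have "G \<noteq> {}" using valid_configsD(6)[OF G(1)] AW by auto
  ultimately have "card G = 1" using G(2) by (simp add: le_Suc_eq)
  then obtain H where H: "G = {H}" by (auto simp: card_1_singleton_iff)
  have HL: "\<Union>H = L" "L \<in> H" using valid_configsD(6)[OF G(1)] valid_configsD(2)[OF G(1)] H by auto
  have "mixed A W G"
    unfolding mixed_def H using HL(2) AW by (intro bexI[of _ L]) auto
  moreover have "displays A W (unroot L G) \<longleftrightarrow> separates A W G \<or> separates W A G"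
  proof
    assume "displays A W (unroot L G)"
    then obtain P Q where PQ: "{P, Q} \<in> unroot L G" "A \<subseteq> P" "W \<subseteq> Q" "P \<inter> Q = {}"
      unfolding displays_def by (elim exE conjE)
    then obtain C where C: "{P, Q} = {C, L - C}" "C \<in> \<Union>G"
      unfolding unroot_def by (auto simp del: Union_iff)
    consider "P = C" "Q = L - C" | "P = L - C" "Q = C" using C(1) by (auto simp: doubleton_eq_iff)
    then show "separates A W G \<or> separates W A G"
    proof cases
      case 1
      then have "C \<inter> (A \<union> W) = A" using PQ by blast
      then show ?thesis unfolding separates_def using C(2) by (metis)
    next
      case 2
      then have "C \<inter> (W \<union> A) = W" using PQ by blast
      then show ?thesis unfolding separates_def using C(2) by (metis)
    qed
  next
    have dir: "\<exists>P Q. {P, Q} \<in> unroot L G \<and> B \<subseteq> P \<and> V \<subseteq> Q \<and> P \<inter> Q = {}"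
      if BV: "separates B V G" "B \<inter> V = {}" "V \<noteq> {}" "V \<subseteq> L" for B V
    proof -
      obtain C where C: "C \<in> \<Union>G" "C \<inter> (B \<union> V) = B" using BV(1) unfolding separates_def by (elim bexE)
      then have "C \<noteq> L" using BV(2-4) by blast
      then have "{C, L - C} \<in> unroot L G" using C(1) unfolding unroot_def by (intro CollectI exI[of _ C] conjI refl)
      moreover have "B \<subseteq> C" "V \<subseteq> L - C" using C(2) BV(2-4) by blast+
      ultimately show ?thesis by (intro exI[of _ C] exI[of _ "L - C"]) auto
    qed
    assume "separates A W G \<or> separates W A G"
    then show "displays A W (unroot L G)"
    proof
      assume "separates A W G"
      from dir[OF this AW(3,5,2)] show ?thesis unfolding displays_def .
    next
      assume "separates W A G"
      from dir[OF this _ AW(4,1)] AW(3) obtain P Q where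
        "{P, Q} \<in> unroot L G" "W \<subseteq> P" "A \<subseteq> Q" "P \<inter> Q = {}" by (auto simp: Int_commute)
      then show ?thesis unfolding displays_def by (metis Int_commute insert_commute)
    qed
  qed
  ultimately show ?thesis by (auto simp: two_type_def)
qed

lemma display_prob_gene_tree_dist:
  assumes d: "distinct (sleaf_list t)"
    and AW: "A \<subseteq> sleaves t" "W \<subseteq> sleaves t" "A \<inter> W = {}" "A \<noteq> {}" "W \<noteq> {}"
  shows "display_prob t A W =
    (\<Sum>T\<in>Pow (Pow (Pow (sleaves t))). gene_tree_dist t T * (if displays A W T then 1 else 0))"
proof -
  let ?L = "sleaves t" let ?I = "\<lambda>T. if displays A W T then 1 else (0::real)"
  have "(\<Sum>T\<in>Pow (Pow (Pow ?L)). gene_tree_dist t T * ?I T)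
      = (\<Sum>T\<in>Pow (Pow (Pow ?L)). \<Sum>G\<in>cfgs ?L. if unroot ?L G = T then rooted_gene_dist t G * ?I (unroot ?L G) else 0)"
    unfolding gene_tree_dist_def sum_distrib_right by (intro sum.cong refl) auto
  also have "\<dots> = (\<Sum>G\<in>cfgs ?L. \<Sum>T\<in>Pow (Pow (Pow ?L)). if unroot ?L G = T then rooted_gene_dist t G * ?I (unroot ?L G) else 0)"
    by (rule sum.swap)
  also have "\<dots> = (\<Sum>G\<in>cfgs ?L. rooted_gene_dist t G * ?I (unroot ?L G))"
  proof (intro sum.cong refl)
    fix G assume "G \<in> cfgs ?L"
    then have "\<And>C. C \<in> \<Union>G \<Longrightarrow> C \<subseteq> ?L" unfolding cfgs_def by blast
    then have "unroot ?L G \<in> Pow (Pow (Pow ?L))" unfolding unroot_def by (auto simp del: Union_iff)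
    then show "(\<Sum>T\<in>Pow (Pow (Pow ?L)). if unroot ?L G = T then rooted_gene_dist t G * ?I (unroot ?L G) else 0)
        = rooted_gene_dist t G * ?I (unroot ?L G)"
      by (subst sum.delta') auto
  qed
  also have "\<dots> = root_expect t (tt_both A W)"
    unfolding root_expect_def
  proof (intro sum.cong refl)
    fix G
    show "rooted_gene_dist t G * ?I (unroot ?L G) = rooted_gene_dist t G * tt_both A W G"
      using rooted_gene_dist_support[OF d, of G] tt_both_final[OF _ _ finite_sleaves AW, of G]
      by (cases "rooted_gene_dist t G = 0") auto
  qed
  finally show ?thesis by simp
qed

lemma tt_both_commute: "tt_both A W = tt_both W A"
proof -
  have "(\<lambda>i j. w_both j i) = w_both" by (intro ext) (auto simp: w_both_def)
  then show ?thesis by (intro ext) (simp add: two_type_commute[of True True w_both A W])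
qed

subsection \<open>Quartets and quintets determine depths up to a constant\<close>

definition isosceles :: "real \<Rightarrow> real \<Rightarrow> real \<Rightarrow> bool" where
  "isosceles x y z \<longleftrightarrow> y < x \<and> y = z \<or> x < y \<and> x = z \<or> x < z \<and> x = y"

lemma splits_at_cases:
  assumes "splits_at t Z l r s" "a \<in> Z" "b \<in> Z" "a \<noteq> b" "a \<in> sleaves l"
  shows "b \<in> sleaves l \<and> s < depth t a b \<or> b \<in> sleaves r \<and> b \<notin> sleaves l \<and> depth t a b = s"
  using splits_at_side[OF assms] by blast

context rooted_tree begin

lemma isosceles_depth:
  assumes "{a, b, c} \<subseteq> sleaves t" "distinct [a, b, c]"
  shows "isosceles (D a b) (D a c) (D b c)"
proof -
  let ?Z = "{a, b, c}"
  obtain l r s where sp: "splits_at t ?Z l r s" and a: "a \<in> sleaves l"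
    using t assms by (elim root_expect_splitE[of t ?Z a]) auto
  have cs: "b \<in> sleaves l \<and> s < D a b \<or> b \<in> sleaves r \<and> b \<notin> sleaves l \<and> D a b = s"
    "c \<in> sleaves l \<and> s < D a c \<or> c \<in> sleaves r \<and> c \<notin> sleaves l \<and> D a c = s"
    by (rule splits_at_cases[OF sp _ _ _ a]; use assms in simp)+
  have out: "b \<notin> sleaves l \<or> c \<notin> sleaves l" using splits_at_nonempty[OF sp] a by auto
  consider "b \<in> sleaves l" "c \<notin> sleaves l" | "b \<notin> sleaves l" "c \<in> sleaves l" | "b \<notin> sleaves l" "c \<notin> sleaves l"
    using out by blast
  then show ?thesis
  proof cases
    case 1
    then have "D b c = s" using splits_at_side(2)[OF sp, of b c] assms by simp
    then show ?thesis using 1 cs by (auto simp: isosceles_def)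
  next
    case 2
    then have "D c b = s" using splits_at_side(2)[OF sp, of c b] assms by auto
    then show ?thesis using 2 cs depth_commute[of t b c] by (auto simp: isosceles_def)
  next
    case 3
    then have "s < D b c" using splits_at_right(1)[OF sp, of b c] cs assms by simp
    then show ?thesis using 3 cs by (auto simp: isosceles_def)
  qed
qed

lemma isosceles4:
  assumes "{a, b, c, d} \<subseteq> sleaves t" "distinct [a, b, c, d]"
  shows "isosceles (D a b) (D a c) (D b c)" "isosceles (D a b) (D a d) (D b d)"
    "isosceles (D a c) (D a d) (D c d)" "isosceles (D b c) (D b d) (D c d)"
  using assms by (auto intro!: isosceles_depth)

lemma four_point:
  assumes "{a, b, c, d} \<subseteq> sleaves t" "distinct [a, b, c, d]"
  shows "D a c + D b d < D a b + D c d \<and> D a c + D b d = D a d + D b c \<or>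
     D a b + D c d < D a c + D b d \<and> D a b + D c d = D a d + D b c \<or>
     D a b + D c d < D a d + D b c \<and> D a b + D c d = D a c + D b d"
  using isosceles4[OF assms] unfolding isosceles_def by (smt (verit))

lemma quartet_display:
  assumes mem: "{a, b, c, d} \<subseteq> sleaves t" and ne: "distinct [a, b, c, d]"
    and D: "D a c + D b d < D a b + D c d"
  shows "display_prob t {a, b} {c, d} = 1 - 2/3 * exp (- (D a b + D c d - D a c - D b d))"
    and "display_prob t {a, c} {b, d} = exp (- (D a b + D c d - D a c - D b d)) / 3"
proof -
  let ?g = "D a b + D c d - D a c - D b d"
  have sym: "D b a = D a b" "D c a = D a c" "D d a = D a d" "D c b = D b c" "D d b = D b d" "D d c = D c d"
    by (rule depth_commute)+
  note iso = isosceles4[OF mem ne, unfolded isosceles_def]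
  consider (d) "D a d < D a c" "D a c < D a b" "?g = D a b - D a c"
    | (c) "D b c < D b d" "D b d < D b a" "?g = D b a - D b d"
    | (b) "D c b < D c a" "D c a < D c d" "?g = D c d - D c a"
    | (a) "D d a < D d b" "D d b < D d c" "?g = D d c - D d b"
    | (bal) "D a c = D b d" "D a d = D b d" "D b d < D a b"
    using iso D unfolding sym by (smt (verit))
  then have "display_prob t {a, b} {c, d} = 1 - 2/3 * exp (- ?g) \<and> display_prob t {a, c} {b, d} = exp (- ?g) / 3"
  proof cases
    case d
    then show ?thesis using quartet_caterpillar[OF mem ne d(1,2) refl] by simp
  next
    case c
    have "display_prob t {b, a} {d, c} = 1 - 2/3 * exp (- ?g)" "display_prob t {b, d} {a, c} = exp (- ?g) / 3"
      unfolding c(3) by (rule quartet_caterpillar[of b a d c, OF _ _ c(1,2) refl]; use mem ne in auto)+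
    then show ?thesis by (simp only: insert_commute[of b a] insert_commute[of d c] tt_both_commute[of "{b, d}"])
  next
    case b
    have "display_prob t {c, d} {a, b} = 1 - 2/3 * exp (- ?g)" "display_prob t {c, a} {d, b} = exp (- ?g) / 3"
      unfolding b(3) by (rule quartet_caterpillar[of c d a b, OF _ _ b(1,2) refl]; use mem ne in auto)+
    then show ?thesis by (simp only: insert_commute[of c a] insert_commute[of d b] tt_both_commute[of "{c, d}"])
  next
    case a
    have "display_prob t {d, c} {b, a} = 1 - 2/3 * exp (- ?g)" "display_prob t {d, b} {c, a} = exp (- ?g) / 3"
      unfolding a(3) by (rule quartet_caterpillar[of d c b a, OF _ _ a(1,2) refl]; use mem ne in auto)+
    then show ?thesis
      by (simp only: insert_commute[of c a] insert_commute[of d b] insert_commute[of d c] insert_commute[of b a]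
          tt_both_commute[of "{c, d}"] tt_both_commute[of "{b, d}"])
  next
    case bal
    have "?g = D a b + D c d - 2 * D b d" using bal by simp
    then show ?thesis using quartet_balanced[OF mem ne bal refl] by simp
  qed
  then show "display_prob t {a, b} {c, d} = 1 - 2/3 * exp (- ?g)"
    "display_prob t {a, c} {b, d} = exp (- ?g) / 3" by auto
qed

lemma quartet_display_minor:
  assumes mem: "{a, b, c, d} \<subseteq> sleaves t" and ne: "distinct [a, b, c, d]"
    and D: "\<not> D a c + D b d < D a b + D c d"
  shows "display_prob t {a, b} {c, d} < 1/3"
proof -
  have sym: "D d c = D c d" by (rule depth_commute)
  consider "D a b + D c d < D a c + D b d" | "D a b + D d c < D a d + D b c"
    using four_point[OF mem ne] D sym by linarith
  then show ?thesis
  proof cases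
    case 1
    have "display_prob t {a, b} {c, d} = exp (- (D a c + D b d - D a b - D c d)) / 3"
      using mem ne 1 by (intro quartet_display(2)) auto
    then show ?thesis using 1 by simp
  next
    case 2
    have "display_prob t {a, b} {d, c} = exp (- (D a d + D b c - D a b - D d c)) / 3"
      using mem ne 2 by (intro quartet_display(2)) auto
    then show ?thesis using 2 by (simp add: insert_commute)
  qed
qed

end

lemma quartet_determined:
  assumes "rooted_tree t1" "rooted_tree t2" and mem: "{a, b, c, d} \<subseteq> sleaves t1" "sleaves t2 = sleaves t1"
    and ne: "distinct [a, b, c, d]"
    and eq: "display_prob t1 {a, b} {c, d} = display_prob t2 {a, b} {c, d}"
    and D: "depth t1 a c + depth t1 b d < depth t1 a b + depth t1 c d"
  shows "depth t2 a b + depth t2 c d - depth t2 a c - depth t2 b d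
      = depth t1 a b + depth t1 c d - depth t1 a c - depth t1 b d"
proof -
  interpret t1: rooted_tree t1 by fact
  interpret t2: rooted_tree t2 by fact
  have mem2: "{a, b, c, d} \<subseteq> sleaves t2" using mem by simp
  note d1 = t1.quartet_display(1)[OF mem(1) ne D]
  have "1/3 < display_prob t1 {a, b} {c, d}" unfolding d1 using D by simp
  then have "depth t2 a c + depth t2 b d < depth t2 a b + depth t2 c d"
    using t2.quartet_display_minor[OF mem2 ne] eq by linarith
  from t2.quartet_display(1)[OF mem2 ne this] show ?thesis using d1 eq by simp
qed

definition caterpillar :: "('a \<Rightarrow> 'a \<Rightarrow> real) \<Rightarrow> 'a \<Rightarrow> 'a \<Rightarrow> 'a \<Rightarrow> 'a \<Rightarrow> 'a \<Rightarrow> bool" where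
  "caterpillar D a b c d e \<longleftrightarrow> D a e < D a d \<and> D a d < D a c \<and> D a c < D a b \<and> D b c = D a c \<and>
     D b d = D a d \<and> D c d = D a d \<and> D b e = D a e \<and> D c e = D a e \<and> D d e = D a e"

definition balanced :: "('a \<Rightarrow> 'a \<Rightarrow> real) \<Rightarrow> 'a \<Rightarrow> 'a \<Rightarrow> 'a \<Rightarrow> 'a \<Rightarrow> 'a \<Rightarrow> bool" where
  "balanced D a b c d e \<longleftrightarrow> D a d < D a c \<and> D a c < D a b \<and> D a d < D d e \<and> D b c = D a c \<and>
     D a e = D a d \<and> D b d = D a d \<and> D b e = D a d \<and> D c d = D a d \<and> D c e = D a d"

definition pseudocaterpillar :: "('a \<Rightarrow> 'a \<Rightarrow> real) \<Rightarrow> 'a \<Rightarrow> 'a \<Rightarrow> 'a \<Rightarrow> 'a \<Rightarrow> 'a \<Rightarrow> bool" where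
  "pseudocaterpillar D a b c d e \<longleftrightarrow> D a c < D a d \<and> D a d < D a b \<and> D a d < D d e \<and>
     D a e = D a d \<and> D b d = D a d \<and> D b e = D a d \<and> D b c = D a c \<and> D c d = D a c \<and> D c e = D a c"

text \<open>The seven possible positions \<open>k\<close> of the root on the unrooted tree with cherries
  \<open>a,b\<close> and \<open>d,e\<close> and middle taxon \<open>c\<close>: the pendant edge of \<open>c\<close>, the two internal edges,
  and the pendant edges of \<open>e\<close>, \<open>d\<close>, \<open>b\<close> and \<open>a\<close>. The number \<open>q\<close> encodes the length that the
  unrooted metric tree does not determine.\<close>

definition root_position ::
    "('a \<Rightarrow> 'a \<Rightarrow> real) \<Rightarrow> 'a \<Rightarrow> 'a \<Rightarrow> 'a \<Rightarrow> 'a \<Rightarrow> 'a \<Rightarrow> nat \<Rightarrow> real \<Rightarrow> bool" where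
  "root_position D a b c d e k q \<longleftrightarrow>
     k = 0 \<and> pseudocaterpillar D a b c d e \<and> q = exp (- (D a d - D a c)) ^ 6 \<or>
     k = 1 \<and> balanced D a b c d e \<and> q = exp (- (D a c - D a d)) ^ 2 \<or>
     k = 2 \<and> balanced D d e c a b \<and> q = exp (- (D d c - D d a)) ^ 2 \<or>
     k = 3 \<and> caterpillar D a b c d e \<and> q = exp (- (D a d - D a e)) ^ 6 \<or>
     k = 4 \<and> caterpillar D a b c e d \<and> q = exp (- (D a e - D a d)) ^ 6 \<or>
     k = 5 \<and> caterpillar D d e c a b \<and> q = exp (- (D d a - D d b)) ^ 6 \<or>
     k = 6 \<and> caterpillar D d e c b a \<and> q = exp (- (D d b - D d a)) ^ 6"

text \<open>With \<open>X\<close> and \<open>U\<close> the exponentials of minus the lengths of the internal edges \<open>ab|cde\<close> and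
  \<open>abc|de\<close>, the gene tree has the cherry \<open>c,a\<close> with probability \<open>X / 3 + X * U * ja\<close> and the cherry
  \<open>c,d\<close> with probability \<open>U / 3 + X * U * jd\<close>, and similarly for \<open>jb\<close> and \<open>je\<close>. Only the relations
  needed to recover \<open>k\<close> and \<open>q\<close> are recorded.\<close>

definition normalized_values :: "real \<Rightarrow> real \<Rightarrow> nat \<Rightarrow> real \<Rightarrow> real \<Rightarrow> real \<Rightarrow> real \<Rightarrow> real \<Rightarrow> bool" where
  "normalized_values X U k q ja jb jd je \<longleftrightarrow>
     k = 0 \<and> ja = - 1/6 + q/30 \<and> jb = - 1/6 + q/30 \<and> jd = - 1/6 + q/30 \<and> je = - 1/6 + q/30 \<or>
     k = 1 \<and> ja = - 2/15 * q \<and> jb = - 2/15 * q \<and> jd = - 1/6 + q/30 \<and> je = - 1/6 + q/30 \<or>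
     k = 2 \<and> ja = - 1/6 + q/30 \<and> jb = - 1/6 + q/30 \<and> jd = - 2/15 * q \<and> je = - 2/15 * q \<or>
     k = 3 \<and> ja = jb \<and> jd = - 1/6 + U\<^sup>2 * (1/18 - q/45) \<and> je = - 1/6 + U\<^sup>2 * (q/30) \<or>
     k = 4 \<and> ja = jb \<and> je = - 1/6 + U\<^sup>2 * (1/18 - q/45) \<and> jd = - 1/6 + U\<^sup>2 * (q/30) \<or>
     k = 5 \<and> jd = je \<and> ja = - 1/6 + X\<^sup>2 * (1/18 - q/45) \<and> jb = - 1/6 + X\<^sup>2 * (q/30) \<or>
     k = 6 \<and> jd = je \<and> jb = - 1/6 + X\<^sup>2 * (1/18 - q/45) \<and> ja = - 1/6 + X\<^sup>2 * (q/30)"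

lemma normalized_values_inj:
  assumes v: "normalized_values X U k q ja jb jd je" "normalized_values X U k' q' ja jb jd je"
    and pos: "0 < X" "0 < U" and q: "0 < q" "q < 1" "0 < q'" "q' < 1"
  shows "k = k' \<and> q = q'"
proof -
  have sq: "0 < X\<^sup>2" "0 < U\<^sup>2" using pos by simp_all
  define A B A' B' where "A = X\<^sup>2 * (q/30)" and "B = X\<^sup>2 * (1/18 - q/45)"
    and "A' = X\<^sup>2 * (q'/30)" and "B' = X\<^sup>2 * (1/18 - q'/45)"
  define E F E' F' where "E = U\<^sup>2 * (q/30)" and "F = U\<^sup>2 * (1/18 - q/45)"
    and "E' = U\<^sup>2 * (q'/30)" and "F' = U\<^sup>2 * (1/18 - q'/45)"
  note defs = A_def B_def A'_def B'_def E_def F_def E'_def F'_def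
  have gap: "W * (p/30) < W * (1/18 - p/45)" if "0 < W" "p < 1" for W p :: real
    using that by (intro mult_strict_left_mono) auto
  have g: "A < B" "A' < B'" "E < F" "E' < F'"
    unfolding defs by (rule gap; use sq q in simp)+
  have i: "A = A' \<Longrightarrow> q = q'" "E = E' \<Longrightarrow> q = q'"
    unfolding defs using pos by simp_all
  show ?thesis
    using v unfolding normalized_values_def defs[symmetric]
    by (elim disjE conjE) (insert q g i, auto)
qed

context rooted_tree begin

lemma pseudocaterpillar_value:
  assumes mem: "{a, b, c, d, e} \<subseteq> sleaves t" and ne: "distinct [a, b, c, d, e]"
    and p: "pseudocaterpillar D a b c d e"
    and X: "X = exp (- (D a b + D c d - D a c - D b d))" and U: "U = exp (- (D d e + D a c - D a d - D c e))"
    and q: "q = exp (- (D a d - D a c)) ^ 6"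
  shows "display_prob t {a, c} {b, d, e} = X / 3 + X * U * (- 1/6 + q/30)"
proof -
  have "display_prob t {a, c} {b, d, e} = X * (1/3 - U / 6) + X * U * exp (- (D a d - D a c)) ^ 6 / 30"
    using p X U unfolding pseudocaterpillar_def
    by (intro quintet_pseudocaterpillar[OF mem ne, of "D a c" "D a d - D a c" "D a b - D a d" "D d e - D a d"]) auto
  then show ?thesis unfolding q by (simp add: field_simps)
qed

lemma balanced_value:
  assumes mem: "{a, b, c, d, e} \<subseteq> sleaves t" and ne: "distinct [a, b, c, d, e]"
    and p: "balanced D a b c d e"
    and X: "X = exp (- (D a b + D c d - D a c - D b d))" and U: "U = exp (- (D d e + D a c - D a d - D c e))"
    and q: "q = exp (- (D a c - D a d)) ^ 2"
  shows "display_prob t {a, c} {b, d, e} = X / 3 + X * U * (- 2/15 * q)"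
    and "display_prob t {c, d} {a, b, e} = U / 3 + X * U * (- 1/6 + q/30)"
proof -
  define Y where "Y = exp (- (D a c - D a d))"
  define V where "V = exp (- (D d e - D a d))"
  have U': "U = Y * V" using p unfolding U Y_def V_def balanced_def by (simp add: mult_exp_exp)
  have X': "X = exp (- (D a b - D a c))" using p unfolding X balanced_def by simp
  have D: "D a d = D a d" "D a e = D a d" "D a c = D a d + (D a c - D a d)"
    "D a b = D a d + (D a c - D a d) + (D a b - D a c)" "D d e = D a d + (D d e - D a d)"
    "0 < D a b - D a c" "0 < D a c - D a d"
    using p unfolding balanced_def by auto
  note v = quintet_balanced[OF mem ne D X' Y_def V_def]
  have q': "q = Y\<^sup>2" unfolding q Y_def ..
  show "display_prob t {a, c} {b, d, e} = X / 3 + X * U * (- 2/15 * q)"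
    unfolding v(1) U' q' by (simp add: power2_eq_square power3_eq_cube)
  show "display_prob t {c, d} {a, b, e} = U / 3 + X * U * (- 1/6 + q/30)"
    unfolding v(2) U' q' by (simp add: power2_eq_square power3_eq_cube field_simps)
qed

lemma caterpillar_value:
  assumes mem: "{a, b, c, d, e} \<subseteq> sleaves t" and ne: "distinct [a, b, c, d, e]"
    and p: "caterpillar D a b c d e"
    and X: "X = exp (- (D a b + D c d - D a c - D b d))" and U: "U = exp (- (D d e + D a c - D a d - D c e))"
    and q: "q = exp (- (D a d - D a e)) ^ 6"
  shows "display_prob t {a, c} {b, d, e} = X / 3 + X * U * (- (U\<^sup>2 * (1/9 + q/45)))"
    and "display_prob t {c, d} {a, b, e} = U / 3 + X * U * (- 1/6 + U\<^sup>2 * (1/18 - q/45))"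
    and "display_prob t {c, e} {a, b, d} = U / 3 + X * U * (- 1/6 + U\<^sup>2 * (q/30))"
proof -
  have X': "X = exp (- (D a b - D a c))" and U': "U = exp (- (D a c - D a d))"
    using p unfolding X U caterpillar_def by auto
  have D: "D a e = D a e" "D a d = D a e + (D a d - D a e)" "D a c = D a e + (D a d - D a e) + (D a c - D a d)"
    "D a b = D a e + (D a d - D a e) + (D a c - D a d) + (D a b - D a c)"
    "0 < D a b - D a c" "0 < D a c - D a d" "0 < D a d - D a e"
    using p unfolding caterpillar_def by auto
  note v = quintet_caterpillar[OF mem ne D X' U' refl, folded q]
  show "display_prob t {a, c} {b, d, e} = X / 3 + X * U * (- (U\<^sup>2 * (1/9 + q/45)))"
    unfolding v(1) by (simp add: power2_eq_square power3_eq_cube field_simps)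
  show "display_prob t {c, d} {a, b, e} = U / 3 + X * U * (- 1/6 + U\<^sup>2 * (1/18 - q/45))"
    unfolding v(2) by (simp add: power2_eq_square power3_eq_cube field_simps)
  show "display_prob t {c, e} {a, b, d} = U / 3 + X * U * (- 1/6 + U\<^sup>2 * (q/30))"
    unfolding v(3) by (simp add: power2_eq_square power3_eq_cube field_simps)
qed

lemma isosceles5:
  assumes "{a, b, c, d, e} \<subseteq> sleaves t" "distinct [a, b, c, d, e]"
  shows "isosceles (D a b) (D a c) (D b c)" "isosceles (D a b) (D a d) (D b d)"
    "isosceles (D a b) (D a e) (D b e)" "isosceles (D a c) (D a d) (D c d)"
    "isosceles (D a c) (D a e) (D c e)" "isosceles (D a d) (D a e) (D d e)"
    "isosceles (D b c) (D b d) (D c d)" "isosceles (D b c) (D b e) (D c e)"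
    "isosceles (D b d) (D b e) (D d e)" "isosceles (D c d) (D c e) (D d e)"
  by (rule isosceles_depth; use assms in auto)+

lemma root_position_exists:
  assumes mem: "{a, b, c, d, e} \<subseteq> sleaves t" and ne: "distinct [a, b, c, d, e]"
    and xu: "0 < x" "0 < u"
    and q: "D a b + D c d - D a c - D b d = x" "D a b + D c d - D a d - D b c = x"
      "D a b + D c e - D a c - D b e = x" "D a b + D c e - D a e - D b c = x"
      "D d e + D a c - D a d - D c e = u" "D d e + D a c - D a e - D c d = u"
      "D d e + D b c - D b d - D c e = u" "D d e + D b c - D b e - D c d = u"
  obtains k z where "root_position D a b c d e k z"
proof -
  note iso = isosceles5[OF mem ne, unfolded isosceles_def]
  have sym: "D d a = D a d" "D d b = D b d" "D d c = D c d" "D e a = D a e" "D e b = D b e" "D e c = D c e"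
    "D e d = D d e" "D c a = D a c" "D c b = D b c" "D b a = D a b"
    by (rule depth_commute)+
  have "pseudocaterpillar D a b c d e \<or> balanced D a b c d e \<or> balanced D d e c a b \<or>
      caterpillar D a b c d e \<or> caterpillar D a b c e d \<or> caterpillar D d e c a b \<or> caterpillar D d e c b a"
    using iso xu q
    unfolding pseudocaterpillar_def balanced_def caterpillar_def sym
    by (smt (verit))
  then show ?thesis using that unfolding root_position_def by blast
qed

end

lemma root_position_bounds:
  assumes "root_position D a b c d e k q"
  shows "0 < q" "q < 1"
  using assms unfolding root_position_def pseudocaterpillar_def balanced_def caterpillar_def
  by (elim disjE conjE; simp add: power_less_one_iff)+

context rooted_tree begin

lemma root_position_values:
  assumes mem: "{a, b, c, d, e} \<subseteq> sleaves t" and ne: "distinct [a, b, c, d, e]"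
    and p: "root_position D a b c d e k q"
    and X: "X = exp (- (D a b + D c d - D a c - D b d))" and U: "U = exp (- (D d e + D a c - D a d - D c e))"
  shows "\<exists>ja jb jd je. normalized_values X U k q ja jb jd je \<and>
    display_prob t {a, c} {b, d, e} = X / 3 + X * U * ja \<and>
    display_prob t {b, c} {a, d, e} = X / 3 + X * U * jb \<and>
    display_prob t {c, d} {a, b, e} = U / 3 + X * U * jd \<and>
    display_prob t {c, e} {a, b, d} = U / 3 + X * U * je"
proof -
  have sym: "D b a = D a b" "D c a = D a c" "D c b = D b c" "D d a = D a d" "D d b = D b d" "D d c = D c d"
    "D e a = D a e" "D e b = D b e" "D e c = D c e" "D e d = D d e"
    by (rule depth_commute)+
  have perm: "{d, c} = {c, d}" "{e, a, b} = {a, b, e}" "{e, c} = {c, e}" "{d, a, b} = {a, b, d}"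
    "{e, b, a} = {a, b, e}" "{d, b, a} = {a, b, d}" "{c, a} = {a, c}" "{c, b} = {b, c}"
    "{d, e, b} = {b, d, e}" "{d, e, a} = {a, d, e}" "{b, e, d} = {b, d, e}" "{a, e, d} = {a, d, e}"
    "{b, a, e} = {a, b, e}" "{b, a, d} = {a, b, d}"
    by auto
  have mems: "{b, a, c, d, e} \<subseteq> sleaves t" "{d, e, c, a, b} \<subseteq> sleaves t" "{e, d, c, a, b} \<subseteq> sleaves t"
    "{a, b, c, e, d} \<subseteq> sleaves t" "{b, a, c, e, d} \<subseteq> sleaves t" "{d, e, c, b, a} \<subseteq> sleaves t"
    "{e, d, c, b, a} \<subseteq> sleaves t"
    using mem by auto
  have nes: "distinct [b, a, c, d, e]" "distinct [d, e, c, a, b]" "distinct [e, d, c, a, b]"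
    "distinct [a, b, c, e, d]" "distinct [b, a, c, e, d]" "distinct [d, e, c, b, a]" "distinct [e, d, c, b, a]"
    using ne by auto
  note defs = pseudocaterpillar_def balanced_def caterpillar_def sym
  show ?thesis
    using p unfolding root_position_def
  proof (elim disjE conjE)
    assume k: "k = 0" and p: "pseudocaterpillar D a b c d e" and q: "q = exp (- (D a d - D a c)) ^ 6"
    have "display_prob t {a, c} {b, d, e} = X / 3 + X * U * (- 1/6 + q/30)"
      using pseudocaterpillar_value[OF mem ne p X U q] .
    moreover have "display_prob t {b, c} {a, d, e} = X / 3 + X * U * (- 1/6 + q/30)"
      by (rule pseudocaterpillar_value[OF mems(1) nes(1)]) (use p in \<open>auto simp: X U q defs\<close>)
    moreover have "display_prob t {d, c} {e, a, b} = U / 3 + U * X * (- 1/6 + q/30)"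
      by (rule pseudocaterpillar_value[OF mems(2) nes(2)]) (use p in \<open>auto simp: X U q defs\<close>)
    moreover have "display_prob t {e, c} {d, a, b} = U / 3 + U * X * (- 1/6 + q/30)"
      by (rule pseudocaterpillar_value[OF mems(3) nes(3)]) (use p in \<open>auto simp: X U q defs\<close>)
    ultimately show ?thesis unfolding perm normalized_values_def k
      by (intro exI[of _ "- 1/6 + q/30"] exI[of _ "- 1/6 + q/30"] exI[of _ "- 1/6 + q/30"] exI[of _ "- 1/6 + q/30"])
        (simp add: mult.commute)
  next
    assume k: "k = 1" and p: "balanced D a b c d e" and q: "q = exp (- (D a c - D a d)) ^ 2"
    have "display_prob t {a, c} {b, d, e} = X / 3 + X * U * (- 2/15 * q)"
      "display_prob t {c, d} {a, b, e} = U / 3 + X * U * (- 1/6 + q/30)"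
      using balanced_value[OF mem ne p X U q] .
    moreover have "display_prob t {b, c} {a, d, e} = X / 3 + X * U * (- 2/15 * q)"
      by (rule balanced_value[OF mems(1) nes(1)]) (use p in \<open>auto simp: X U q defs\<close>)
    moreover have "display_prob t {c, e} {a, b, d} = U / 3 + X * U * (- 1/6 + q/30)"
      by (rule balanced_value[OF mems(4) nes(4)]) (use p in \<open>auto simp: X U q defs\<close>)
    ultimately show ?thesis unfolding perm normalized_values_def k
      by (intro exI[of _ "- 2/15 * q"] exI[of _ "- 2/15 * q"] exI[of _ "- 1/6 + q/30"] exI[of _ "- 1/6 + q/30"])
        (simp add: mult.commute)
  next
    assume k: "k = 2" and p: "balanced D d e c a b" and q: "q = exp (- (D d c - D d a)) ^ 2"
    have "display_prob t {d, c} {e, a, b} = U / 3 + U * X * (- 2/15 * q)"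
      by (rule balanced_value[OF mems(2) nes(2)]) (use p in \<open>auto simp: X U q defs\<close>)
    moreover have "display_prob t {e, c} {d, a, b} = U / 3 + U * X * (- 2/15 * q)"
      by (rule balanced_value[OF mems(3) nes(3)]) (use p in \<open>auto simp: X U q defs\<close>)
    moreover have "display_prob t {c, a} {d, e, b} = X / 3 + U * X * (- 1/6 + q/30)"
      by (rule balanced_value[OF mems(2) nes(2)]) (use p in \<open>auto simp: X U q defs\<close>)
    moreover have "display_prob t {c, b} {d, e, a} = X / 3 + U * X * (- 1/6 + q/30)"
      by (rule balanced_value[OF mems(6) nes(6)]) (use p in \<open>auto simp: X U q defs\<close>)
    ultimately show ?thesis unfolding perm normalized_values_def k
      by (intro exI[of _ "- 1/6 + q/30"] exI[of _ "- 1/6 + q/30"] exI[of _ "- 2/15 * q"] exI[of _ "- 2/15 * q"])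
        (simp add: mult.commute)
  next
    assume k: "k = 3" and p: "caterpillar D a b c d e" and q: "q = exp (- (D a d - D a e)) ^ 6"
    note caterpillar_value[OF mem ne p X U q]
    moreover have "display_prob t {b, c} {a, d, e} = X / 3 + X * U * (- (U\<^sup>2 * (1/9 + q/45)))"
      by (rule caterpillar_value[OF mems(1) nes(1)]) (use p in \<open>auto simp: X U q defs\<close>)
    ultimately show ?thesis unfolding perm normalized_values_def k
      by (intro exI[of _ "- (U\<^sup>2 * (1/9 + q/45))"] exI[of _ "- (U\<^sup>2 * (1/9 + q/45))"] exI[of _ "- 1/6 + U\<^sup>2 * (1/18 - q/45)"] exI[of _ "- 1/6 + U\<^sup>2 * (q/30)"])
        (simp add: mult.commute)
  next
    assume k: "k = 4" and p: "caterpillar D a b c e d" and q: "q = exp (- (D a e - D a d)) ^ 6"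
    have XU: "X = exp (- (D a b + D c e - D a c - D b e))" "U = exp (- (D e d + D a c - D a e - D c d))"
      using p by (auto simp: X U defs)
    note caterpillar_value[OF mems(4) nes(4) p XU q]
    moreover have "display_prob t {b, c} {a, e, d} = X / 3 + X * U * (- (U\<^sup>2 * (1/9 + q/45)))"
      by (rule caterpillar_value[OF mems(5) nes(5)]) (use p in \<open>auto simp: X U q defs\<close>)
    ultimately show ?thesis unfolding perm normalized_values_def k
      by (intro exI[of _ "- (U\<^sup>2 * (1/9 + q/45))"] exI[of _ "- (U\<^sup>2 * (1/9 + q/45))"] exI[of _ "- 1/6 + U\<^sup>2 * (q/30)"] exI[of _ "- 1/6 + U\<^sup>2 * (1/18 - q/45)"])
        (simp add: mult.commute)
  next
    assume k: "k = 5" and p: "caterpillar D d e c a b" and q: "q = exp (- (D d a - D d b)) ^ 6"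
    have XU: "U = exp (- (D d e + D c a - D d c - D e a))" "X = exp (- (D a b + D d c - D d a - D c b))"
      using p by (auto simp: X U defs)
    note caterpillar_value[OF mems(2) nes(2) p XU q]
    moreover have "display_prob t {e, c} {d, a, b} = U / 3 + U * X * (- (X\<^sup>2 * (1/9 + q/45)))"
      by (rule caterpillar_value[OF mems(3) nes(3)]) (use p in \<open>auto simp: X U q defs\<close>)
    ultimately show ?thesis unfolding perm normalized_values_def k
      by (intro exI[of _ "- 1/6 + X\<^sup>2 * (1/18 - q/45)"] exI[of _ "- 1/6 + X\<^sup>2 * (q/30)"] exI[of _ "- (X\<^sup>2 * (1/9 + q/45))"] exI[of _ "- (X\<^sup>2 * (1/9 + q/45))"])
        (simp add: mult.commute)
  next
    assume k: "k = 6" and p: "caterpillar D d e c b a" and q: "q = exp (- (D d b - D d a)) ^ 6"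
    have XU: "U = exp (- (D d e + D c b - D d c - D e b))" "X = exp (- (D b a + D d c - D d b - D c a))"
      using p by (auto simp: X U defs)
    note caterpillar_value[OF mems(6) nes(6) p XU q]
    moreover have "display_prob t {e, c} {d, b, a} = U / 3 + U * X * (- (X\<^sup>2 * (1/9 + q/45)))"
      by (rule caterpillar_value[OF mems(7) nes(7)]) (use p in \<open>auto simp: X U q defs\<close>)
    ultimately show ?thesis unfolding perm normalized_values_def k
      by (intro exI[of _ "- 1/6 + X\<^sup>2 * (q/30)"] exI[of _ "- 1/6 + X\<^sup>2 * (1/18 - q/45)"] exI[of _ "- (X\<^sup>2 * (1/9 + q/45))"] exI[of _ "- (X\<^sup>2 * (1/9 + q/45))"])
        (simp add: mult.commute)
  qed
qed

lemma closest_pair: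
  assumes "finite Z" "2 \<le> card Z"
  obtains a b where "a \<in> Z" "b \<in> Z" "a \<noteq> b" "\<And>x y. x \<in> Z \<Longrightarrow> y \<in> Z \<Longrightarrow> x \<noteq> y \<Longrightarrow> D x y \<le> D a b"
proof -
  let ?P = "{p \<in> Z \<times> Z. fst p \<noteq> snd p}" let ?M = "Max ((\<lambda>p. D (fst p) (snd p)) ` ?P)"
  obtain x y where "x \<in> Z" "y \<in> Z" "x \<noteq> y"
    using assms by (metis card_le_Suc0_iff_eq not_less_eq_eq numeral_2_eq_2)
  then have ne: "?P \<noteq> {}" by force
  have fin: "finite ?P" using assms by simp
  then have "?M \<in> (\<lambda>p. D (fst p) (snd p)) ` ?P" using ne by (intro Max_in) auto
  then obtain p where p: "p \<in> ?P" "?M = D (fst p) (snd p)" by auto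
  have "D x y \<le> D (fst p) (snd p)" if "x \<in> Z" "y \<in> Z" "x \<noteq> y" for x y
  proof -
    have "(x, y) \<in> ?P" using that by simp
    then have "D x y \<in> (\<lambda>p. D (fst p) (snd p)) ` ?P" by force
    then show ?thesis unfolding p(2)[symmetric] using fin by (intro Max_ge) auto
  qed
  then show ?thesis using that[of "fst p" "snd p"] p(1) by auto
qed

lemma quintet_shape:
  assumes Y: "Y \<subseteq> sleaves t" "card Y = 5"
  obtains a b c d e where "Y = {a, b, c, d, e}" "distinct [a, b, c, d, e]"
    "pseudocaterpillar D a b c d e \<or> balanced D a b c d e \<or> caterpillar D a b c d e"
proof -
  let ?S = "\<lambda>a b c d e. pseudocaterpillar D a b c d e \<or> balanced D a b c d e \<or> caterpillar D a b c d e"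
  have fin: "finite Y" using Y(2) by (intro card_ge_0_finite) simp
  obtain a b where ab: "a \<in> Y" "b \<in> Y" "a \<noteq> b" "\<And>x y. x \<in> Y \<Longrightarrow> y \<in> Y \<Longrightarrow> x \<noteq> y \<Longrightarrow> D x y \<le> D a b"
  proof -
    have "2 \<le> card Y" using Y(2) by simp
    from closest_pair[OF fin this] show thesis using that by metis
  qed
  have card4: "card (Y - {b}) = 4" using ab Y fin by simp
  obtain p q where pq: "p \<in> Y - {b}" "q \<in> Y - {b}" "p \<noteq> q"
      "\<And>x y. x \<in> Y - {b} \<Longrightarrow> y \<in> Y - {b} \<Longrightarrow> x \<noteq> y \<Longrightarrow> D x y \<le> D p q"
  proof -
    have "2 \<le> card (Y - {b})" "finite (Y - {b})" using card4 fin by simp_all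
    from closest_pair[OF this(2,1)] show thesis using that by metis
  qed
  have sym: "D x y = D y x" for x y by (rule depth_commute)
  show ?thesis
  proof (cases "a = p \<or> a = q")
    case True
    then obtain c where c: "c \<in> Y - {b}" "c \<noteq> a" "\<And>x y. x \<in> Y - {b} \<Longrightarrow> y \<in> Y - {b} \<Longrightarrow> x \<noteq> y \<Longrightarrow> D x y \<le> D a c"
      using pq sym by metis
    have "card (Y - {a, b, c}) = 2" using Y ab c fin by (subst card_Diff_subset) auto
    then obtain d e where de: "Y - {a, b, c} = {d, e}" "d \<noteq> e" by (auto simp: card_2_iff)
    have Yeq: "Y = {a, b, c, d, e}" using de(1) ab c by auto
    have ne: "distinct [a, b, c, d, e]" using de ab c by auto
    have mem: "{a, b, c, d, e} \<subseteq> sleaves t" using Y Yeq by simp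
    have le: "D a c \<le> D a b" "D a d \<le> D a b" "D a e \<le> D a b" "D a d \<le> D a c" "D a e \<le> D a c"
        "D c d \<le> D a c" "D c e \<le> D a c" "D d e \<le> D a c"
        "D b c \<le> D a b" "D b d \<le> D a b" "D b e \<le> D a b"
      using ab(4) c(3) ne Yeq by auto
    have "balanced D a b c d e \<or> caterpillar D a b c d e \<or> caterpillar D a b c e d"
      using isosceles5[OF mem ne, unfolded isosceles_def] le
      unfolding balanced_def caterpillar_def sym[of e d] by (smt (verit))
    then show ?thesis
      using that[of a b c d e] that[of a b c e d] Yeq ne by (auto simp: insert_commute)
  next
    case False
    have "card (Y - {a, b, p, q}) = 1" using Y ab pq False fin by (subst card_Diff_subset) auto
    then obtain c where c: "Y - {a, b, p, q} = {c}" by (auto simp: card_1_singleton_iff)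
    have Yeq: "Y = {a, b, c, p, q}" using c ab pq by auto
    have ne: "distinct [a, b, c, p, q]" using c ab pq False by auto
    have mem: "{a, b, c, p, q} \<subseteq> sleaves t" using Y Yeq by simp
    have le: "D a c \<le> D a b" "D a p \<le> D a b" "D a q \<le> D a b" "D p q \<le> D a b"
        "D a c \<le> D p q" "D a p \<le> D p q" "D a q \<le> D p q" "D c p \<le> D p q" "D c q \<le> D p q"
        "D b c \<le> D a b" "D b p \<le> D a b" "D b q \<le> D a b"
      using ab(4) pq(4) ne Yeq by auto
    have "balanced D a b c p q \<or> pseudocaterpillar D a b c p q \<or> balanced D p q c a b"
      using isosceles5[OF mem ne, unfolded isosceles_def] le
      unfolding balanced_def pseudocaterpillar_def sym[of p a] sym[of p b] sym[of p c] sym[of q a] sym[of q b]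
        sym[of q c] sym[of c a] sym[of c b] by (smt (verit))
    then show ?thesis
      using that[of a b c p q] that[of p q c a b] Yeq ne by (auto simp: insert_commute)
  qed
qed

end

lemma root_position_unique:
  assumes p: "root_position D a b c d e k q" "root_position D' a b c d e k q"
    and x: "D a b + D c d - D a c - D b d = D' a b + D' c d - D' a c - D' b d"
    and u: "D d e + D a c - D a d - D c e = D' d e + D' a c - D' a d - D' c e"
    and sym: "\<And>x y. D x y = D y x" "\<And>x y. D' x y = D' y x"
    and vw: "v \<in> {a, b, c, d, e}" "w \<in> {a, b, c, d, e}" "v \<noteq> w"
  shows "D v w - D' v w = D a b - D' a b"
proof -
  have inj: "y = y'" if "exp (- y) ^ n = exp (- y') ^ n" "0 < n" for y y' :: real and n :: nat
    using that power_eq_iff_eq_base[of n "exp (- y)" "exp (- y')"] by simp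
  have i2: "exp (- y) ^ 2 = exp (- y') ^ 2 \<Longrightarrow> y = y'" and i6: "exp (- y) ^ 6 = exp (- y') ^ 6 \<Longrightarrow> y = y'"
    for y y' :: real using inj[of y 2 y'] inj[of y 6 y'] by auto
  have s: "D b a = D a b" "D c a = D a c" "D c b = D b c" "D d a = D a d" "D d b = D b d" "D d c = D c d"
    "D e a = D a e" "D e b = D b e" "D e c = D c e" "D e d = D d e"
    "D' b a = D' a b" "D' c a = D' a c" "D' c b = D' b c" "D' d a = D' a d" "D' d b = D' b d" "D' d c = D' c d"
    "D' e a = D' a e" "D' e b = D' b e" "D' e c = D' c e" "D' e d = D' d e"
    by (rule sym)+
  let ?g = "D a b - D' a b"
  have "D a c - D' a c = ?g \<and> D a d - D' a d = ?g \<and> D a e - D' a e = ?g \<and> D b c - D' b c = ?g \<and>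
      D b d - D' b d = ?g \<and> D b e - D' b e = ?g \<and> D c d - D' c d = ?g \<and> D c e - D' c e = ?g \<and> D d e - D' d e = ?g"
  proof -
    consider "k = 0" | "k = 1" | "k = 2" | "k = 3" | "k = 4" | "k = 5" | "k = 6"
      using p(1) unfolding root_position_def by blast
    then show ?thesis
    proof cases
      case 1
      then have *: "pseudocaterpillar D a b c d e" "pseudocaterpillar D' a b c d e" "exp (- (D a d - D a c)) ^ 6 = exp (- (D' a d - D' a c)) ^ 6"
        using p unfolding root_position_def by simp_all
      show ?thesis using i6[OF *(3)] *(1,2) x u unfolding pseudocaterpillar_def s by linarith
    next
      case 2
      then have *: "balanced D a b c d e" "balanced D' a b c d e" "exp (- (D a c - D a d)) ^ 2 = exp (- (D' a c - D' a d)) ^ 2"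
        using p unfolding root_position_def by simp_all
      show ?thesis using i2[OF *(3)] *(1,2) x u unfolding balanced_def s by linarith
    next
      case 3
      then have *: "balanced D d e c a b" "balanced D' d e c a b" "exp (- (D d c - D d a)) ^ 2 = exp (- (D' d c - D' d a)) ^ 2"
        using p unfolding root_position_def by simp_all
      show ?thesis using i2[OF *(3)] *(1,2) x u unfolding balanced_def s by linarith
    next
      case 4
      then have *: "caterpillar D a b c d e" "caterpillar D' a b c d e" "exp (- (D a d - D a e)) ^ 6 = exp (- (D' a d - D' a e)) ^ 6"
        using p unfolding root_position_def by simp_all
      show ?thesis using i6[OF *(3)] *(1,2) x u unfolding caterpillar_def s by linarith
    next
      case 5
      then have *: "caterpillar D a b c e d" "caterpillar D' a b c e d" "exp (- (D a e - D a d)) ^ 6 = exp (- (D' a e - D' a d)) ^ 6"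
        using p unfolding root_position_def by simp_all
      show ?thesis using i6[OF *(3)] *(1,2) x u unfolding caterpillar_def s by linarith
    next
      case 6
      then have *: "caterpillar D d e c a b" "caterpillar D' d e c a b" "exp (- (D d a - D d b)) ^ 6 = exp (- (D' d a - D' d b)) ^ 6"
        using p unfolding root_position_def by simp_all
      show ?thesis using i6[OF *(3)] *(1,2) x u unfolding caterpillar_def s by linarith
    next
      case 7
      then have *: "caterpillar D d e c b a" "caterpillar D' d e c b a" "exp (- (D d b - D d a)) ^ 6 = exp (- (D' d b - D' d a)) ^ 6"
        using p unfolding root_position_def by simp_all
      show ?thesis using i6[OF *(3)] *(1,2) x u unfolding caterpillar_def s by linarith
    qed
  qed
  then show ?thesis using vw s by auto
qed

lemma depth_diff_quintet:
  assumes r: "rooted_tree t1" "rooted_tree t2" and L: "sleaves t2 = sleaves t1"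
    and eq: "\<And>A W. A \<subseteq> sleaves t1 \<Longrightarrow> W \<subseteq> sleaves t1 \<Longrightarrow> A \<inter> W = {} \<Longrightarrow> A \<noteq> {} \<Longrightarrow> W \<noteq> {} \<Longrightarrow>
      display_prob t1 A W = display_prob t2 A W"
    and Y: "Y \<subseteq> sleaves t1" "card Y = 5"
  obtains g where "\<And>v w. v \<in> Y \<Longrightarrow> w \<in> Y \<Longrightarrow> v \<noteq> w \<Longrightarrow> depth t1 v w - depth t2 v w = g"
proof -
  interpret t1: rooted_tree t1 by fact
  interpret t2: rooted_tree t2 by fact
  let ?D = "depth t1" and ?E = "depth t2"
  obtain a b c d e where Yeq: "Y = {a, b, c, d, e}" and ne: "distinct [a, b, c, d, e]"
    and shape: "pseudocaterpillar ?D a b c d e \<or> balanced ?D a b c d e \<or> caterpillar ?D a b c d e"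
    using t1.quintet_shape[OF Y] .
  have mem: "{a, b, c, d, e} \<subseteq> sleaves t1" and mem2: "{a, b, c, d, e} \<subseteq> sleaves t2" using Y(1) L Yeq by auto
  obtain k q where p1: "root_position ?D a b c d e k q"
    using shape unfolding root_position_def by blast
  define x where "x = ?D a b + ?D c d - ?D a c - ?D b d"
  define u where "u = ?D d e + ?D a c - ?D a d - ?D c e"
  have sym: "depth t y z = depth t z y" for t :: "'a stree" and y z by (rule depth_commute)
  have D1: "?D a b + ?D c d - ?D a d - ?D b c = x"
      "?D a b + ?D c e - ?D a c - ?D b e = x" "?D a b + ?D c e - ?D a e - ?D b c = x"
      "?D d e + ?D a c - ?D a e - ?D c d = u"
      "?D d e + ?D b c - ?D b d - ?D c e = u" "?D d e + ?D b c - ?D b e - ?D c d = u" "0 < x" "0 < u"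
    using shape unfolding x_def u_def pseudocaterpillar_def balanced_def caterpillar_def by auto
  have Q: "?E y z + ?E v w - ?E y v - ?E z w = ?D y z + ?D v w - ?D y v - ?D z w"
    if "{y, z, v, w} \<subseteq> {a, b, c, d, e}" "distinct [y, z, v, w]" "?D y v + ?D z w < ?D y z + ?D v w" for y z v w
  proof (rule quartet_determined[OF r _ L that(2) _ that(3)])
    show m: "{y, z, v, w} \<subseteq> sleaves t1" using that(1) mem by blast
    then show "display_prob t1 {y, z} {v, w} = display_prob t2 {y, z} {v, w}"
      using that(2) by (intro eq) auto
  qed
  have E1: "?E a b + ?E c d - ?E a c - ?E b d = x" "?E a b + ?E c d - ?E a d - ?E b c = x"
      "?E a b + ?E c e - ?E a c - ?E b e = x" "?E a b + ?E c e - ?E a e - ?E b c = x"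
      "?E d e + ?E a c - ?E a d - ?E c e = u" "?E d e + ?E a c - ?E a e - ?E c d = u"
      "?E d e + ?E b c - ?E b d - ?E c e = u" "?E d e + ?E b c - ?E b e - ?E c d = u"
    using Q[of a b c d] Q[of a b d c] Q[of a b c e] Q[of a b e c] Q[of d e a c] Q[of e d a c]
      Q[of d e b c] Q[of e d b c] D1 ne x_def u_def
      sym[of _ d c] sym[of _ e c] sym[of _ d a] sym[of _ e a] sym[of _ d b] sym[of _ e b] sym[of _ e d]
    by auto
  obtain k' q' where p2: "root_position ?E a b c d e k' q'"
    using t2.root_position_exists[OF mem2 ne D1(7,8) E1] .
  have XU: "exp (- x) = exp (- (?E a b + ?E c d - ?E a c - ?E b d))"
      "exp (- u) = exp (- (?E d e + ?E a c - ?E a d - ?E c e))"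
    using E1 by simp_all
  obtain ja jb jd je where v1: "normalized_values (exp (- x)) (exp (- u)) k q ja jb jd je"
      "display_prob t1 {a, c} {b, d, e} = exp (- x) / 3 + exp (- x) * exp (- u) * ja"
      "display_prob t1 {b, c} {a, d, e} = exp (- x) / 3 + exp (- x) * exp (- u) * jb"
      "display_prob t1 {c, d} {a, b, e} = exp (- u) / 3 + exp (- x) * exp (- u) * jd"
      "display_prob t1 {c, e} {a, b, d} = exp (- u) / 3 + exp (- x) * exp (- u) * je"
    using t1.root_position_values[OF mem ne p1, of "exp (- x)" "exp (- u)"] unfolding x_def u_def by blast
  obtain ja' jb' jd' je' where v2: "normalized_values (exp (- x)) (exp (- u)) k' q' ja' jb' jd' je'"
      "display_prob t2 {a, c} {b, d, e} = exp (- x) / 3 + exp (- x) * exp (- u) * ja'"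
      "display_prob t2 {b, c} {a, d, e} = exp (- x) / 3 + exp (- x) * exp (- u) * jb'"
      "display_prob t2 {c, d} {a, b, e} = exp (- u) / 3 + exp (- x) * exp (- u) * jd'"
      "display_prob t2 {c, e} {a, b, d} = exp (- u) / 3 + exp (- x) * exp (- u) * je'"
    using t2.root_position_values[OF mem2 ne p2 XU] by blast
  have "display_prob t1 {a, c} {b, d, e} = display_prob t2 {a, c} {b, d, e}"
    "display_prob t1 {b, c} {a, d, e} = display_prob t2 {b, c} {a, d, e}"
    "display_prob t1 {c, d} {a, b, e} = display_prob t2 {c, d} {a, b, e}"
    "display_prob t1 {c, e} {a, b, d} = display_prob t2 {c, e} {a, b, d}"
    by (rule eq; use mem ne in auto)+
  then have j: "ja' = ja" "jb' = jb" "jd' = jd" "je' = je"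
    unfolding v1 v2 by simp_all
  have "k = k' \<and> q = q'"
    using normalized_values_inj[OF v1(1) v2(1)[unfolded j]] root_position_bounds[OF p1] root_position_bounds[OF p2]
    by simp
  then have p2': "root_position ?E a b c d e k q" using p2 by simp
  have "?D v w - ?E v w = ?D a b - ?E a b" if "v \<in> Y" "w \<in> Y" "v \<noteq> w" for v w
    using root_position_unique[OF p1 p2' _ _ sym sym, of v w] that E1 x_def u_def unfolding Yeq by simp
  then show ?thesis using that by blast
qed

lemma depth_diff_constant:
  assumes r: "rooted_tree t1" "rooted_tree t2" and L: "sleaves t2 = sleaves t1"
    and eq: "\<And>A W. A \<subseteq> sleaves t1 \<Longrightarrow> W \<subseteq> sleaves t1 \<Longrightarrow> A \<inter> W = {} \<Longrightarrow> A \<noteq> {} \<Longrightarrow> W \<noteq> {} \<Longrightarrow>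
      display_prob t1 A W = display_prob t2 A W"
    and card: "5 \<le> card (sleaves t1)"
  obtains g where "\<And>v w. v \<in> sleaves t1 \<Longrightarrow> w \<in> sleaves t1 \<Longrightarrow> v \<noteq> w \<Longrightarrow> depth t1 v w - depth t2 v w = g"
proof -
  obtain a b where ab: "a \<in> sleaves t1" "b \<in> sleaves t1" "a \<noteq> b"
    using card card_le_Suc0_iff_eq[OF finite_sleaves, of t1] by fastforce
  have "depth t1 v w - depth t2 v w = depth t1 a b - depth t2 a b"
    if vw: "v \<in> sleaves t1" "w \<in> sleaves t1" "v \<noteq> w" for v w
  proof -
    have "card {a, b, v, w} \<le> 4"
      using card_length[of "[a, b, v, w]"] by simp
    then obtain Y where Y: "{a, b, v, w} \<subseteq> Y" "Y \<subseteq> sleaves t1" "card Y = 5"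
      using exists_subset_between[of "{a, b, v, w}" 5 "sleaves t1"] card ab vw by auto
    obtain g where "\<And>v w. v \<in> Y \<Longrightarrow> w \<in> Y \<Longrightarrow> v \<noteq> w \<Longrightarrow> depth t1 v w - depth t2 v w = g"
      using depth_diff_quintet[OF r L eq Y(2,3)] by blast
    then show ?thesis using Y(1) ab(3) vw(3) by (metis insert_subset)
  qed
  then show ?thesis using that by blast
qed

subsection \<open>Depths determine the rooted metric tree\<close>

lemma sleaves_nonempty: "sleaves t \<noteq> {}"
  by (induction t) auto

lemma clusters_subset: "C \<in> clusters t \<Longrightarrow> C \<subseteq> sleaves t \<and> C \<noteq> {}"
proof (induction t)
  case (SNode len l r)
  then show ?case using sleaves_nonempty[of l] by auto
qed simp

lemma pos_below_internal: "pos_below t \<Longrightarrow> pos_internal t"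
  by (cases t) auto

lemma clusters_elen_determined:
  assumes "distinct (sleaf_list t1)" "distinct (sleaf_list t2)" "pos_internal t1" "pos_internal t2"
    "sleaves t1 = sleaves t2"
    "\<And>a b. a \<in> sleaves t1 \<Longrightarrow> b \<in> sleaves t1 \<Longrightarrow> a \<noteq> b \<Longrightarrow> depth t1 a b = depth t2 a b"
  shows "clusters t1 = clusters t2 \<and> (\<forall>C\<in>clusters t1. 2 \<le> card C \<longrightarrow> elen t1 C = elen t2 C)"
  using assms
proof (induction t1 arbitrary: t2)
  case (SLeaf a)
  show ?case
  proof (cases t2)
    case (SLeaf b)
    then show ?thesis using SLeaf.prems by simp
  next
    case (SNode len l r)
    then have "sleaves l = {a}" "sleaves r = {a}" using SLeaf.prems(5) sleaves_nonempty by (metis Un_singleton_iff sleaves_simps)+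
    moreover have "sleaves l \<inter> sleaves r = {}" using SLeaf.prems(2) SNode by (simp add: sleaves_def)
    ultimately show ?thesis by simp
  qed
next
  case (SNode len l r)
  let ?t1 = "SNode len l r"
  have d: "distinct (sleaf_list l)" "distinct (sleaf_list r)" "sleaves l \<inter> sleaves r = {}"
    using SNode.prems(1) by (auto simp: sleaves_def)
  have pos: "pos_below l" "pos_below r" using SNode.prems by auto
  obtain x y where xy: "x \<in> sleaves l" "y \<in> sleaves r"
    using sleaves_nonempty[of l] sleaves_nonempty[of r] by blast
  show ?case
  proof (cases t2)
    case (SLeaf b)
    then have "x = b" "y = b" using SNode.prems(5) xy by auto
    then show ?thesis using xy d(3) by blast
  next
    case t2: (SNode len' l' r')
    have d': "distinct (sleaf_list l')" "distinct (sleaf_list r')" "sleaves l' \<inter> sleaves r' = {}"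
      using SNode.prems(2) t2 by (auto simp: sleaves_def)
    have pos': "pos_below l'" "pos_below r'" using SNode.prems t2 by auto
    have L: "sleaves l \<union> sleaves r = sleaves l' \<union> sleaves r'" using SNode.prems(5) t2 by simp
    have key: "sleaves la = sleaves la' \<and> sleaves ra = sleaves ra' \<and> m = m'"
      if D: "\<And>a b. a \<in> sleaves la \<union> sleaves ra \<Longrightarrow> b \<in> sleaves la \<union> sleaves ra \<Longrightarrow> a \<noteq> b \<Longrightarrow>
          depth (SNode m la ra) a b = depth (SNode m' la' ra') a b"
        and U: "sleaves la \<union> sleaves ra = sleaves la' \<union> sleaves ra'"
        and dd: "sleaves la \<inter> sleaves ra = {}" "sleaves la' \<inter> sleaves ra' = {}"
        and pp: "pos_below la" "pos_below ra" "pos_below la'" "pos_below ra'"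
        and x: "x \<in> sleaves la" "x \<in> sleaves la'"
      for la ra la' ra' :: "'a stree" and m m' x
    proof -
      have ge: "m \<le> depth (SNode m la ra) a b" "m' \<le> depth (SNode m' la' ra') a b"
        if "a \<in> sleaves la \<union> sleaves ra" "b \<in> sleaves la \<union> sleaves ra" "a \<noteq> b" for a b
        using that depth_pos[OF pp(1), of a b] depth_pos[OF pp(2), of a b] depth_pos[OF pp(3), of a b]
          depth_pos[OF pp(4), of a b] by auto
      obtain y y' where y: "y \<in> sleaves ra" "y' \<in> sleaves ra'"
        using sleaves_nonempty[of ra] sleaves_nonempty[of ra'] by blast
      have "x \<noteq> y" "x \<notin> sleaves ra" "y \<notin> sleaves la" "x \<noteq> y'" "x \<notin> sleaves ra'" "y' \<notin> sleaves la'"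
        using x y dd by blast+
      then have "depth (SNode m la ra) x y = m" "depth (SNode m' la' ra') x y' = m'" by auto
      moreover have mem: "x \<in> sleaves la \<union> sleaves ra" "y \<in> sleaves la \<union> sleaves ra" "y' \<in> sleaves la \<union> sleaves ra"
        using x y U by blast+
      ultimately have m: "m = m'"
        using D[OF mem(1,2) \<open>x \<noteq> y\<close>] D[OF mem(1,3) \<open>x \<noteq> y'\<close>]
          ge(1)[OF mem(1,3) \<open>x \<noteq> y'\<close>] ge(2)[OF mem(1,2) \<open>x \<noteq> y\<close>] by linarith
      have "v \<in> sleaves la \<longleftrightarrow> v \<in> sleaves la'" if v: "v \<in> sleaves la \<union> sleaves ra" for v
      proof (cases "v = x")
        case False
        have "v \<in> sleaves la \<longleftrightarrow> m < depth (SNode m la ra) x v"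
          using depth_pos[OF pp(1), of x v] False x \<open>x \<notin> sleaves ra\<close> by auto
        moreover have "v \<in> sleaves la' \<longleftrightarrow> m' < depth (SNode m' la' ra') x v"
          using depth_pos[OF pp(3), of x v] False x \<open>x \<notin> sleaves ra'\<close> by auto
        ultimately show ?thesis using D[of x v] False x v m by simp
      qed (use x in simp)
      then have "sleaves la = sleaves la'" using U by blast
      moreover then have "sleaves ra = sleaves ra'" using U dd by blast
      ultimately show ?thesis using m by simp
    qed
    have sub: "clusters la = clusters la' \<and> (\<forall>C\<in>clusters la. 2 \<le> card C \<longrightarrow> elen la C = elen la' C)"
      if IH: "\<And>s. distinct (sleaf_list la) \<Longrightarrow> distinct (sleaf_list s) \<Longrightarrow> pos_internal la \<Longrightarrow> pos_internal s \<Longrightarrow>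
          sleaves la = sleaves s \<Longrightarrow>
          (\<And>a b. a \<in> sleaves la \<Longrightarrow> b \<in> sleaves la \<Longrightarrow> a \<noteq> b \<Longrightarrow> depth la a b = depth s a b) \<Longrightarrow>
          clusters la = clusters s \<and> (\<forall>C\<in>clusters la. 2 \<le> card C \<longrightarrow> elen la C = elen s C)"
        and "distinct (sleaf_list la)" "distinct (sleaf_list la')" "pos_below la" "pos_below la'" "sleaves la = sleaves la'"
        and D: "\<And>a b. a \<in> sleaves la \<Longrightarrow> b \<in> sleaves la \<Longrightarrow> a \<noteq> b \<Longrightarrow> depth la a b = depth la' a b"
      for la la'
      using that by (intro IH pos_below_internal) auto
    note D = SNode.prems(6)[unfolded t2]
    consider "x \<in> sleaves l'" | "x \<in> sleaves r'" using xy L by blast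
    then show ?thesis
    proof cases
      case 1
      have S: "sleaves l = sleaves l'" "sleaves r = sleaves r'" "len = len'"
        using key[of l r len len' l' r' x] D L d(3) d'(3) pos pos' xy(1) 1 by simp_all
      have Dl: "depth l a b = depth l' a b" if "a \<in> sleaves l" "b \<in> sleaves l" "a \<noteq> b" for a b
        using D[of a b] that S by simp
      have Dr: "depth r a b = depth r' a b" if "a \<in> sleaves r" "b \<in> sleaves r" "a \<noteq> b" for a b
      proof -
        have "a \<notin> sleaves l" "a \<notin> sleaves l'" using that d(3) S by blast+
        then show ?thesis using D[of a b] that S by simp
      qed
      note cl = sub[OF SNode.IH(1) d(1) d'(1) pos(1) pos'(1) S(1) Dl]
      note cr = sub[OF SNode.IH(2) d(2) d'(2) pos(2) pos'(2) S(2) Dr]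
      have "elen ?t1 C = elen t2 C" if C: "C \<in> clusters ?t1" "2 \<le> card C" for C
      proof (cases "C = sleaves l \<union> sleaves r")
        case True
        then show ?thesis using S t2 by simp
      next
        case False
        then have ne: "C \<noteq> sleaves l' \<union> sleaves r'" using L by simp
        have "C \<in> clusters l \<union> clusters r" using False C(1) by simp
        then consider "C \<in> clusters l" | "C \<notin> clusters l" "C \<in> clusters r" by blast
        then show ?thesis
        proof cases
          case 1
          then have "C \<in> clusters l'" "elen l C = elen l' C" using cl C(2) by blast+
          then show ?thesis using False ne 1 by (simp add: t2)
        next
          case 2
          then have "C \<notin> clusters l'" "elen r C = elen r' C" using cl cr C(2) by blast+
          then show ?thesis using False ne 2 by (simp add: t2)
        qed
      qed
      moreover have "clusters l = clusters l'" "clusters r = clusters r'" using cl cr by blast+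
      then have "clusters ?t1 = clusters t2" by (simp add: t2 L)
      ultimately show ?thesis by blast
    next
      case 2
      have L2: "sleaves l \<union> sleaves r = sleaves r' \<union> sleaves l'" using L by blast
      have "depth ?t1 a b = depth (SNode len' r' l') a b"
        if "a \<in> sleaves l \<union> sleaves r" "b \<in> sleaves l \<union> sleaves r" "a \<noteq> b" for a b
        using D[of a b] that d'(3) by auto
      then have S: "sleaves l = sleaves r'" "sleaves r = sleaves l'" "len = len'"
        using key[of l r len len' r' l' x] L2 d(3) d'(3) pos pos' xy(1) 2 by (simp_all add: Int_commute)
      have Dl: "depth l a b = depth r' a b" if "a \<in> sleaves l" "b \<in> sleaves l" "a \<noteq> b" for a b
      proof -
        have "a \<notin> sleaves l'" using that d(3) S by blast
        then show ?thesis using D[of a b] that S by simp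
      qed
      have Dr: "depth r a b = depth l' a b" if "a \<in> sleaves r" "b \<in> sleaves r" "a \<noteq> b" for a b
      proof -
        have "a \<notin> sleaves l" using that d(3) by blast
        then show ?thesis using D[of a b] that S by simp
      qed
      note cl = sub[OF SNode.IH(1) d(1) d'(2) pos(1) pos'(2) S(1) Dl]
      note cr = sub[OF SNode.IH(2) d(2) d'(1) pos(2) pos'(1) S(2) Dr]
      have dis: "C \<notin> clusters r" if "C \<in> clusters l" for C
        using that clusters_subset[of C l] clusters_subset[of C r] d(3) by blast
      have "elen ?t1 C = elen t2 C" if C: "C \<in> clusters ?t1" "2 \<le> card C" for C
      proof (cases "C = sleaves l \<union> sleaves r")
        case True
        then show ?thesis using S t2 by (simp add: Un_commute)
      next
        case False
        then have ne: "C \<noteq> sleaves l' \<union> sleaves r'" using L by simp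
        have "C \<in> clusters l \<union> clusters r" using False C(1) by simp
        then consider "C \<in> clusters l" "C \<notin> clusters r" | "C \<notin> clusters l" "C \<in> clusters r"
          using dis by blast
        then show ?thesis
        proof cases
          case 1
          then have "C \<notin> clusters l'" "elen l C = elen r' C" using cl cr C(2) by blast+
          then show ?thesis using False ne 1 by (simp add: t2)
        next
          case 2
          then have "C \<in> clusters l'" "elen r C = elen l' C" using cr C(2) by blast+
          then show ?thesis using False ne 2 by (simp add: t2)
        qed
      qed
      moreover have "clusters l = clusters r'" "clusters r = clusters l'" using cl cr by blast+
      then have "clusters ?t1 = clusters t2" by (simp add: t2 L Un_commute)
      ultimately show ?thesis by blast
    qed
  qed
qed

lemma rooted_eq_of_depth_diff:
  assumes d: "distinct (sleaf_list t1)" "distinct (sleaf_list t2)" and pos: "pos_internal t1" "pos_internal t2"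
    and L: "sleaves t1 = sleaves t2"
    and D: "\<And>a b. a \<in> sleaves t1 \<Longrightarrow> b \<in> sleaves t1 \<Longrightarrow> a \<noteq> b \<Longrightarrow> depth t1 a b - depth t2 a b = g"
  shows "rooted_eq t1 t2"
proof (cases t1)
  case (SLeaf x)
  then have "clusters t1 = clusters t2 \<and> (\<forall>C\<in>clusters t1. 2 \<le> card C \<longrightarrow> elen t1 C = elen t2 C)"
  proof (intro clusters_elen_determined d pos L)
    fix a b assume "a \<in> sleaves t1" "b \<in> sleaves t1" "a \<noteq> b"
    then show "depth t1 a b = depth t2 a b" using SLeaf by simp
  qed
  then show ?thesis unfolding rooted_eq_def internal_clusters_def by simp
next
  case (SNode len l r)
  let ?s = "SNode (len - g) l r"
  have s: "clusters ?s = clusters t2 \<and> (\<forall>C\<in>clusters ?s. 2 \<le> card C \<longrightarrow> elen ?s C = elen t2 C)"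
  proof (rule clusters_elen_determined)
    fix a b assume "a \<in> sleaves ?s" "b \<in> sleaves ?s" "a \<noteq> b"
    then show "depth ?s a b = depth t2 a b" using D[of a b] SNode by auto
  qed (use d pos L SNode in auto)
  have c: "clusters ?s = clusters t1" using SNode by simp
  have e: "elen ?s C = elen t1 C" if "C \<noteq> sleaves t1" for C using that SNode by simp
  have "elen t1 C = elen t2 C" if "C \<in> clusters t1" "2 \<le> card C" "C \<noteq> sleaves t1" for C
  proof -
    have "elen ?s C = elen t2 C" using s[THEN conjunct2, unfolded c, rule_format, OF that(1,2)] .
    then show ?thesis unfolding e[OF that(3)] .
  qed
  then show ?thesis
    using s[THEN conjunct1] c unfolding rooted_eq_def internal_clusters_def by (simp only:) blast
qed

lemma rmst_rooted_tree: "rmst X t \<Longrightarrow> rooted_tree t"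
  by (simp add: rmst_def rooted_tree_def)

lemma display_prob_eq:
  assumes "rmst X t1" "rmst X t2" "gene_tree_dist t1 = gene_tree_dist t2"
    "A \<subseteq> X" "W \<subseteq> X" "A \<inter> W = {}" "A \<noteq> {}" "W \<noteq> {}"
  shows "display_prob t1 A W = display_prob t2 A W"
  using assms display_prob_gene_tree_dist[of t1 A W] display_prob_gene_tree_dist[of t2 A W]
  by (simp add: rmst_def)

lemma rooted_tree_identifiable:
  assumes t: "rmst X t1" "rmst X t2" and eq: "gene_tree_dist t1 = gene_tree_dist t2" and card: "5 \<le> card X"
  shows "rooted_eq t1 t2"
proof -
  have L: "sleaves t1 = X" "sleaves t2 = X" using t by (auto simp: rmst_def)
  obtain g where "\<And>v w. v \<in> sleaves t1 \<Longrightarrow> w \<in> sleaves t1 \<Longrightarrow> v \<noteq> w \<Longrightarrow> depth t1 v w - depth t2 v w = g"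
    using depth_diff_constant[OF rmst_rooted_tree[OF t(1)] rmst_rooted_tree[OF t(2)]] L card display_prob_eq[OF t eq]
    by metis
  then show ?thesis using t L by (intro rooted_eq_of_depth_diff) (auto simp: rmst_def)
qed

subsection \<open>Four taxa\<close>

definition quartet_tree :: "'a \<Rightarrow> 'a \<Rightarrow> 'a \<Rightarrow> 'a \<Rightarrow> 'a set set set" where
  "quartet_tree a b c d = {{{a}, {b, c, d}}, {{b}, {a, c, d}}, {{c}, {a, b, d}}, {{d}, {a, b, c}}, {{a, b}, {c, d}}}"

lemma usplits_image: "usplits t = (\<lambda>C. {C, sleaves t - C}) ` (clusters t - {sleaves t})"
  unfolding usplits_def by blast

lemma caterpillar4_unrooted:
  assumes ne: "distinct [a, b, c, d]" and L: "sleaves t = {a, b, c, d}"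
    and K: "clusters t = {{a, b, c, d}, {a, b, c}, {a, b}, {a}, {b}, {c}, {d}}"
  shows "usplits t = quartet_tree a b c d" and "ulen t {{a, b}, {c, d}} = elen t {a, b}"
proof -
  have n: "a \<noteq> b" "a \<noteq> c" "a \<noteq> d" "b \<noteq> c" "b \<noteq> d" "c \<noteq> d"
    "b \<noteq> a" "c \<noteq> a" "d \<noteq> a" "c \<noteq> b" "d \<noteq> b" "d \<noteq> c" using ne by auto
  have nz: "(Z = {a, b, c, d}) = False" if "a \<notin> Z \<or> b \<notin> Z \<or> c \<notin> Z \<or> d \<notin> Z" for Z
    using that by blast
  have nz1: "({a, b} = Z) = False" if "a \<notin> Z \<or> b \<notin> Z \<or> c \<in> Z \<or> d \<in> Z" for Z
    using that n by blast
  have nz2: "({c, d} = Z) = False" if "a \<in> Z \<or> b \<in> Z \<or> c \<notin> Z \<or> d \<notin> Z" for Z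
    using that n by blast
  have m: "clusters t - {{a, b, c, d}} = {{a, b, c}, {a, b}, {a}, {b}, {c}, {d}}"
    unfolding K insert_Diff_if using n by (simp add: nz)
  have c: "{a,b,c,d} - {a,b,c} = {d}" "{a,b,c,d} - {a,b} = {c,d}" "{a,b,c,d} - {a} = {b,c,d}"
    "{a,b,c,d} - {b} = {a,c,d}" "{a,b,c,d} - {c} = {a,b,d}" "{a,b,c,d} - {d} = {a,b,c}"
    using n by auto
  have i: "{{a, b, c}, {d}} = {{d}, {a, b, c}}" by (rule insert_commute)
  have p: "{e4, e5, e1, e2, e3, e4} = {e1, e2, e3, e4, e5}" for e1 e2 e3 e4 e5 :: "'a set set" by blast
  show "usplits t = quartet_tree a b c d"
    unfolding usplits_image L m image_insert image_empty c quartet_tree_def i by (rule p)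
  have cd: "{c, d} \<notin> clusters t" unfolding K using n by (simp add: nz2)
  have ab: "{a, b} \<in> internal_clusters t" unfolding internal_clusters_def K L using n by (simp add: nz1)
  have "{C \<in> internal_clusters t. {C, sleaves t - C} = {{a, b}, {c, d}}} = {{a, b}}"
  proof (intro equalityI subsetI)
    fix C assume "C \<in> {C \<in> internal_clusters t. {C, sleaves t - C} = {{a, b}, {c, d}}}"
    then have "C \<in> clusters t" "C = {a, b} \<or> C = {c, d}"
      unfolding internal_clusters_def doubleton_eq_iff by blast+
    then show "C \<in> {{a, b}}" using cd by blast
  next
    fix C assume "C \<in> {{a, b}}"
    then show "C \<in> {C \<in> internal_clusters t. {C, sleaves t - C} = {{a, b}, {c, d}}}"
      using ab by (simp add: L c(2))
  qed
  then show "ulen t {{a, b}, {c, d}} = elen t {a, b}" unfolding ulen_def by simp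
qed

lemma balanced4_unrooted:
  assumes ne: "distinct [a, b, c, d]" and L: "sleaves t = {a, b, c, d}"
    and K: "clusters t = {{a, b, c, d}, {a, b}, {c, d}, {a}, {b}, {c}, {d}}"
  shows "usplits t = quartet_tree a b c d" and "ulen t {{a, b}, {c, d}} = elen t {a, b} + elen t {c, d}"
proof -
  have n: "a \<noteq> b" "a \<noteq> c" "a \<noteq> d" "b \<noteq> c" "b \<noteq> d" "c \<noteq> d"
    "b \<noteq> a" "c \<noteq> a" "d \<noteq> a" "c \<noteq> b" "d \<noteq> b" "d \<noteq> c" using ne by auto
  have nz: "(Z = {a, b, c, d}) = False" if "a \<notin> Z \<or> b \<notin> Z \<or> c \<notin> Z \<or> d \<notin> Z" for Z
    using that by blast
  have nz1: "({a, b} = Z) = False" if "a \<notin> Z \<or> b \<notin> Z \<or> c \<in> Z \<or> d \<in> Z" for Z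
    using that n by blast
  have nz2: "({c, d} = Z) = False" if "a \<in> Z \<or> b \<in> Z \<or> c \<notin> Z \<or> d \<notin> Z" for Z
    using that n by blast
  have m: "clusters t - {{a, b, c, d}} = {{a, b}, {c, d}, {a}, {b}, {c}, {d}}"
    unfolding K insert_Diff_if using n by (simp add: nz)
  have c: "{a,b,c,d} - {c,d} = {a,b}" "{a,b,c,d} - {a,b} = {c,d}" "{a,b,c,d} - {a} = {b,c,d}"
    "{a,b,c,d} - {b} = {a,c,d}" "{a,b,c,d} - {c} = {a,b,d}" "{a,b,c,d} - {d} = {a,b,c}"
    using n by auto
  have i: "{{c, d}, {a, b}} = {{a, b}, {c, d}}" by (rule insert_commute)
  have p: "{e5, e5, e1, e2, e3, e4} = {e1, e2, e3, e4, e5}" for e1 e2 e3 e4 e5 :: "'a set set" by blast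
  show "usplits t = quartet_tree a b c d"
    unfolding usplits_image L m image_insert image_empty c quartet_tree_def i by (rule p)
  have ab: "{a, b} \<in> internal_clusters t" "{c, d} \<in> internal_clusters t"
    unfolding internal_clusters_def K L using n by (simp_all add: nz1 nz2)
  have "{C \<in> internal_clusters t. {C, sleaves t - C} = {{a, b}, {c, d}}} = {{a, b}, {c, d}}"
  proof (intro equalityI subsetI)
    fix C assume "C \<in> {C \<in> internal_clusters t. {C, sleaves t - C} = {{a, b}, {c, d}}}"
    then show "C \<in> {{a, b}, {c, d}}" unfolding doubleton_eq_iff by blast
  next
    fix C assume "C \<in> {{a, b}, {c, d}}"
    then show "C \<in> {C \<in> internal_clusters t. {C, sleaves t - C} = {{a, b}, {c, d}}}"
      using ab by (elim insertE) (simp_all add: L c(1,2) i)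
  qed
  moreover have "{a, b} \<noteq> {c, d}" using n by auto
  ultimately show "ulen t {{a, b}, {c, d}} = elen t {a, b} + elen t {c, d}" unfolding ulen_def by simp
qed

lemma sleaf_list_1: "length (sleaf_list t) = 1 \<Longrightarrow> \<exists>a. t = SLeaf a"
  and sleaf_list_nonempty: "0 < length (sleaf_list t)"
proof -
  show pos: "0 < length (sleaf_list t)" for t :: "'a stree" by (induction t) auto
  show "length (sleaf_list t) = 1 \<Longrightarrow> \<exists>a. t = SLeaf a"
  proof (cases t)
    case (SNode len l r)
    assume "length (sleaf_list t) = 1"
    then show ?thesis using SNode pos[of l] pos[of r] by simp
  qed simp
qed

lemma sleaf_list_2:
  assumes "length (sleaf_list t) = 2"
  shows "\<exists>x a b. t = SNode x (SLeaf a) (SLeaf b)"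
proof (cases t)
  case (SNode x l r)
  then have "length (sleaf_list l) + length (sleaf_list r) = 2" using assms by simp
  then have "length (sleaf_list l) = 1" "length (sleaf_list r) = 1"
    using sleaf_list_nonempty[of l] sleaf_list_nonempty[of r] by linarith+
  then show ?thesis using SNode sleaf_list_1 by metis
qed (use assms in simp)

lemma sleaf_list_3:
  assumes "length (sleaf_list t) = 3"
  shows "\<exists>y x a b c. t = SNode y (SNode x (SLeaf a) (SLeaf b)) (SLeaf c) \<or>
    t = SNode y (SLeaf c) (SNode x (SLeaf a) (SLeaf b))"
proof (cases t)
  case (SNode x l r)
  then have "length (sleaf_list l) + length (sleaf_list r) = 3" using assms by simp
  then have "length (sleaf_list l) = 2 \<and> length (sleaf_list r) = 1 \<or>
      length (sleaf_list l) = 1 \<and> length (sleaf_list r) = 2"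
    using sleaf_list_nonempty[of l] sleaf_list_nonempty[of r] by linarith
  then show ?thesis using SNode sleaf_list_1 sleaf_list_2 by metis
qed (use assms in simp)

lemma unrooted_quartet:
  assumes t: "rmst X t" and card: "card X = 4"
  obtains a b c d where "X = {a, b, c, d}" "distinct [a, b, c, d]" "usplits t = quartet_tree a b c d"
    "depth t a c + depth t b d < depth t a b + depth t c d"
    "ulen t {{a, b}, {c, d}} = depth t a b + depth t c d - depth t a c - depth t b d"
proof -
  have d: "distinct (sleaf_list t)" and L: "sleaves t = X" and pos: "pos_internal t" using t by (auto simp: rmst_def)
  have len: "length (sleaf_list t) = 4"
    using distinct_card[OF d] L card by (simp add: sleaves_def)
  show ?thesis
  proof (cases t)
    case (SLeaf a)
    then show ?thesis using len by simp
  next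
    case (SNode z l r)
    have "length (sleaf_list l) + length (sleaf_list r) = 4" using len SNode by simp
    then consider (31) "length (sleaf_list l) = 3" "length (sleaf_list r) = 1"
      | (13) "length (sleaf_list l) = 1" "length (sleaf_list r) = 3"
      | (22) "length (sleaf_list l) = 2" "length (sleaf_list r) = 2"
      using sleaf_list_nonempty[of l] sleaf_list_nonempty[of r] by linarith
    then show ?thesis
    proof cases
      case 31
      obtain s where r: "r = SLeaf s" using sleaf_list_1[OF 31(2)] by blast
      obtain y x a b c where l: "l = SNode y (SNode x (SLeaf a) (SLeaf b)) (SLeaf c) \<or>
          l = SNode y (SLeaf c) (SNode x (SLeaf a) (SLeaf b))" using sleaf_list_3[OF 31(1)] by blast
      have ne: "distinct [a, b, c, s]" using d SNode r l by auto
      have X: "sleaves t = {a, b, c, s}" using SNode r l by auto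
      have K: "clusters t = {{a, b, c, s}, {a, b, c}, {a, b}, {a}, {b}, {c}, {s}}"
        using l r by (elim disjE; simp add: SNode insert_commute)
      have nz: "({a, b} = Z) = False" if "c \<in> Z \<or> s \<in> Z" for Z using that ne by auto
      have "elen t {a, b} = x" using l r ne by (elim disjE) (simp_all add: SNode nz doubleton_eq_iff)
      moreover have "0 < x" using SNode r l pos by auto
      moreover have "depth t a b = z + y + x" "depth t c s = z" "depth t a c = z + y" "depth t b s = z"
        using SNode r l ne by auto
      ultimately show ?thesis
        using that[of a b c s] caterpillar4_unrooted[OF ne X K] ne X L by simp
    next
      case 13
      obtain s where r: "l = SLeaf s" using sleaf_list_1[OF 13(1)] by blast
      obtain y x a b c where l: "r = SNode y (SNode x (SLeaf a) (SLeaf b)) (SLeaf c) \<or>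
          r = SNode y (SLeaf c) (SNode x (SLeaf a) (SLeaf b))" using sleaf_list_3[OF 13(2)] by blast
      have ne: "distinct [a, b, c, s]" using d SNode r l by auto
      have X: "sleaves t = {a, b, c, s}" using SNode r l by auto
      have K: "clusters t = {{a, b, c, s}, {a, b, c}, {a, b}, {a}, {b}, {c}, {s}}"
        using l r by (elim disjE; simp add: SNode insert_commute)
      have nz: "({a, b} = Z) = False" if "c \<in> Z \<or> s \<in> Z" for Z using that ne by auto
      have "elen t {a, b} = x" using l r ne by (elim disjE) (simp_all add: SNode nz doubleton_eq_iff)
      moreover have "0 < x" using SNode r l pos by auto
      moreover have "depth t a b = z + y + x" "depth t c s = z" "depth t a c = z + y" "depth t b s = z"
        using SNode r l ne by auto
      ultimately show ?thesis
        using that[of a b c s] caterpillar4_unrooted[OF ne X K] ne X L by simp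
    next
      case 22
      obtain x a b where l: "l = SNode x (SLeaf a) (SLeaf b)" using sleaf_list_2[OF 22(1)] by blast
      obtain y c s where r: "r = SNode y (SLeaf c) (SLeaf s)" using sleaf_list_2[OF 22(2)] by blast
      have ne: "distinct [a, b, c, s]" using d SNode r l by auto
      have X: "sleaves t = {a, b, c, s}" using SNode r l by auto
      have K: "clusters t = {{a, b, c, s}, {a, b}, {c, s}, {a}, {b}, {c}, {s}}"
        using l r by (simp add: SNode insert_commute)
      have nz: "({a, b} = Z) = False" if "c \<in> Z \<or> s \<in> Z" for Z using that ne by auto
      have nz': "({c, s} = Z) = False" if "a \<in> Z \<or> b \<in> Z" for Z using that ne by auto
      have "elen t {a, b} = x" "elen t {c, s} = y" using l r ne by (auto simp add: SNode nz nz' doubleton_eq_iff)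
      moreover have "0 < x" "0 < y" using SNode r l pos by auto
      moreover have "depth t a b = z + x" "depth t c s = z + y" "depth t a c = z" "depth t b s = z"
        using SNode r l ne by auto
      ultimately show ?thesis
        using that[of a b c s] balanced4_unrooted[OF ne X K] ne X L by simp
    qed
  qed
qed

lemma unrooted_tree_identifiable:
  assumes t: "rmst X t1" "rmst X t2" and eq: "gene_tree_dist t1 = gene_tree_dist t2" and card: "card X = 4"
  shows "unrooted_eq t1 t2"
proof -
  have r: "rooted_tree t1" "rooted_tree t2" using t rmst_rooted_tree by auto
  have L: "sleaves t1 = X" "sleaves t2 = X" using t by (auto simp: rmst_def)
  obtain a b c d where X: "X = {a, b, c, d}" and ne: "distinct [a, b, c, d]"
    and us: "usplits t1 = quartet_tree a b c d" and D: "depth t1 a c + depth t1 b d < depth t1 a b + depth t1 c d"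
    and ul: "ulen t1 {{a, b}, {c, d}} = depth t1 a b + depth t1 c d - depth t1 a c - depth t1 b d"
    using unrooted_quartet[OF t(1) card] .
  obtain p q v w where X2: "X = {p, q, v, w}" and ne2: "distinct [p, q, v, w]"
    and us2: "usplits t2 = quartet_tree p q v w" and D2: "depth t2 p v + depth t2 q w < depth t2 p q + depth t2 v w"
    and ul2: "ulen t2 {{p, q}, {v, w}} = depth t2 p q + depth t2 v w - depth t2 p v - depth t2 q w"
    using unrooted_quartet[OF t(2) card] .
  have Q: "depth t2 a b + depth t2 c d - depth t2 a c - depth t2 b d
      = depth t1 a b + depth t1 c d - depth t1 a c - depth t1 b d"
    using X L ne D by (intro quartet_determined[OF r]) (auto intro!: display_prob_eq[OF t eq])
  have sym: "depth t2 y z = depth t2 z y" for y z by (rule depth_commute)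
  have 4: "{p, q, v, w} \<subseteq> sleaves t2" using X2 L by simp
  have fp: "depth t2 p v + depth t2 q w = depth t2 p w + depth t2 q v"
    using rooted_tree.four_point[OF r(2) 4 ne2] D2 by linarith
  have perm: "{p, q} = {a, b} \<and> {v, w} = {c, d} \<or> {p, q} = {c, d} \<and> {v, w} = {a, b} \<or>
      (depth t2 p q + depth t2 v w = depth t2 a c + depth t2 b d \<and> depth t2 a b + depth t2 c d = depth t2 p v + depth t2 q w) \<or>
      (depth t2 p q + depth t2 v w = depth t2 a d + depth t2 b c \<and>
        depth t2 a b + depth t2 c d = depth t2 p v + depth t2 q w \<and> depth t2 a c + depth t2 b d = depth t2 p v + depth t2 q w)"
  proof -
    have pm: "p \<in> {a, b, c, d}" "q \<in> {a, b, c, d}" "v \<in> {a, b, c, d}" "w \<in> {a, b, c, d}" using X X2 by auto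
    show ?thesis using pm ne ne2 fp sym[of b a] sym[of c a] sym[of d a] sym[of c b] sym[of d b] sym[of d c]
      by (elim insertE; simp add: insert_commute)
  qed
  then have "{p, q} = {a, b} \<and> {v, w} = {c, d} \<or> {p, q} = {c, d} \<and> {v, w} = {a, b}"
    using Q D D2 by linarith
  then have "(p = a \<and> q = b \<or> p = b \<and> q = a) \<and> (v = c \<and> w = d \<or> v = d \<and> w = c) \<or>
      (p = c \<and> q = d \<or> p = d \<and> q = c) \<and> (v = a \<and> w = b \<or> v = b \<and> w = a)"
    unfolding doubleton_eq_iff by blast
  then have e: "{{p, q}, {v, w}} = {{a, b}, {c, d}} \<and>
    depth t2 p q + depth t2 v w = depth t2 a b + depth t2 c d \<and>
    depth t2 p v + depth t2 q w = depth t2 a c + depth t2 b d \<and> quartet_tree p q v w = quartet_tree a b c d"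
    using fp sym[of b a] sym[of c a] sym[of d a] sym[of c b] sym[of d b] sym[of d c]
    by (elim disjE conjE) (simp_all add: insert_commute quartet_tree_def)
  then have us2': "usplits t2 = quartet_tree a b c d" using us2 by simp
  have "ulen t2 {{a, b}, {c, d}} = ulen t1 {{a, b}, {c, d}}" using ul ul2 e Q by simp
  moreover have "s = {{a, b}, {c, d}}" if "s \<in> internal_splits t1" for s
    using that unfolding internal_splits_def us quartet_tree_def by auto
  ultimately show ?thesis unfolding unrooted_eq_def us us2' by auto
qed

abbreviation cherry_unmerged :: "'a \<Rightarrow> 'a \<Rightarrow> 'a config" where
  "cherry_unmerged a b \<equiv> {{{a}}, {{b}}}"

abbreviation cherry_merged :: "'a \<Rightarrow> 'a \<Rightarrow> 'a config" where
  "cherry_merged a b \<equiv> {{{a, b}, {a}, {b}}}"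

lemma out_dist_cherry:
  assumes "out_dist (SNode x (SLeaf a) (SLeaf b)) S \<noteq> 0"
  shows "S = cherry_unmerged a b \<or> S = cherry_merged a b"
proof -
  let ?N = "cherry_unmerged a b" and ?M = "cherry_merged a b"
  have cl: "merge_pair R p \<in> {?N, ?M}" if R: "R \<in> {?N, ?M}" and p: "p \<in> pairs R" for R p
  proof -
    obtain H1 H2 where H: "p = {H1, H2}" "H1 \<noteq> H2" "H1 \<in> R" "H2 \<in> R" using p by (rule pairs_E)
    then have "R = ?N" using R by auto
    then have "p = ?N" using H by auto
    then have "merge_pair R p = ?M" using \<open>R = ?N\<close> by (simp add: merge_pair_def insert_commute)
    then show ?thesis by simp
  qed
  obtain S1 S2 where "out_dist (SLeaf a) S1 * out_dist (SLeaf b) S2 * edge_dist (S1 \<union> S2) x S \<noteq> 0"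
    using assms by (metis (no_types, lifting) out_dist.simps(2) sum.not_neutral_contains_not_neutral)
  then have "S1 = {{{a}}}" "S2 = {{{b}}}" "edge_dist (S1 \<union> S2) x S \<noteq> 0" by (auto split: if_splits)
  then have "edge_k (card ?N) ?N x S \<noteq> 0" by (simp add: edge_dist_def insert_commute)
  then have "S \<in> {?N, ?M}" using edge_k_outside[of "{?N, ?M}" S ?N, OF cl] by blast
  then show ?thesis by (simp only: insert_iff empty_iff simp_thms)
qed

lemma gene_tree_dist_root_expect:
  "gene_tree_dist t T = root_expect t (\<lambda>G. if unroot (sleaves t) G = T then 1 else 0)"
  by (simp add: gene_tree_dist_def root_expect_def)

definition resolved_configs :: "'a \<Rightarrow> 'a \<Rightarrow> 'a \<Rightarrow> 'a \<Rightarrow> 'a config set" where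
  "resolved_configs a b c d = {S \<in> valid_configs {a, b, c, d}. {{a}, {b}, {c}, {d}} \<subseteq> \<Union>S \<and> {} \<notin> \<Union>S \<and>
     (\<forall>C\<in>\<Union>S. card C = 2 \<longrightarrow> C = {a, b} \<or> C = {c, d}) \<and> ({a, b} \<in> \<Union>S \<or> {c, d} \<in> \<Union>S)}"

lemma resolved_configsD:
  assumes "S \<in> resolved_configs a b c d"
  shows "S \<in> valid_configs {a, b, c, d}" "{{a}, {b}, {c}, {d}} \<subseteq> \<Union>S" "{} \<notin> \<Union>S"
    "\<And>C. C \<in> \<Union>S \<Longrightarrow> card C = 2 \<Longrightarrow> C = {a, b} \<or> C = {c, d}" "{a, b} \<in> \<Union>S \<or> {c, d} \<in> \<Union>S"
proof -
  note S = assms[unfolded resolved_configs_def mem_Collect_eq]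
  show "S \<in> valid_configs {a, b, c, d}" using S by (rule conjunct1)
  note S = S[THEN conjunct2]
  show "{{a}, {b}, {c}, {d}} \<subseteq> \<Union>S" using S by (rule conjunct1)
  note S = S[THEN conjunct2]
  show "{} \<notin> \<Union>S" using S by (rule conjunct1)
  note S = S[THEN conjunct2]
  show "\<And>C. C \<in> \<Union>S \<Longrightarrow> card C = 2 \<Longrightarrow> C = {a, b} \<or> C = {c, d}" using S[THEN conjunct1, rule_format] .
  show "{a, b} \<in> \<Union>S \<or> {c, d} \<in> \<Union>S" using S by (rule conjunct2)
qed

lemma resolved_configs_merge_pair:
  assumes ne: "distinct [a, b, c, d]" and S: "S \<in> resolved_configs a b c d" and p: "p \<in> pairs S"
  shows "merge_pair S p \<in> resolved_configs a b c d"
proof -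
  note V = resolved_configsD(1)[OF S] and s = resolved_configsD(2,3)[OF S]
    and C2 = resolved_configsD(4)[OF S] and P = resolved_configsD(5)[OF S]
  obtain H1 H2 where H: "p = {H1, H2}" "H1 \<noteq> H2" "H1 \<in> S" "H2 \<in> S" using p by (rule pairs_E)
  let ?N = "\<Union>H1 \<union> \<Union>H2"
  have U: "\<Union>(merge_pair S p) = insert ?N (\<Union>S)" unfolding H(1) by (rule Union_merge_pair[OF H(3,4)])
  have N0: "?N \<noteq> {}" "?N \<subseteq> {a, b, c, d}" "finite ?N"
  proof -
    show "?N \<noteq> {}" using valid_configsD(3)[OF V H(3)] by simp
    show N: "?N \<subseteq> {a, b, c, d}" using valid_configsD(4)[OF V H(3)] valid_configsD(4)[OF V H(4)] by blast
    show "finite ?N" by (rule finite_subset[OF N]) simp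
  qed
  have blk: "Q \<subseteq> ?N" if Q: "Q \<in> \<Union>S" "?N \<inter> Q \<noteq> {}" for Q
  proof -
    obtain H where Hq: "H \<in> S" "Q \<in> H" using Q(1) by blast
    then have QH: "Q \<subseteq> \<Union>H" by blast
    then have "\<Union>H \<inter> \<Union>H1 \<noteq> {} \<or> \<Union>H \<inter> \<Union>H2 \<noteq> {}" using Q(2) by blast
    then have "H = H1 \<or> H = H2"
      using valid_configsD(5)[OF V Hq(1) H(3)] valid_configsD(5)[OF V Hq(1) H(4)] by blast
    then show ?thesis using QH by blast
  qed
  have N2: "?N = {a, b} \<or> ?N = {c, d}" if c2: "card ?N = 2"
  proof -
    have pick: "?N = Q \<or> ?N = R"
      if Q: "Q \<in> \<Union>S" "card Q = 2" "card R = 2" "finite R" "{a, b, c, d} \<subseteq> Q \<union> R" for Q R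
    proof (cases "?N \<inter> Q = {}")
      case True
      then have "?N \<subseteq> R" using N0(2) Q(5) by blast
      then show ?thesis using card_subset_eq[OF Q(4)] c2 Q(3) by metis
    next
      case False
      then show ?thesis using card_subset_eq[OF N0(3) blk[OF Q(1)]] c2 Q(2) by metis
    qed
    have c: "card {a, b} = 2" "card {c, d} = 2" "finite {a, b}" "finite {c, d}" using ne by auto
    have "{a, b, c, d} \<subseteq> {a, b} \<union> {c, d}" "{a, b, c, d} \<subseteq> {c, d} \<union> {a, b}" by auto
    then show ?thesis using P pick[OF _ c(1,2,4)] pick[OF _ c(2,1,3)] by metis
  qed
  have "merge_pair S p \<in> valid_configs {a, b, c, d}" using merge_pair_valid[OF V p] .
  moreover have "{{a}, {b}, {c}, {d}} \<subseteq> \<Union>(merge_pair S p)" unfolding U using s(1) by (rule subset_insertI2)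
  moreover have "{} \<notin> \<Union>(merge_pair S p)" unfolding U using s(2) N0(1) by (metis insertE)
  moreover have "\<forall>C\<in>\<Union>(merge_pair S p). card C = 2 \<longrightarrow> C = {a, b} \<or> C = {c, d}"
    unfolding U using C2 N2 by (metis insertE)
  moreover have "{a, b} \<in> \<Union>(merge_pair S p) \<or> {c, d} \<in> \<Union>(merge_pair S p)" unfolding U using P by (metis insertI2)
  ultimately show ?thesis unfolding resolved_configs_def by (intro CollectI conjI)
qed

lemma unroot_resolved:
  assumes ne: "distinct [a, b, c, d]" and S: "S \<in> resolved_configs a b c d"
  shows "unroot {a, b, c, d} S = quartet_tree a b c d"
proof -
  let ?X = "{a, b, c, d}"
  note V = resolved_configsD(1)[OF S] and s = resolved_configsD(2,3)[OF S]
    and C2 = resolved_configsD(4)[OF S] and P = resolved_configsD(5)[OF S]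
  have cX: "card ?X = 4" using ne by simp
  have co: "?X - {a} = {b, c, d}" "?X - {b} = {a, c, d}" "?X - {c} = {a, b, d}" "?X - {d} = {a, b, c}"
    "?X - {a, b} = {c, d}" "?X - {c, d} = {a, b}" using ne by auto
  have single: "{{x}, ?X - {x}} \<in> quartet_tree a b c d" if "x \<in> ?X" for x
    using that by (elim insertE) (simp_all add: co quartet_tree_def del: insert_Diff_single)
  have pair: "{{a, b}, ?X - {a, b}} = {{a, b}, {c, d}}" "{{c, d}, ?X - {c, d}} = {{a, b}, {c, d}}"
    unfolding co by (simp_all add: insert_commute)
  show ?thesis
  proof (intro equalityI subsetI)
    fix T assume "T \<in> unroot ?X S"
    then obtain C where C: "T = {C, ?X - C}" "C \<in> \<Union>S" "C \<noteq> ?X" unfolding unroot_def by (auto simp del: Union_iff)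
    have sub: "C \<subseteq> ?X" using cluster_subset[OF V C(2)] .
    have "C \<noteq> {}" using C(2) s(2) by metis
    then have "0 < card C" using sub finite_subset[OF sub] by (simp add: card_gt_0_iff)
    moreover have "card C < 4" using psubset_card_mono[of ?X C] sub C(3) cX by auto
    ultimately consider "card C = 1" | "card C = 2" | "card C = 3" by linarith
    then show "T \<in> quartet_tree a b c d"
    proof cases
      case 1
      then obtain x where "C = {x}" by (auto simp: card_1_singleton_iff)
      then show ?thesis using C(1) single[of x] sub by simp
    next
      case 2
      have "{{a, b}, {c, d}} \<in> quartet_tree a b c d" by (simp add: quartet_tree_def)
      then show ?thesis using C2[OF C(2) 2] pair unfolding C(1) by metis
    next
      case 3
      have "card (?X - C) = 1" using card_Diff_subset[OF finite_subset[OF sub] sub] cX 3 by simp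
      then obtain x where x: "?X - C = {x}" by (auto simp: card_1_singleton_iff)
      then have "C = ?X - {x}" "x \<in> ?X" using sub by blast+
      then show ?thesis unfolding C(1) x using single[of x] by (simp add: insert_commute del: insert_Diff_single)
    qed
  next
    fix T assume "T \<in> quartet_tree a b c d"
    then have T: "T = {{a}, ?X - {a}} \<or> T = {{b}, ?X - {b}} \<or> T = {{c}, ?X - {c}} \<or> T = {{d}, ?X - {d}} \<or>
        T = {{a, b}, {c, d}}"
      unfolding quartet_tree_def co by (simp only: insert_iff empty_iff simp_thms)
    have mem: "{C, ?X - C} \<in> unroot ?X S" if "C \<in> \<Union>S" "card C < 4" for C
    proof -
      have "C \<noteq> ?X" using that(2) cX by (metis less_irrefl)
      then show ?thesis using that(1) unfolding unroot_def by (intro CollectI exI[of _ C] conjI refl)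
    qed
    have "card {a, b} < 4" "card {c, d} < 4" using ne by simp_all
    then have pm: "{{a, b}, {c, d}} \<in> unroot ?X S"
      using P mem[of "{a, b}", unfolded pair] mem[of "{c, d}", unfolded pair] by metis
    have sm: "{{x}, ?X - {x}} \<in> unroot ?X S" if "x \<in> ?X" for x
    proof -
      have "{x} \<in> \<Union>S" using s(1) that by (elim insertE) (simp_all del: Union_iff)
      then show ?thesis using mem[of "{x}"] by simp
    qed
    have "{{a}, ?X - {a}} \<in> unroot ?X S" "{{b}, ?X - {b}} \<in> unroot ?X S"
      "{{c}, ?X - {c}} \<in> unroot ?X S" "{{d}, ?X - {d}} \<in> unroot ?X S" by (rule sm; simp)+
    then show "T \<in> unroot ?X S" using T pm by metis
  qed
qed

lemma root_expectation_resolved: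
  assumes ne: "distinct [a, b, c, d]" and S: "S \<in> resolved_configs a b c d"
  shows "(\<Sum>G\<in>cfgs {a, b, c, d}. root_dist S G * (if unroot {a, b, c, d} G = T then 1 else 0))
    = (if quartet_tree a b c d = T then 1 else 0)"
proof -
  let ?X = "{a, b, c, d}"
  have "(\<Sum>G\<in>cfgs ?X. root_dist S G * (if unroot ?X G = T then 1 else 0))
      = (\<Sum>G\<in>cfgs ?X. root_dist S G * (if quartet_tree a b c d = T then 1 else 0))"
  proof (intro sum.cong refl)
    fix G
    show "root_dist S G * (if unroot ?X G = T then 1 else 0) = root_dist S G * (if quartet_tree a b c d = T then 1 else 0)"
    proof (cases "G \<in> resolved_configs a b c d")
      case True
      then show ?thesis using unroot_resolved[OF ne True] by simp
    next
      case False
      then have "root_dist S G = 0"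
        unfolding root_dist_def using root_k_outside[OF resolved_configs_merge_pair[OF ne] False S] by blast
      then show ?thesis by simp
    qed
  qed
  also have "\<dots> = (if quartet_tree a b c d = T then 1 else 0)"
  proof -
    have "S \<in> valid_configs ?X" using S unfolding resolved_configs_def by blast
    then show ?thesis unfolding root_dist_def by (intro root_k_harmonic constant_harmonic) simp_all
  qed
  finally show ?thesis .
qed

lemma gene_tree_dist_balanced4:
  assumes ne: "distinct [a, b, c, d]" and pos: "0 < x" "0 < y"
  defines "S0 \<equiv> cherry_unmerged a b \<union> cherry_unmerged c d"
  defines "R \<equiv> \<lambda>T. \<Sum>G\<in>cfgs {a, b, c, d}. root_dist S0 G * (if unroot {a, b, c, d} G = T then 1 else 0)"
  defines "Q \<equiv> \<lambda>T. if quartet_tree a b c d = T then 1 else (0::real)"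
  shows "gene_tree_dist (SNode z (SNode x (SLeaf a) (SLeaf b)) (SNode y (SLeaf c) (SLeaf d))) T
    = Q T + exp (- (x + y)) * (R T - Q T)"
proof -
  let ?l = "SNode x (SLeaf a) (SLeaf b)" and ?r = "SNode y (SLeaf c) (SLeaf d)" and ?X = "{a, b, c, d}"
  let ?F = "\<lambda>G. if unroot ?X G = T then 1 else (0::real)"
  have L: "sleaves (SNode z ?l ?r) = ?X" by auto
  have lr: "distinct (sleaf_list ?l)" "pos_below ?l" "distinct (sleaf_list ?r)" "pos_below ?r"
    using ne pos by auto
  have un: "unmerged {u, v} (cherry_unmerged u v) = 1" "unmerged {u, v} (cherry_merged u v) = 0" if "u \<noteq> v" for u v :: 'a
  proof -
    have "lineages_meeting {u, v} (cherry_unmerged u v) = cherry_unmerged u v"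
      "lineages_meeting {u, v} (cherry_merged u v) = cherry_merged u v"
      by (simp_all add: lineages_meeting_insert lineages_meeting_def[of _ "{}"])
    moreover have "card (cherry_unmerged u v) = 2" using that by (simp add: card_insert_if)
    ultimately show "unmerged {u, v} (cherry_unmerged u v) = 1" "unmerged {u, v} (cherry_merged u v) = 0"
      using that by (simp_all add: unmerged_def)
  qed
  have valid: "cherry_unmerged u v \<in> valid_configs {u, v}" "cherry_merged u v \<in> valid_configs {u, v}" if "u \<noteq> v" for u v :: 'a
  proof -
    have "{{{w}}} \<in> valid_configs {w}" for w :: 'a by (auto simp: valid_configs_def cfgs_def)
    from valid_configs_Un[OF this[of u] this[of v]] that
    show N: "cherry_unmerged u v \<in> valid_configs {u, v}" by (simp add: insert_commute)
    have "cherry_unmerged u v \<in> pairs (cherry_unmerged u v)" using that by (simp add: pairs_def card_insert_if)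
    from merge_pair_valid[OF N this] show "cherry_merged u v \<in> valid_configs {u, v}"
      by (simp add: merge_pair_def insert_commute)
  qed
  have res: "S1 \<union> S2 \<in> resolved_configs a b c d"
    if S: "S1 = cherry_unmerged a b \<or> S1 = cherry_merged a b" "S2 = cherry_unmerged c d \<or> S2 = cherry_merged c d"
      "S1 = cherry_merged a b \<or> S2 = cherry_merged c d" for S1 S2
  proof -
    have "S1 \<in> valid_configs {a, b}" "S2 \<in> valid_configs {c, d}" using valid[of a b] valid[of c d] S ne by auto
    then have "S1 \<union> S2 \<in> valid_configs ({a, b} \<union> {c, d})" using ne by (intro valid_configs_Un) auto
    then have V: "S1 \<union> S2 \<in> valid_configs ?X" by (simp add: insert_commute)
    have U1: "\<Union>S1 \<subseteq> {{a}, {b}, {a, b}}" "{{a}, {b}} \<subseteq> \<Union>S1" using S(1) by (elim disjE; simp)+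
    have U2: "\<Union>S2 \<subseteq> {{c}, {d}, {c, d}}" "{{c}, {d}} \<subseteq> \<Union>S2" using S(2) by (elim disjE; simp)+
    have "{a, b} \<in> \<Union>S1 \<or> {c, d} \<in> \<Union>S2" using S(3) by (elim disjE; simp)
    then have P: "{a, b} \<in> \<Union>(S1 \<union> S2) \<or> {c, d} \<in> \<Union>(S1 \<union> S2)"
      unfolding Union_Un_distrib by (metis UnI1 UnI2)
    have sup: "{{a}, {b}, {c}, {d}} \<subseteq> \<Union>(S1 \<union> S2)"
      unfolding Union_Un_distrib using Un_mono[OF U1(2) U2(2)] by (simp only: Un_insert_left Un_empty_left)
    have sub: "C \<in> {{a}, {b}, {a, b}} \<union> {{c}, {d}, {c, d}}" if "C \<in> \<Union>(S1 \<union> S2)" for C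
      using that Un_mono[OF U1(1) U2(1)] unfolding Union_Un_distrib by (rule subsetD[rotated])
    have "{} \<notin> \<Union>(S1 \<union> S2)" using sub[of "{}"] by auto
    moreover have "\<forall>C\<in>\<Union>(S1 \<union> S2). card C = 2 \<longrightarrow> C = {a, b} \<or> C = {c, d}"
    proof (intro ballI impI)
      fix C assume C: "C \<in> \<Union>(S1 \<union> S2)" and c2: "card C = 2"
      show "C = {a, b} \<or> C = {c, d}" using sub[OF C] c2 by (elim UnE insertE; simp)
    qed
    ultimately show ?thesis unfolding resolved_configs_def using V sup P by (intro CollectI conjI)
  qed
  have "gene_tree_dist (SNode z ?l ?r) T
      = join_expect ?l ?r (\<lambda>S1 S2. \<Sum>G\<in>cfgs ?X. root_dist (S1 \<union> S2) G * ?F G)"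
    unfolding gene_tree_dist_root_expect root_expect_SNode L ..
  also have "\<dots> = join_expect ?l ?r (\<lambda>S1 S2. Q T + (R T - Q T) * (unmerged {a, b} S1 * unmerged {c, d} S2))"
  proof (rule join_expect_cong_support)
    fix S1 S2 assume o: "out_dist ?l S1 \<noteq> 0" "out_dist ?r S2 \<noteq> 0"
    have S: "S1 = cherry_unmerged a b \<or> S1 = cherry_merged a b" "S2 = cherry_unmerged c d \<or> S2 = cherry_merged c d"
      using out_dist_cherry[OF o(1)] out_dist_cherry[OF o(2)] .
    show "(\<Sum>G\<in>cfgs ?X. root_dist (S1 \<union> S2) G * ?F G)
        = Q T + (R T - Q T) * (unmerged {a, b} S1 * unmerged {c, d} S2)"
    proof (cases "S1 = cherry_merged a b \<or> S2 = cherry_merged c d")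
      case True
      then have "unmerged {a, b} S1 * unmerged {c, d} S2 = 0" using un[of a b] un[of c d] ne by auto
      then show ?thesis using root_expectation_resolved[OF ne res[OF S True], of T] by (simp add: Q_def)
    next
      case False
      then have "S1 = cherry_unmerged a b" "S2 = cherry_unmerged c d" using S by auto
      moreover have "unmerged {a, b} (cherry_unmerged a b) * unmerged {c, d} (cherry_unmerged c d) = 1"
        using un[of a b] un[of c d] ne by simp
      ultimately show ?thesis by (simp only: R_def S0_def) simp
    qed
  qed
  also have "\<dots> = Q T + (R T - Q T) * (exp (- x) * exp (- y))"
  proof -
    have "out_expect ?l (unmerged {a, b}) = exp (- x)" "out_expect ?r (unmerged {c, d}) = exp (- y)"
      using out_expect_unmerged_doubleton[OF lr(1,2), of a b] out_expect_unmerged_doubleton[OF lr(3,4), of c d] ne by auto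
    moreover have "join_expect ?l ?r (\<lambda>S1 S2. Q T) = Q T"
      using join_expect_left[OF lr(3,4), of ?l "\<lambda>_. Q T"] out_expect_const[OF lr(1,2), of "Q T"] by simp
    ultimately show ?thesis unfolding join_expect_add join_expect_cmult join_expect_mult by simp
  qed
  finally show ?thesis by (simp add: mult_exp_exp algebra_simps)
qed

lemma rooted_tree_not_identifiable:
  assumes "card X = 4"
  shows "\<exists>t1 t2. rmst X t1 \<and> rmst X t2 \<and> gene_tree_dist t1 = gene_tree_dist t2 \<and> \<not> rooted_eq t1 t2"
proof -
  obtain xs where xs: "set xs = X" "distinct xs"
    using finite_distinct_list[of X] assms by (metis card_ge_0_finite zero_less_numeral)
  then have "length xs = 4" using distinct_card assms by metis
  then obtain a b c d where "xs = [a, b, c, d]" by (auto simp: eval_nat_numeral length_Suc_conv)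
  then have X: "X = {a, b, c, d}" and ne: "distinct [a, b, c, d]" using xs by auto
  let ?t = "\<lambda>x y. SNode 1 (SNode x (SLeaf a) (SLeaf b)) (SNode y (SLeaf c) (SLeaf d))"
  have "rmst X (?t 1 2)" "rmst X (?t 2 1)" using X ne by (auto simp: rmst_def)
  moreover have "gene_tree_dist (?t 1 2) = gene_tree_dist (?t 2 1)"
    by (rule ext) (simp add: gene_tree_dist_balanced4[OF ne])
  moreover have "\<not> rooted_eq (?t 1 2) (?t 2 1)"
  proof
    assume eq: "rooted_eq (?t 1 2) (?t 2 1)"
    have nz: "({a, b} = Z) = False" if "c \<in> Z" for Z using that ne by auto
    have "{a, b} \<in> internal_clusters (?t 1 2)"
      unfolding internal_clusters_def using ne by (simp add: nz doubleton_eq_iff)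
    then have "elen (?t 1 2) {a, b} = elen (?t 2 1) {a, b}" using eq unfolding rooted_eq_def by blast
    then show False using ne by (simp add: nz doubleton_eq_iff)
  qed
  ultimately show ?thesis by blast
qed

theorem theorem1:
  fixes X :: "'a set"
  shows "(card X \<ge> 5 \<longrightarrow>
            (\<forall>t1 t2. rmst X t1 \<and> rmst X t2 \<and> gene_tree_dist t1 = gene_tree_dist t2
                \<longrightarrow> rooted_eq t1 t2))
       \<and> (card X = 4 \<longrightarrow>
            (\<forall>t1 t2. rmst X t1 \<and> rmst X t2 \<and> gene_tree_dist t1 = gene_tree_dist t2
                \<longrightarrow> unrooted_eq t1 t2)
          \<and> (\<exists>t1 t2. rmst X t1 \<and> rmst X t2 \<and> gene_tree_dist t1 = gene_tree_dist t2
                \<and> \<not> rooted_eq t1 t2))"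
  using rooted_tree_identifiable[of X] unrooted_tree_identifiable[of X] rooted_tree_not_identifiable[of X]
  by blast

end
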